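(* Let $k$ be a finite field and let $(\mathscr C,\mathbb E,\mathfrak s)$ be an extriangulated category, where $\mathscr C$ is an essentially small Krull–Schmidt additive $k$-linear category. Assume: (a) $\mathscr C$ has enough projective objects and enough injective objects; (b) for all $X,Y\in\mathscr C$ and $d\in\{\mathrm I,\mathrm{II}\}$ one has $\dim_k\mathbb E_d^{i}(X,Y)<\infty$ for every $i\le 0$ and $\sum_{i\le 0}\dim_k\mathbb E_d^{i}(X,Y)<\infty$; (c) $\mathrm{Hom}(I,x)$ is a monomorphism for every injective object $I$ and every inflation $x$; (d) $\mathrm{Hom}(y,P)$ is a monomorphism for every projective object $P$ and every deflation $y$. Let $\overline{\mathcal H}(\mathscr C)$ be the $\mathbb Q$-vector space with basis $\{u_{[X]}\mid X\in\mathscr C\}$ indexed by the isomorphism classes of objects of $\mathscr C$, with the bilinear multiplication $$u_{[X]}\diamond u_{[Y]}=\sum_{[L]}G_{XY}^L\,u_{[L]},\qquad G_{XY}^L:=\frac{|{}_X(L,Y)|}{|\mathrm{Aut}\,Y|}\frac{\{L,Y\}}{\{Y,Y\}}=\frac{|(X,L)_Y|}{|\mathrm{Aut}\,X|}\frac{\{X,L\}}{\{X,X\}}$$ (the two expressions for $G_{XY}^L$ agree). Then $\overline{\mathcal H}(\mathscr C)$ is an associative algebra.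
   Context: An extriangulated category (Nakaoka–Palu) is a triple $(\mathscr C,\mathbb E,\mathfrak s)$ as follows. (ET1) $\mathscr C$ is additive and $\mathbb E:\mathscr C^{op}\times\mathscr C\to Ab$ is a biadditive functor; elements $\delta\in\mathbb E(C,A)$ are called extensions; for $a:A\to A'$, $c:C'\to C$ put $a_*\delta=\mathbb E(C,a)(\delta)$, $c^*\delta=\mathbb E(c,A)(\delta)$; a morphism from $\delta\in\mathbb E(C,A)$ to $\delta'\in\mathbb E(C',A')$ is a pair $(a:A\to A',c:C\to C')$ with $a_*\delta=c^*\delta'$. (ET2) $\mathfrak s$ assigns to each $\delta\in\mathbb E(C,A)$ an equivalence class $[A\to B\to C]$ of sequences (two sequences $A\to B\to C$ and $A\to B'\to C$ are equivalent if there is an isomorphism $B\cong B'$ compatible with the identities of $A$ and $C$), such that every morphism $(a,c):\delta\to\delta'$ is realized by some $(a,b,c)$ making both squares between representing sequences commute, $\mathfrak s(0)$ is the class of the split sequence $A\to A\oplus C\to C$, and $\mathfrak s(\delta\oplus\delta')=\mathfrak s(\delta)\oplus\mathfrak s(\delta')$. (ET3) If $\mathfrak s(\delta)=[A\xrightarrow{x}B\xrightarrow{y}C]$, $\mathfrak s(\delta')=[A'\xrightarrow{x'}B'\xrightarrow{y'}C']$ and $bx=x'a$, there is $c$ with $cy=y'b$ and $a_*\delta=c^*\delta'$. (ET4) If $\delta\in\mathbb E(D,A)$, $\delta'\in\mathbb E(F,B)$ are realized by $A\xrightarrow{f}B\xrightarrow{f'}D$ and $B\xrightarrow{g}C\xrightarrow{g'}F$,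 there are an object $E$, an extension $\delta''\in\mathbb E(E,A)$ realized by $A\xrightarrow{h}C\xrightarrow{h'}E$ with $h=gf$, and a sequence $D\xrightarrow{d}E\xrightarrow{e}F$ realizing $f'_*\delta'$, with $h'g=df'$, $eh'=g'$, $d^*\delta''=\delta$, $f_*\delta''=e^*\delta'$. The duals of (ET3) and (ET4) also hold. If $\mathfrak s(\delta)=[A\xrightarrow{x}B\xrightarrow{y}C]$, then $A\xrightarrow{x}B\xrightarrow{y}C\overset{\delta}{\dashrightarrow}$ is called an $\mathbb E$-triangle, $x$ an inflation, $y$ a deflation, $C=\mathrm{cone}(x)$ and $A=\mathrm{cocone}(y)$ (well defined up to isomorphism). An object $P$ is projective if for every deflation $y:B\to C$ every morphism $P\to C$ factors through $y$; injective objects are defined dually. $\mathscr C$ has enough projective objects if every $M$ admits an $\mathbb E$-triangle $A\to P\to M\dashrightarrow$ with $P$ projective; dually for enough injective objects. A morphism $f$ is projective if $\mathbb E(f,-)=f^*$ is zero, and injective if $\mathbb E(-,f)=f_*$ is zero. (If there are enough projective objects, every $C$ admits a deflation $G\to C$ that is a projective morphism; dually for injectives.) Negative extensions (Gorsky–Nakaoka–Palu), up to natural isomorphism: $\mathbb E^0_{\mathrm I}=\mathbb E^0_{\mathrm{II}}=\mathrm{Hom}$. For $n\ge1$ and an $\mathbb E$-triangle $K\to G\xrightarrow{g}C\dashrightarrow$ with $g$ a projective morphism, $\mathbb E_{\mathrm I}^{-n}(X,C)=\mathrm{Ker}\big(\mathbb E_{\mathrm I}^{-n+1}(X,K)\to\mathbb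 E_{\mathrm I}^{-n+1}(X,G)\big)$. Dually, for an $\mathbb E$-triangle $A\xrightarrow{j}J\to S\dashrightarrow$ with $j$ an injective morphism, $\mathbb E_{\mathrm{II}}^{-n}(A,X)=\mathrm{Ker}\big(\mathbb E_{\mathrm{II}}^{-n+1}(S,X)\to\mathbb E_{\mathrm{II}}^{-n+1}(J,X)\big)$. These do not depend on the choices, up to isomorphism. Notation: $(X,L)_Y$ is the set of inflations $f:X\to L$ with $\mathrm{cone}(f)\cong Y$; ${}_X(L,Y)$ is the set of deflations $g:L\to Y$ with $\mathrm{cocone}(g)\cong X$. Put $\{X,Y\}_d:=\prod_{i>0}|\mathbb E_d^{-i}(X,Y)|^{(-1)^i}$ for $d\in\{\mathrm I,\mathrm{II}\}$. Under the assumptions of the claim $\dim_k\mathbb E_{\mathrm I}^{i}(X,Y)=\dim_k\mathbb E_{\mathrm{II}}^{i}(X,Y)$ for all $i<0$ (Gorsky–Nakaoka–Palu), so $\{X,Y\}_{\mathrm I}=\{X,Y\}_{\mathrm{II}}$, and this common value is denoted $\{X,Y\}$. $[X]$ denotes the isomorphism class of $X$. *)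

theory Defs
  imports
    Complex_Main
    "HOL-Algebra.Module"
    "Jordan_Normal_Form.Missing_VectorSpace"
begin

section \<open>Extriangulated categories\<close>

text \<open>
  The data of a \<open>k\<close>-linear category \<open>\<C>\<close> with a bifunctor \<open>\<E>\<close> and a realization \<open>\<s>\<close>.
  Hom-sets are pairwise disjoint (see \<open>hom_disjoint\<close> below), so composition needs no object indices;
  for the sets \<open>\<E>(Z,A)\<close> no disjointness is required.
  \<^item> \<open>Hom C X Y\<close> is the \<open>k\<close>-vector space \<open>Hom(X,Y)\<close>, and \<open>Ext C Z A\<close> the abelian group \<open>\<E>(Z,A)\<close>.
    Of these records only the additive part (and scalar multiplication) is used.
  \<^item> \<open>Emap C c a\<close> is \<open>\<E>(c,a) : \<E>(Z,A) \<rightarrow> \<E>(Z',A')\<close> for \<open>c : Z' \<rightarrow> Z\<close> and \<open>a : A \<rightarrow> A'\<close>.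
  \<^item> \<open>Rlz C Z A \<delta>\<close> is the class \<open>\<s>(\<delta>)\<close>; a sequence \<open>A \<rightarrow> B \<rightarrow> Z\<close> is represented by its two morphisms.
\<close>

record ('k, 'o, 'm, 'e) ext_data =
  Obj :: "'o set"
  Hom :: "'o \<Rightarrow> 'o \<Rightarrow> ('k, 'm) module"
  cmp :: "'m \<Rightarrow> 'm \<Rightarrow> 'm"  (infixr \<open>\<cdot>\<index>\<close> 75)
  idm :: "'o \<Rightarrow> 'm"
  Ext :: "'o \<Rightarrow> 'o \<Rightarrow> 'e ring"
  Emap :: "'m \<Rightarrow> 'm \<Rightarrow> 'e \<Rightarrow> 'e"
  Rlz :: "'o \<Rightarrow> 'o \<Rightarrow> 'e \<Rightarrow> ('m \<times> 'm) set"

abbreviation arr :: "('k, 'o, 'm, 'e) ext_data \<Rightarrow> 'o \<Rightarrow> 'o \<Rightarrow> 'm set" where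
  "arr C X Y \<equiv> carrier (Hom C X Y)"

abbreviation exts :: "('k, 'o, 'm, 'e) ext_data \<Rightarrow> 'o \<Rightarrow> 'o \<Rightarrow> 'e set" where
  "exts C Z A \<equiv> carrier (Ext C Z A)"

definition opp :: "('k, 'o, 'm, 'e) ext_data \<Rightarrow> ('k, 'o, 'm, 'e) ext_data" where
  "opp C = \<lparr> Obj = Obj C,
             Hom = (\<lambda>X Y. Hom C Y X),
             cmp = (\<lambda>g f. f \<cdot>\<^bsub>C\<^esub> g),
             idm = idm C,
             Ext = (\<lambda>Z A. Ext C A Z),
             Emap = (\<lambda>c a. Emap C a c),
             Rlz = (\<lambda>Z A \<delta>. {(x, y). (y, x) \<in> Rlz C A Z \<delta>}) \<rparr>"

locale linear_category =
  fixes K :: "'k ring" and C :: "('k, 'o, 'm, 'e) ext_data"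
  assumes hom_vectorspace: "\<lbrakk>X \<in> Obj C; Y \<in> Obj C\<rbrakk> \<Longrightarrow> vectorspace K (Hom C X Y)"
    and hom_disjoint:
      "\<lbrakk>X \<in> Obj C; Y \<in> Obj C; X' \<in> Obj C; Y' \<in> Obj C; f \<in> arr C X Y; f \<in> arr C X' Y'\<rbrakk>
        \<Longrightarrow> X = X' \<and> Y = Y'"
    and id_closed: "X \<in> Obj C \<Longrightarrow> idm C X \<in> arr C X X"
    and comp_closed:
      "\<lbrakk>X \<in> Obj C; Y \<in> Obj C; Z \<in> Obj C; f \<in> arr C X Y; g \<in> arr C Y Z\<rbrakk> \<Longrightarrow> g \<cdot>\<^bsub>C\<^esub> f \<in> arr C X Z"
    and id_left: "\<lbrakk>X \<in> Obj C; Y \<in> Obj C; f \<in> arr C X Y\<rbrakk> \<Longrightarrow> idm C Y \<cdot>\<^bsub>C\<^esub> f = f"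
    and id_right: "\<lbrakk>X \<in> Obj C; Y \<in> Obj C; f \<in> arr C X Y\<rbrakk> \<Longrightarrow> f \<cdot>\<^bsub>C\<^esub> idm C X = f"
    and comp_assoc:
      "\<lbrakk>W \<in> Obj C; X \<in> Obj C; Y \<in> Obj C; Z \<in> Obj C; f \<in> arr C W X; g \<in> arr C X Y; h \<in> arr C Y Z\<rbrakk>
        \<Longrightarrow> (h \<cdot>\<^bsub>C\<^esub> g) \<cdot>\<^bsub>C\<^esub> f = h \<cdot>\<^bsub>C\<^esub> (g \<cdot>\<^bsub>C\<^esub> f)"
    and comp_add_right:
      "\<lbrakk>X \<in> Obj C; Y \<in> Obj C; Z \<in> Obj C; f \<in> arr C X Y; f' \<in> arr C X Y; g \<in> arr C Y Z\<rbrakk>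
        \<Longrightarrow> g \<cdot>\<^bsub>C\<^esub> (f \<oplus>\<^bsub>Hom C X Y\<^esub> f') = (g \<cdot>\<^bsub>C\<^esub> f) \<oplus>\<^bsub>Hom C X Z\<^esub> (g \<cdot>\<^bsub>C\<^esub> f')"
    and comp_add_left:
      "\<lbrakk>X \<in> Obj C; Y \<in> Obj C; Z \<in> Obj C; f \<in> arr C X Y; g \<in> arr C Y Z; g' \<in> arr C Y Z\<rbrakk>
        \<Longrightarrow> (g \<oplus>\<^bsub>Hom C Y Z\<^esub> g') \<cdot>\<^bsub>C\<^esub> f = (g \<cdot>\<^bsub>C\<^esub> f) \<oplus>\<^bsub>Hom C X Z\<^esub> (g' \<cdot>\<^bsub>C\<^esub> f)"
    and comp_smult_right:
      "\<lbrakk>X \<in> Obj C; Y \<in> Obj C; Z \<in> Obj C; f \<in> arr C X Y; g \<in> arr C Y Z; r \<in> carrier K\<rbrakk>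
        \<Longrightarrow> g \<cdot>\<^bsub>C\<^esub> (r \<odot>\<^bsub>Hom C X Y\<^esub> f) = r \<odot>\<^bsub>Hom C X Z\<^esub> (g \<cdot>\<^bsub>C\<^esub> f)"
    and comp_smult_left:
      "\<lbrakk>X \<in> Obj C; Y \<in> Obj C; Z \<in> Obj C; f \<in> arr C X Y; g \<in> arr C Y Z; r \<in> carrier K\<rbrakk>
        \<Longrightarrow> (r \<odot>\<^bsub>Hom C Y Z\<^esub> g) \<cdot>\<^bsub>C\<^esub> f = r \<odot>\<^bsub>Hom C X Z\<^esub> (g \<cdot>\<^bsub>C\<^esub> f)"

definition zero_object :: "('k, 'o, 'm, 'e) ext_data \<Rightarrow> 'o \<Rightarrow> bool" where
  "zero_object C Z \<longleftrightarrow> Z \<in> Obj C \<and> idm C Z = \<zero>\<^bsub>Hom C Z Z\<^esub>"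

text \<open>\<open>S = A \<oplus> B\<close> with injections \<open>i\<close>, \<open>j\<close> and projections \<open>p\<close>, \<open>q\<close>.\<close>

definition biproduct ::
  "('k, 'o, 'm, 'e) ext_data \<Rightarrow> 'o \<Rightarrow> 'o \<Rightarrow> 'o \<Rightarrow> 'm \<Rightarrow> 'm \<Rightarrow> 'm \<Rightarrow> 'm \<Rightarrow> bool" where
  "biproduct C A B S i j p q \<longleftrightarrow>
     A \<in> Obj C \<and> B \<in> Obj C \<and> S \<in> Obj C \<and>
     i \<in> arr C A S \<and> j \<in> arr C B S \<and> p \<in> arr C S A \<and> q \<in> arr C S B \<and>
     p \<cdot>\<^bsub>C\<^esub> i = idm C A \<and> q \<cdot>\<^bsub>C\<^esub> j = idm C B \<and>
     q \<cdot>\<^bsub>C\<^esub> i = \<zero>\<^bsub>Hom C A B\<^esub> \<and> p \<cdot>\<^bsub>C\<^esub> j = \<zero>\<^bsub>Hom C B A\<^esub> \<and>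
     (i \<cdot>\<^bsub>C\<^esub> p) \<oplus>\<^bsub>Hom C S S\<^esub> (j \<cdot>\<^bsub>C\<^esub> q) = idm C S"

locale additive_linear_category = linear_category +
  assumes ex_zero_object: "\<exists>Z. zero_object C Z"
    and ex_biproduct: "\<lbrakk>A \<in> Obj C; B \<in> Obj C\<rbrakk> \<Longrightarrow> \<exists>S i j p q. biproduct C A B S i j p q"

definition iso_arr :: "('k, 'o, 'm, 'e) ext_data \<Rightarrow> 'o \<Rightarrow> 'o \<Rightarrow> 'm \<Rightarrow> bool" where
  "iso_arr C X Y f \<longleftrightarrow> f \<in> arr C X Y \<and>
     (\<exists>g \<in> arr C Y X. g \<cdot>\<^bsub>C\<^esub> f = idm C X \<and> f \<cdot>\<^bsub>C\<^esub> g = idm C Y)"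

definition isomorphic :: "('k, 'o, 'm, 'e) ext_data \<Rightarrow> 'o \<Rightarrow> 'o \<Rightarrow> bool" where
  "isomorphic C X Y \<longleftrightarrow> (\<exists>f. iso_arr C X Y f)"

definition Aut :: "('k, 'o, 'm, 'e) ext_data \<Rightarrow> 'o \<Rightarrow> 'm set" where
  "Aut C X = {f. iso_arr C X X f}"

definition pushout_ext :: "('k, 'o, 'm, 'e) ext_data \<Rightarrow> 'o \<Rightarrow> 'm \<Rightarrow> 'e \<Rightarrow> 'e" where
  \<comment> \<open>\<open>a\<^sub>*\<delta>\<close> for \<open>\<delta> \<in> \<E>(Z,A)\<close>\<close>
  "pushout_ext C Z a \<delta> = Emap C (idm C Z) a \<delta>"

definition pullback_ext :: "('k, 'o, 'm, 'e) ext_data \<Rightarrow> 'o \<Rightarrow> 'm \<Rightarrow> 'e \<Rightarrow> 'e" where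
  \<comment> \<open>\<open>c\<^sup>*\<delta>\<close> for \<open>\<delta> \<in> \<E>(Z,A)\<close>\<close>
  "pullback_ext C A c \<delta> = Emap C c (idm C A) \<delta>"

definition seqs :: "('k, 'o, 'm, 'e) ext_data \<Rightarrow> 'o \<Rightarrow> 'o \<Rightarrow> ('m \<times> 'm) set" where
  "seqs C A Z = {(x, y). \<exists>B \<in> Obj C. x \<in> arr C A B \<and> y \<in> arr C B Z}"

definition seq_equiv :: "('k, 'o, 'm, 'e) ext_data \<Rightarrow> 'o \<Rightarrow> 'o \<Rightarrow> (('m \<times> 'm) \<times> ('m \<times> 'm)) set" where
  "seq_equiv C A Z = {((x, y), (x', y')). \<exists>B \<in> Obj C. \<exists>B' \<in> Obj C. \<exists>b.
     x \<in> arr C A B \<and> y \<in> arr C B Z \<and> x' \<in> arr C A B' \<and> y' \<in> arr C B' Z \<and>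
     iso_arr C B B' b \<and> b \<cdot>\<^bsub>C\<^esub> x = x' \<and> y' \<cdot>\<^bsub>C\<^esub> b = y}"

text \<open>The \<open>\<E>\<close>-triangle \<open>A \<rightarrow> B \<rightarrow> Z \<dashrightarrow>\<close> with morphisms \<open>x\<close>, \<open>y\<close> and extension \<open>\<delta>\<close>.\<close>

definition etriangle ::
  "('k, 'o, 'm, 'e) ext_data \<Rightarrow> 'o \<Rightarrow> 'o \<Rightarrow> 'o \<Rightarrow> 'm \<Rightarrow> 'm \<Rightarrow> 'e \<Rightarrow> bool" where
  "etriangle C A B Z x y \<delta> \<longleftrightarrow>
     A \<in> Obj C \<and> B \<in> Obj C \<and> Z \<in> Obj C \<and> x \<in> arr C A B \<and> y \<in> arr C B Z \<and>
     \<delta> \<in> exts C Z A \<and> (x, y) \<in> Rlz C Z A \<delta>"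

definition ET3 :: "('k, 'o, 'm, 'e) ext_data \<Rightarrow> bool" where
  "ET3 C \<longleftrightarrow> (\<forall>A B Z x y \<delta> A' B' Z' x' y' \<delta>' a b.
     etriangle C A B Z x y \<delta> \<and> etriangle C A' B' Z' x' y' \<delta>' \<and>
     a \<in> arr C A A' \<and> b \<in> arr C B B' \<and> b \<cdot>\<^bsub>C\<^esub> x = x' \<cdot>\<^bsub>C\<^esub> a \<longrightarrow>
     (\<exists>c \<in> arr C Z Z'. c \<cdot>\<^bsub>C\<^esub> y = y' \<cdot>\<^bsub>C\<^esub> b \<and>
        pushout_ext C Z a \<delta> = pullback_ext C A' c \<delta>'))"

definition ET4 :: "('k, 'o, 'm, 'e) ext_data \<Rightarrow> bool" where
  "ET4 C \<longleftrightarrow> (\<forall>A B D Y F f f' g g' \<delta> \<delta>'.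
     etriangle C A B D f f' \<delta> \<and> etriangle C B Y F g g' \<delta>' \<longrightarrow>
     (\<exists>E h h' d e \<delta>''.
        etriangle C A Y E h h' \<delta>'' \<and> h = g \<cdot>\<^bsub>C\<^esub> f \<and>
        etriangle C D E F d e (pushout_ext C F f' \<delta>') \<and>
        h' \<cdot>\<^bsub>C\<^esub> g = d \<cdot>\<^bsub>C\<^esub> f' \<and> e \<cdot>\<^bsub>C\<^esub> h' = g' \<and>
        pullback_ext C A d \<delta>'' = \<delta> \<and>
        pushout_ext C E f \<delta>'' = pullback_ext C B e \<delta>'))"

locale extriangulated_category = additive_linear_category +
  assumes ext_abelian_group: "\<lbrakk>Z \<in> Obj C; A \<in> Obj C\<rbrakk> \<Longrightarrow> abelian_group (Ext C Z A)"
    and Emap_closed: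
      "\<lbrakk>Z \<in> Obj C; Z' \<in> Obj C; A \<in> Obj C; A' \<in> Obj C; c \<in> arr C Z' Z; a \<in> arr C A A'; \<delta> \<in> exts C Z A\<rbrakk>
        \<Longrightarrow> Emap C c a \<delta> \<in> exts C Z' A'"
    and Emap_add:
      "\<lbrakk>Z \<in> Obj C; Z' \<in> Obj C; A \<in> Obj C; A' \<in> Obj C; c \<in> arr C Z' Z; a \<in> arr C A A';
        \<delta> \<in> exts C Z A; \<delta>' \<in> exts C Z A\<rbrakk>
        \<Longrightarrow> Emap C c a (\<delta> \<oplus>\<^bsub>Ext C Z A\<^esub> \<delta>') = Emap C c a \<delta> \<oplus>\<^bsub>Ext C Z' A'\<^esub> Emap C c a \<delta>'"
    and Emap_id:
      "\<lbrakk>Z \<in> Obj C; A \<in> Obj C; \<delta> \<in> exts C Z A\<rbrakk> \<Longrightarrow> Emap C (idm C Z) (idm C A) \<delta> = \<delta>"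
    and Emap_comp:
      "\<lbrakk>Z \<in> Obj C; Z' \<in> Obj C; Z'' \<in> Obj C; A \<in> Obj C; A' \<in> Obj C; A'' \<in> Obj C;
        c \<in> arr C Z' Z; c' \<in> arr C Z'' Z'; a \<in> arr C A A'; a' \<in> arr C A' A''; \<delta> \<in> exts C Z A\<rbrakk>
        \<Longrightarrow> Emap C (c \<cdot>\<^bsub>C\<^esub> c') (a' \<cdot>\<^bsub>C\<^esub> a) \<delta> = Emap C c' a' (Emap C c a \<delta>)"
    and Emap_biadditive_left:
      "\<lbrakk>Z \<in> Obj C; Z' \<in> Obj C; A \<in> Obj C; A' \<in> Obj C;
        c \<in> arr C Z' Z; c' \<in> arr C Z' Z; a \<in> arr C A A'; \<delta> \<in> exts C Z A\<rbrakk>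
        \<Longrightarrow> Emap C (c \<oplus>\<^bsub>Hom C Z' Z\<^esub> c') a \<delta> = Emap C c a \<delta> \<oplus>\<^bsub>Ext C Z' A'\<^esub> Emap C c' a \<delta>"
    and Emap_biadditive_right:
      "\<lbrakk>Z \<in> Obj C; Z' \<in> Obj C; A \<in> Obj C; A' \<in> Obj C;
        c \<in> arr C Z' Z; a \<in> arr C A A'; a' \<in> arr C A A'; \<delta> \<in> exts C Z A\<rbrakk>
        \<Longrightarrow> Emap C c (a \<oplus>\<^bsub>Hom C A A'\<^esub> a') \<delta> = Emap C c a \<delta> \<oplus>\<^bsub>Ext C Z' A'\<^esub> Emap C c a' \<delta>"
    and Rlz_class:
      "\<lbrakk>Z \<in> Obj C; A \<in> Obj C; \<delta> \<in> exts C Z A\<rbrakk> \<Longrightarrow> Rlz C Z A \<delta> \<in> seqs C A Z // seq_equiv C A Z"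
    and Rlz_morphism:
      "\<lbrakk>etriangle C A B Z x y \<delta>; etriangle C A' B' Z' x' y' \<delta>'; a \<in> arr C A A'; c \<in> arr C Z Z';
        pushout_ext C Z a \<delta> = pullback_ext C A' c \<delta>'\<rbrakk>
        \<Longrightarrow> \<exists>b \<in> arr C B B'. b \<cdot>\<^bsub>C\<^esub> x = x' \<cdot>\<^bsub>C\<^esub> a \<and> y' \<cdot>\<^bsub>C\<^esub> b = c \<cdot>\<^bsub>C\<^esub> y"
    and Rlz_zero: "biproduct C A Z S i j p q \<Longrightarrow> (i, q) \<in> Rlz C Z A \<zero>\<^bsub>Ext C Z A\<^esub>"
    \<comment> \<open>\<open>\<delta> \<oplus> \<delta>'\<close> is the element of \<open>\<E>(Z \<oplus> Z', A \<oplus> A')\<close> with components \<open>(\<delta>, 0, 0, \<delta>')\<close>\<close>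
    and Rlz_sum:
      "\<lbrakk>etriangle C A B Z x y \<delta>; etriangle C A' B' Z' x' y' \<delta>';
        biproduct C A A' SA iA jA pA qA; biproduct C B B' SB iB jB pB qB;
        biproduct C Z Z' SZ iZ jZ pZ qZ\<rbrakk>
        \<Longrightarrow> ((iB \<cdot>\<^bsub>C\<^esub> x \<cdot>\<^bsub>C\<^esub> pA) \<oplus>\<^bsub>Hom C SA SB\<^esub> (jB \<cdot>\<^bsub>C\<^esub> x' \<cdot>\<^bsub>C\<^esub> qA),
             (iZ \<cdot>\<^bsub>C\<^esub> y \<cdot>\<^bsub>C\<^esub> pB) \<oplus>\<^bsub>Hom C SB SZ\<^esub> (jZ \<cdot>\<^bsub>C\<^esub> y' \<cdot>\<^bsub>C\<^esub> qB))
            \<in> Rlz C SZ SA (Emap C pZ iA \<delta> \<oplus>\<^bsub>Ext C SZ SA\<^esub> Emap C qZ jA \<delta>')"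
    and ET3: "ET3 C"
    and ET3_op: "ET3 (opp C)"
    and ET4: "ET4 C"
    and ET4_op: "ET4 (opp C)"


section \<open>Krull--Schmidt property, projectives and injectives\<close>

definition local_ring :: "('a, 'r) ring_scheme \<Rightarrow> bool" where
  "local_ring R \<longleftrightarrow> ring R \<and> \<one>\<^bsub>R\<^esub> \<noteq> \<zero>\<^bsub>R\<^esub> \<and>
     (\<forall>a \<in> carrier R - Units R. \<forall>b \<in> carrier R - Units R. a \<oplus>\<^bsub>R\<^esub> b \<notin> Units R)"

definition End_ring :: "('k, 'o, 'm, 'e) ext_data \<Rightarrow> 'o \<Rightarrow> 'm ring" where
  "End_ring C X = \<lparr> carrier = arr C X X, mult = cmp C, one = idm C X,
                    zero = \<zero>\<^bsub>Hom C X X\<^esub>, add = add (Hom C X X) \<rparr>"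

definition krull_schmidt :: "('k, 'o, 'm, 'e) ext_data \<Rightarrow> bool" where
  "krull_schmidt C \<longleftrightarrow> (\<forall>X \<in> Obj C. \<exists>(n::nat) Y i p.
     (\<forall>t<n. Y t \<in> Obj C \<and> local_ring (End_ring C (Y t)) \<and>
            i t \<in> arr C (Y t) X \<and> p t \<in> arr C X (Y t)) \<and>
     (\<forall>s<n. \<forall>t<n. p s \<cdot>\<^bsub>C\<^esub> i t = (if s = t then idm C (Y t) else \<zero>\<^bsub>Hom C (Y t) (Y s)\<^esub>)) \<and>
     finsum (Hom C X X) (\<lambda>t. i t \<cdot>\<^bsub>C\<^esub> p t) {..<n} = idm C X)"

definition inflation :: "('k, 'o, 'm, 'e) ext_data \<Rightarrow> 'o \<Rightarrow> 'o \<Rightarrow> 'm \<Rightarrow> bool" where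
  "inflation C A B x \<longleftrightarrow> (\<exists>Z y \<delta>. etriangle C A B Z x y \<delta>)"

definition deflation :: "('k, 'o, 'm, 'e) ext_data \<Rightarrow> 'o \<Rightarrow> 'o \<Rightarrow> 'm \<Rightarrow> bool" where
  "deflation C B Z y \<longleftrightarrow> (\<exists>A x \<delta>. etriangle C A B Z x y \<delta>)"

definition projective :: "('k, 'o, 'm, 'e) ext_data \<Rightarrow> 'o \<Rightarrow> bool" where
  "projective C P \<longleftrightarrow> P \<in> Obj C \<and>
     (\<forall>B Z y. deflation C B Z y \<longrightarrow> (\<forall>f \<in> arr C P Z. \<exists>g \<in> arr C P B. y \<cdot>\<^bsub>C\<^esub> g = f))"

definition injective :: "('k, 'o, 'm, 'e) ext_data \<Rightarrow> 'o \<Rightarrow> bool" where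
  "injective C I \<longleftrightarrow> I \<in> Obj C \<and>
     (\<forall>A B x. inflation C A B x \<longrightarrow> (\<forall>f \<in> arr C A I. \<exists>g \<in> arr C B I. g \<cdot>\<^bsub>C\<^esub> x = f))"

definition enough_projectives :: "('k, 'o, 'm, 'e) ext_data \<Rightarrow> bool" where
  "enough_projectives C \<longleftrightarrow>
     (\<forall>M \<in> Obj C. \<exists>A P x y \<delta>. etriangle C A P M x y \<delta> \<and> projective C P)"

definition enough_injectives :: "('k, 'o, 'm, 'e) ext_data \<Rightarrow> bool" where
  "enough_injectives C \<longleftrightarrow>
     (\<forall>M \<in> Obj C. \<exists>I Z x y \<delta>. etriangle C M I Z x y \<delta> \<and> injective C I)"


section \<open>Negative extensions\<close>

definition projective_morphism :: "('k, 'o, 'm, 'e) ext_data \<Rightarrow> 'o \<Rightarrow> 'o \<Rightarrow> 'm \<Rightarrow> bool" where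
  "projective_morphism C X Y f \<longleftrightarrow> f \<in> arr C X Y \<and>
     (\<forall>A \<in> Obj C. \<forall>\<delta> \<in> exts C Y A. pullback_ext C A f \<delta> = \<zero>\<^bsub>Ext C X A\<^esub>)"

text \<open>
  A choice, for every object \<open>Y\<close>, of an \<open>\<E>\<close>-triangle \<open>K \<rightarrow> G \<rightarrow> Y \<dashrightarrow>\<close> with morphisms \<open>k\<close>, \<open>g\<close>
  and extension \<open>d\<close>, in which \<open>g\<close> is a projective morphism.
\<close>

record ('o, 'm, 'e) syzygies =
  sK :: "'o \<Rightarrow> 'o"
  sG :: "'o \<Rightarrow> 'o"
  sk :: "'o \<Rightarrow> 'm"
  sg :: "'o \<Rightarrow> 'm"
  sd :: "'o \<Rightarrow> 'e"

definition syzygy_choice :: "('k, 'o, 'm, 'e) ext_data \<Rightarrow> ('o, 'm, 'e) syzygies \<Rightarrow> bool" where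
  "syzygy_choice C S \<longleftrightarrow> (\<forall>Y \<in> Obj C.
     etriangle C (sK S Y) (sG S Y) Y (sk S Y) (sg S Y) (sd S Y) \<and>
     projective_morphism C (sG S Y) Y (sg S Y))"

text \<open>
  A morphism \<open>f : Y \<rightarrow> Y'\<close> lifts to a morphism of the chosen \<open>\<E>\<close>-triangles. Its component
  \<open>f' : K \<rightarrow> K'\<close>, which satisfies \<open>f'\<^sub>*d = f\<^sup>*d'\<close>, is unique up to morphisms factoring through
  \<open>k : K \<rightarrow> G\<close>. Hence the map that it induces on \<open>\<E>\<^sup>-\<^sup>n(X,Y)\<close>, a subset of
  \<open>\<E>\<^sup>-\<^sup>n\<^sup>+\<^sup>1(X,K)\<close>, does not depend on the lift.
\<close>

definition syzygy_map ::
  "('k, 'o, 'm, 'e) ext_data \<Rightarrow> ('o, 'm, 'e) syzygies \<Rightarrow> 'o \<Rightarrow> 'o \<Rightarrow> 'm \<Rightarrow> 'm" where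
  "syzygy_map C S Y Y' f = (SOME f'. f' \<in> arr C (sK S Y) (sK S Y') \<and>
     pushout_ext C Y f' (sd S Y) = pullback_ext C (sK S Y') f (sd S Y'))"

text \<open>\<open>\<E>\<^sub>I\<^sup>-\<^sup>n(X,f) : \<E>\<^sub>I\<^sup>-\<^sup>n(X,Y) \<rightarrow> \<E>\<^sub>I\<^sup>-\<^sup>n(X,Y')\<close> for \<open>f : Y \<rightarrow> Y'\<close>.\<close>

fun negext_map ::
  "('k, 'o, 'm, 'e) ext_data \<Rightarrow> ('o, 'm, 'e) syzygies \<Rightarrow> nat \<Rightarrow> 'o \<Rightarrow> 'o \<Rightarrow> 'm \<Rightarrow> 'm \<Rightarrow> 'm" where
  "negext_map C S 0 Y Y' f h = f \<cdot>\<^bsub>C\<^esub> h"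
| "negext_map C S (Suc n) Y Y' f h = negext_map C S n (sK S Y) (sK S Y') (syzygy_map C S Y Y' f) h"

text \<open>
  The underlying set of \<open>\<E>\<^sub>I\<^sup>-\<^sup>n(X,Y)\<close>. It is a subset of \<open>Hom(X, K\<^sup>n(Y))\<close>, where \<open>K\<^sup>n(Y)\<close> is the
  \<open>n\<close>-fold chosen syzygy of \<open>Y\<close>; this also determines the zero element of \<open>\<E>\<^sub>I\<^sup>-\<^sup>n(X,G)\<close>.
\<close>

fun negext_set ::
  "('k, 'o, 'm, 'e) ext_data \<Rightarrow> ('o, 'm, 'e) syzygies \<Rightarrow> nat \<Rightarrow> 'o \<Rightarrow> 'o \<Rightarrow> 'm set" where
  "negext_set C S 0 X Y = arr C X Y"
| "negext_set C S (Suc n) X Y =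
     {h \<in> negext_set C S n X (sK S Y).
        negext_map C S n (sK S Y) (sG S Y) (sk S Y) h = \<zero>\<^bsub>Hom C X ((sK S ^^ n) (sG S Y))\<^esub>}"

text \<open>\<open>\<E>\<^sub>I\<^sup>-\<^sup>n(X,Y)\<close> as a \<open>k\<close>-vector space.\<close>

definition negext_I ::
  "('k, 'o, 'm, 'e) ext_data \<Rightarrow> ('o, 'm, 'e) syzygies \<Rightarrow> nat \<Rightarrow> 'o \<Rightarrow> 'o \<Rightarrow> ('k, 'm) module" where
  "negext_I C S n X Y = (Hom C X ((sK S ^^ n) Y)) \<lparr> carrier := negext_set C S n X Y \<rparr>"

text \<open>
  \<open>\<E>\<^sub>I\<^sub>I\<^sup>-\<^sup>n(X,Y)\<close> is the dual construction: a syzygy choice for the opposite category consists of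
  \<open>\<E>\<close>-triangles \<open>X \<rightarrow> J \<rightarrow> S \<dashrightarrow>\<close> whose first morphism is injective, that is, induces zero on
  \<open>\<E>(Z,-)\<close> for all \<open>Z\<close>.
\<close>

definition negext_II ::
  "('k, 'o, 'm, 'e) ext_data \<Rightarrow> ('o, 'm, 'e) syzygies \<Rightarrow> nat \<Rightarrow> 'o \<Rightarrow> 'o \<Rightarrow> ('k, 'm) module" where
  "negext_II C T n X Y = negext_I (opp C) T n Y X"

definition negext_finite ::
  "'k ring \<Rightarrow> ('k, 'o, 'm, 'e) ext_data \<Rightarrow> (nat \<Rightarrow> 'o \<Rightarrow> 'o \<Rightarrow> ('k, 'm) module) \<Rightarrow> bool" where
  "negext_finite K C N \<longleftrightarrow> (\<forall>X \<in> Obj C. \<forall>Y \<in> Obj C.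
     (\<forall>n. vectorspace.fin_dim K (N n X Y)) \<and>
     summable (\<lambda>n. real (vectorspace.dim K (N n X Y))))"

text \<open>
  The alternating product of the cardinalities of a family indexed by \<open>i > 0\<close>; the trivial
  factors are left out, so that the product is finite whenever \<open>negext_finite\<close> holds.
\<close>

definition alt_prod :: "(nat \<Rightarrow> ('k, 'm) module) \<Rightarrow> rat" where
  "alt_prod N = (\<Prod>i \<in> {i. i > 0 \<and> card (carrier (N i)) \<noteq> 1}.
     of_nat (card (carrier (N i))) powi ((-1) ^ i))"

definition brace_I :: "('k, 'o, 'm, 'e) ext_data \<Rightarrow> ('o, 'm, 'e) syzygies \<Rightarrow> 'o \<Rightarrow> 'o \<Rightarrow> rat" where
  "brace_I C S X Y = alt_prod (\<lambda>i. negext_I C S i X Y)"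

definition brace_II :: "('k, 'o, 'm, 'e) ext_data \<Rightarrow> ('o, 'm, 'e) syzygies \<Rightarrow> 'o \<Rightarrow> 'o \<Rightarrow> rat" where
  "brace_II C T X Y = alt_prod (\<lambda>i. negext_II C T i X Y)"


section \<open>The Hall algebra\<close>

definition inflations_with_cone ::
  "('k, 'o, 'm, 'e) ext_data \<Rightarrow> 'o \<Rightarrow> 'o \<Rightarrow> 'o \<Rightarrow> 'm set" where
  \<comment> \<open>\<open>(X,L)\<^sub>Y\<close>\<close>
  "inflations_with_cone C X L Y =
     {f. \<exists>Z y \<delta>. etriangle C X L Z f y \<delta> \<and> isomorphic C Z Y}"

definition deflations_with_cocone ::
  "('k, 'o, 'm, 'e) ext_data \<Rightarrow> 'o \<Rightarrow> 'o \<Rightarrow> 'o \<Rightarrow> 'm set" where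
  \<comment> \<open>\<open>\<^sub>X(L,Y)\<close>\<close>
  "deflations_with_cocone C X L Y =
     {g. \<exists>A x \<delta>. etriangle C A L Y x g \<delta> \<and> isomorphic C A X}"

text \<open>The two expressions for \<open>G\<^sup>L\<^sub>X\<^sub>Y\<close>.\<close>

definition hall_number_defl ::
  "('k, 'o, 'm, 'e) ext_data \<Rightarrow> ('o, 'm, 'e) syzygies \<Rightarrow> 'o \<Rightarrow> 'o \<Rightarrow> 'o \<Rightarrow> rat" where
  "hall_number_defl C S X Y L =
     of_nat (card (deflations_with_cocone C X L Y)) / of_nat (card (Aut C Y)) *
     (brace_I C S L Y / brace_I C S Y Y)"

definition hall_number_infl ::
  "('k, 'o, 'm, 'e) ext_data \<Rightarrow> ('o, 'm, 'e) syzygies \<Rightarrow> 'o \<Rightarrow> 'o \<Rightarrow> 'o \<Rightarrow> rat" where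
  "hall_number_infl C S X Y L =
     of_nat (card (inflations_with_cone C X L Y)) / of_nat (card (Aut C X)) *
     (brace_I C S X L / brace_I C S X X)"

definition iso_class :: "('k, 'o, 'm, 'e) ext_data \<Rightarrow> 'o \<Rightarrow> 'o set" where
  "iso_class C X = {Y \<in> Obj C. isomorphic C X Y}"

definition iso_classes :: "('k, 'o, 'm, 'e) ext_data \<Rightarrow> 'o set set" where
  "iso_classes C = iso_class C ` Obj C"

text \<open>The numbers \<open>G\<^sup>L\<^sub>X\<^sub>Y\<close> depend only on isomorphism classes, so any representative will do.\<close>

definition rep :: "'o set \<Rightarrow> 'o" where
  "rep c = (SOME X. X \<in> c)"

definition basis_vec :: "'o set \<Rightarrow> 'o set \<Rightarrow> rat" where
  "basis_vec c = (\<lambda>c'. if c' = c then 1 else 0)"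

definition hall_mult ::
  "('k, 'o, 'm, 'e) ext_data \<Rightarrow> ('o, 'm, 'e) syzygies \<Rightarrow> ('o set \<Rightarrow> rat) \<Rightarrow> ('o set \<Rightarrow> rat) \<Rightarrow> 'o set \<Rightarrow> rat" where
  "hall_mult C S u v = (\<lambda>l. if l \<in> iso_classes C
     then (\<Sum>a \<in> {a. u a \<noteq> 0}. \<Sum>b \<in> {b. v b \<noteq> 0}. u a * v b * hall_number_defl C S (rep a) (rep b) (rep l))
     else 0)"

text \<open>
  Elements are the finitely supported rational functions on the set of isomorphism classes, the
  basis vector \<open>u\<^bsub>[X]\<^esub>\<close> being \<open>basis_vec (iso_class C X)\<close>. The zero objects form one isomorphism class,
  whose basis vector is the unit. That the product is again finitely supported is
  part of the ring axioms.
\<close>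

definition hall_algebra ::
  "('k, 'o, 'm, 'e) ext_data \<Rightarrow> ('o, 'm, 'e) syzygies \<Rightarrow> (rat, 'o set \<Rightarrow> rat) module" where
  "hall_algebra C S =
     \<lparr> carrier = {u. finite {c. u c \<noteq> 0} \<and> {c. u c \<noteq> 0} \<subseteq> iso_classes C},
       mult = hall_mult C S,
       one = basis_vec {Z. zero_object C Z},
       zero = (\<lambda>_. 0),
       add = (\<lambda>u v c. u c + v c),
       smult = (\<lambda>r u c. r * u c) \<rparr>"

definition rat_ring :: "rat ring" where
  "rat_ring = \<lparr> carrier = UNIV, mult = (*), one = 1, zero = 0, add = (+) \<rparr>"

text \<open>\<^locale>\<open>algebra\<close> of the library requires commutativity.\<close>

locale associative_algebra = module R A + ring A for R (structure) and A (structure) +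
  assumes smult_mult_left:
      "\<lbrakk>r \<in> carrier R; u \<in> carrier A; v \<in> carrier A\<rbrakk>
        \<Longrightarrow> (r \<odot>\<^bsub>A\<^esub> u) \<otimes>\<^bsub>A\<^esub> v = r \<odot>\<^bsub>A\<^esub> (u \<otimes>\<^bsub>A\<^esub> v)"
    and smult_mult_right:
      "\<lbrakk>r \<in> carrier R; u \<in> carrier A; v \<in> carrier A\<rbrakk>
        \<Longrightarrow> u \<otimes>\<^bsub>A\<^esub> (r \<odot>\<^bsub>A\<^esub> v) = r \<odot>\<^bsub>A\<^esub> (u \<otimes>\<^bsub>A\<^esub> v)"

end

theory Submission
  imports Defs
begin

text \<open>
  Write \<open>b(X,Y)\<close> for the brace \<open>{X,Y}\<close>. The functors \<open>\<E>\<^sub>I\<^sup>-\<^sup>n(X,-)\<close> are iterated satellites of the half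
  exact functor \<open>Hom(X,-)\<close>, so every triangle \<open>A \<rightarrow> B \<rightarrow> Z\<close> gives a long exact sequence ending in
  \<open>Hom(X,A) \<rightarrow> Hom(X,B)\<close>, and the kernel of the last map has \<open>b(X,B) / (b(X,A) b(X,Z))\<close> elements.
  The same holds for \<open>\<E>\<^sub>I\<^sub>I\<close> in the opposite category. Shifting dimensions along projective and
  injective objects reduces the equality of the two braces to a snake argument in degree one,
  which is where conditions (c) and (d) enter.

  For a triangle \<open>M \<rightarrow> B \<rightarrow> N\<close> the inflations and the deflations are orbits under \<open>Aut M\<close> and \<open>Aut N\<close>. The
  stabilizers are related through the endomorphisms \<open>(u, 0, v)\<close> of the triangle, which gives
  the equality of the two expressions for the Hall number, even when only those inflations are
  counted whose deflation has a prescribed property.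

  For associativity fix \<open>Q = L \<oplus> Y\<close>. A deflation \<open>y : M \<rightarrow> Y\<close> with cocone \<open>X\<close> and an inflation \<open>m : M \<rightarrow> L\<close> with cone
  \<open>Z\<close> amount to one inflation \<open>(m, y) : M \<rightarrow> Q\<close>. If \<open>(p, d) : Q \<rightarrow> N\<close> is its deflation, then \<open>p : L \<rightarrow> N\<close> is a
  deflation with cocone \<open>X\<close> and \<open>d : Y \<rightarrow> N\<close> an inflation with cone \<open>Z\<close>, and conversely. The
  refined duality for \<open>M \<rightarrow> Q \<rightarrow> N\<close> exchanges \<open>M\<close> and \<open>N\<close>, and with them the two bracketings.
\<close>

section \<open>Duality\<close>

text \<open>The braces turn the direct sum \<open>Q\<close> into a product: with one Hall number in
  deflation form and the other in inflation form, their brace factors are \<open>b(M,Y)\<close> and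
  \<open>b(M,L)\<close>, and these multiply to \<open>b(M,Q)\<close>. What remains is the weight of
  \<open>M -> Q -> N\<close> in the refined duality, times a factor that depends on \<open>Y\<close>
  alone and is common to both bracketings.

  Fillers of triangles are not unique, so the two ends of a triangle are compared through relations
  with fibres of constant size instead of maps. In the duality these sizes enter twice and cancel.
  In degree one of the brace comparison nothing cancels, and the snake argument has to show that the
  two sizes agree.

  Negative extensions are defined by deflations \<open>G -> Y\<close> that are projective morphisms,
  while \<open>G\<close> itself need not be a projective object. Exactness of the satellites and
  dimension shifting are therefore obtained by comparison with projective objects.

  One-sided statements are proved for all extriangulated categories and then read in
  \<open>opp C\<close>; this is why the hypotheses are kept in dual pairs.\<close>

lemma opp_simps [simp]:
  "Obj (opp C) = Obj C" "Hom (opp C) X Y = Hom C Y X" "cmp (opp C) g f = cmp C f g"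
  "idm (opp C) = idm C" "Ext (opp C) Z A = Ext C A Z" "Emap (opp C) c a = Emap C a c"
  "Rlz (opp C) Z A \<delta> = {(x, y). (y, x) \<in> Rlz C A Z \<delta>}"
  by (simp_all add: opp_def)

lemma opp_opp [simp]: "opp (opp C) = C"
  by (simp add: opp_def)

lemma etriangle_opp [simp]: "etriangle (opp C) A B Z x y \<delta> \<longleftrightarrow> etriangle C Z B A y x \<delta>"
  by (auto simp: etriangle_def)

lemma pushout_ext_opp [simp]: "pushout_ext (opp C) Z a = pullback_ext C Z a"
  by (rule ext) (simp add: pushout_ext_def pullback_ext_def)

lemma pullback_ext_opp [simp]: "pullback_ext (opp C) Z a = pushout_ext C Z a"
  by (rule ext) (simp add: pushout_ext_def pullback_ext_def)

lemma iso_arr_opp [simp]: "iso_arr (opp C) X Y f \<longleftrightarrow> iso_arr C Y X f"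
  by (auto simp: iso_arr_def)

lemma Aut_opp [simp]: "Aut (opp C) X = Aut C X"
  by (simp add: Aut_def)

lemma zero_object_opp [simp]: "zero_object (opp C) X = zero_object C X"
  by (simp add: zero_object_def)

lemma biproduct_opp [simp]: "biproduct (opp C) A B S i j p q \<longleftrightarrow> biproduct C A B S p q i j"
  by (auto simp: biproduct_def)

section \<open>Arithmetic of morphisms\<close>

text \<open>
  Since Hom-sets are pairwise disjoint, a morphism determines its domain and codomain.
  With addition indexed by these instead of by objects, the laws of a linear category become
  conditional rewrite rules without free variables in their premises.
\<close>

definition arrow :: "('k, 'o, 'm, 'e) ext_data \<Rightarrow> 'm \<Rightarrow> bool" where
  "arrow C f \<longleftrightarrow> (\<exists>X \<in> Obj C. \<exists>Y \<in> Obj C. f \<in> arr C X Y)"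

definition dom_of :: "('k, 'o, 'm, 'e) ext_data \<Rightarrow> 'm \<Rightarrow> 'o" where
  "dom_of C f = (SOME X. \<exists>Y. X \<in> Obj C \<and> Y \<in> Obj C \<and> f \<in> arr C X Y)"

definition cod_of :: "('k, 'o, 'm, 'e) ext_data \<Rightarrow> 'm \<Rightarrow> 'o" where
  "cod_of C f = (SOME Y. \<exists>X. Y \<in> Obj C \<and> X \<in> Obj C \<and> f \<in> arr C X Y)"

definition madd :: "('k, 'o, 'm, 'e) ext_data \<Rightarrow> 'm \<Rightarrow> 'm \<Rightarrow> 'm" where
  "madd C f g = f \<oplus>\<^bsub>Hom C (dom_of C f) (cod_of C f)\<^esub> g"

definition mneg :: "('k, 'o, 'm, 'e) ext_data \<Rightarrow> 'm \<Rightarrow> 'm" where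
  "mneg C f = \<ominus>\<^bsub>Hom C (dom_of C f) (cod_of C f)\<^esub> f"

lemma arrow_opp [simp]: "arrow (opp C) f = arrow C f"
  by (auto simp: arrow_def)

lemma dom_of_opp [simp]: "dom_of (opp C) f = cod_of C f"
  by (simp add: dom_of_def cod_of_def)

lemma cod_of_opp [simp]: "cod_of (opp C) f = dom_of C f"
  by (simp add: dom_of_def cod_of_def)

lemma madd_opp [simp]: "madd (opp C) = madd C"
  by (intro ext) (simp add: madd_def)

lemma mneg_opp [simp]: "mneg (opp C) = mneg C"
  by (intro ext) (simp add: mneg_def)

context linear_category
begin

abbreviation ar where "ar \<equiv> arrow C"
abbreviation dm where "dm \<equiv> dom_of C"
abbreviation cd where "cd \<equiv> cod_of C"
abbreviation ob where "ob X \<equiv> X \<in> Obj C"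
abbreviation compose (infixr "\<bullet>" 75) where "g \<bullet> f \<equiv> cmp C g f"
abbreviation plus_arr (infixl "\<boxplus>" 65) where "f \<boxplus> g \<equiv> madd C f g"
abbreviation neg_arr ("\<boxminus> _" [81] 80) where "\<boxminus> f \<equiv> mneg C f"
abbreviation zro where "zro X Y \<equiv> \<zero>\<^bsub>Hom C X Y\<^esub>"
abbreviation idt where "idt \<equiv> idm C"
abbreviation in_hom ("\<guillemotleft>_ : _ \<rightarrow> _\<guillemotright>") where
  "\<guillemotleft>f : X \<rightarrow> Y\<guillemotright> \<equiv> ar f \<and> dm f = X \<and> cd f = Y"
abbreviation push where "push Z a \<delta> \<equiv> pushout_ext C Z a \<delta>"
abbreviation pull where "pull A c \<delta> \<equiv> pullback_ext C A c \<delta>"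
abbreviation tri where "tri A B Z x y \<delta> \<equiv> etriangle C A B Z x y \<delta>"

lemma dm_cd_eq:
  assumes "ob X" "ob Y" "f \<in> arr C X Y"
  shows "dm f = X" "cd f = Y"
proof -
  have "\<exists>Y. dm f \<in> Obj C \<and> Y \<in> Obj C \<and> f \<in> arr C (dm f) Y"
    unfolding dom_of_def by (rule someI[of _ X]) (use assms in blast)
  then show "dm f = X" using hom_disjoint assms by blast
  have "\<exists>X. cd f \<in> Obj C \<and> X \<in> Obj C \<and> f \<in> arr C X (cd f)"
    unfolding cod_of_def by (rule someI[of _ Y]) (use assms in blast)
  then show "cd f = Y" using hom_disjoint assms by blast
qed

lemma arrowE:
  assumes "ar f"
  shows "ob (dm f)" "ob (cd f)" "f \<in> arr C (dm f) (cd f)"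
  using assms dm_cd_eq unfolding arrow_def by auto

lemma ob_dm: "ar f \<Longrightarrow> dm f = X \<Longrightarrow> ob X"
  and ob_cd: "ar f \<Longrightarrow> cd f = X \<Longrightarrow> ob X"
  using arrowE by auto

lemma arr_iff: "ob X \<Longrightarrow> ob Y \<Longrightarrow> f \<in> arr C X Y \<longleftrightarrow> \<guillemotleft>f : X \<rightarrow> Y\<guillemotright>"
  using arrowE(3)[of f] dm_cd_eq[of X Y f] unfolding arrow_def by auto

lemma in_hom_arr: "\<guillemotleft>f : X \<rightarrow> Y\<guillemotright> \<Longrightarrow> f \<in> arr C X Y"
  using arrowE(3) by auto

lemma hom_abelian_group: "ob X \<Longrightarrow> ob Y \<Longrightarrow> abelian_group (Hom C X Y)"
  using hom_vectorspace[of X Y] unfolding vectorspace_def by (blast dest: Module.module.axioms(2))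

lemma cmp_simps [simp]:
  assumes "ar f" "ar g" "cd f = dm g"
  shows "ar (g \<bullet> f)" "dm (g \<bullet> f) = dm f" "cd (g \<bullet> f) = cd g"
  using comp_closed[OF arrowE(1)[OF assms(1)] arrowE(2)[OF assms(1)] arrowE(2)[OF assms(2)]
      arrowE(3)[OF assms(1)]] assms arrowE arr_iff by metis+

lemma cmp_assoc [simp]:
  assumes "ar f" "ar g" "ar h" "cd f = dm g" "cd g = dm h"
  shows "(h \<bullet> g) \<bullet> f = h \<bullet> (g \<bullet> f)"
  using comp_assoc[of "dm f" "cd f" "cd g" "cd h" f g h] assms arrowE by metis

lemma idt_simps [simp]:
  assumes "ob X" shows "ar (idt X)" "dm (idt X) = X" "cd (idt X) = X"
  using id_closed[OF assms] arr_iff assms by auto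

lemma idt_left [simp]: "ar f \<Longrightarrow> cd f = Y \<Longrightarrow> idt Y \<bullet> f = f"
  using id_left arrowE by blast

lemma idt_right [simp]: "ar f \<Longrightarrow> dm f = X \<Longrightarrow> f \<bullet> idt X = f"
  using id_right arrowE by blast

lemma zro_simps [simp]:
  assumes "ob X" "ob Y" shows "ar (zro X Y)" "dm (zro X Y) = X" "cd (zro X Y) = Y"
proof -
  interpret abelian_group "Hom C X Y" using assms by (rule hom_abelian_group)
  show "ar (zro X Y)" "dm (zro X Y) = X" "cd (zro X Y) = Y"
    using zero_closed arr_iff[OF assms] by blast+
qed

lemma madd_eq: "ar f \<Longrightarrow> dm f = X \<Longrightarrow> cd f = Y \<Longrightarrow> f \<oplus>\<^bsub>Hom C X Y\<^esub> g = f \<boxplus> g"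
  by (simp add: madd_def)

lemma mneg_eq: "ar f \<Longrightarrow> dm f = X \<Longrightarrow> cd f = Y \<Longrightarrow> \<ominus>\<^bsub>Hom C X Y\<^esub> f = \<boxminus> f"
  by (simp add: mneg_def)

lemma madd_simps [simp]:
  assumes "ar f" "ar g" "dm g = dm f" "cd g = cd f"
  shows "ar (f \<boxplus> g)" "dm (f \<boxplus> g) = dm f" "cd (f \<boxplus> g) = cd f"
proof -
  interpret abelian_group "Hom C (dm f) (cd f)" using assms by (simp add: hom_abelian_group arrowE)
  have "f \<boxplus> g \<in> arr C (dm f) (cd f)"
    unfolding madd_def using assms arrowE by (intro a_closed) (auto simp: arr_iff)
  then show "ar (f \<boxplus> g)" "dm (f \<boxplus> g) = dm f" "cd (f \<boxplus> g) = cd f"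
    using arr_iff assms arrowE by metis+
qed

lemma mneg_simps [simp]:
  assumes "ar f"
  shows "ar (\<boxminus> f)" "dm (\<boxminus> f) = dm f" "cd (\<boxminus> f) = cd f"
proof -
  interpret abelian_group "Hom C (dm f) (cd f)" using assms by (simp add: hom_abelian_group arrowE)
  have "\<boxminus> f \<in> arr C (dm f) (cd f)"
    unfolding mneg_def using assms arrowE by (intro a_inv_closed) (auto simp: arr_iff)
  then show "ar (\<boxminus> f)" "dm (\<boxminus> f) = dm f" "cd (\<boxminus> f) = cd f"
    using arr_iff assms arrowE by metis+
qed

lemma madd_assoc [simp]:
  assumes "ar f" "ar g" "ar h" "dm g = dm f" "cd g = cd f" "dm h = dm f" "cd h = cd f"
  shows "(f \<boxplus> g) \<boxplus> h = f \<boxplus> (g \<boxplus> h)"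
proof -
  interpret abelian_group "Hom C (dm f) (cd f)" using assms by (simp add: hom_abelian_group arrowE)
  show ?thesis using assms arrowE[of f] a_assoc[of f g h]
    by (simp add: madd_eq arr_iff)
qed

lemma madd_comm:
  assumes "ar f" "ar g" "dm g = dm f" "cd g = cd f"
  shows "f \<boxplus> g = g \<boxplus> f"
proof -
  interpret abelian_group "Hom C (dm f) (cd f)" using assms by (simp add: hom_abelian_group arrowE)
  show ?thesis using assms arrowE[of f] a_comm[of f g] by (simp add: madd_eq arr_iff)
qed

lemma madd_lcomm:
  assumes "ar f" "ar g" "ar h" "dm g = dm f" "cd g = cd f" "dm h = dm f" "cd h = cd f"
  shows "f \<boxplus> (g \<boxplus> h) = g \<boxplus> (f \<boxplus> h)"
  using madd_assoc[of f g h] madd_assoc[of g f h] madd_comm[of f g] assms by simp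

lemmas madd_ac = madd_comm madd_lcomm

lemma madd_zro [simp]:
  assumes "ar f" "dm f = X" "cd f = Y"
  shows "zro X Y \<boxplus> f = f" "f \<boxplus> zro X Y = f"
proof -
  interpret abelian_group "Hom C X Y" using assms by (auto simp: hom_abelian_group arrowE)
  show "f \<boxplus> zro X Y = f" "zro X Y \<boxplus> f = f"
    using assms arrowE[of f] r_zero[of f] l_zero[of f] by (simp_all add: madd_eq arr_iff)
qed

lemma madd_neg [simp]:
  assumes "ar f"
  shows "f \<boxplus> \<boxminus> f = zro (dm f) (cd f)" "\<boxminus> f \<boxplus> f = zro (dm f) (cd f)"
proof -
  interpret abelian_group "Hom C (dm f) (cd f)" using assms by (simp add: hom_abelian_group arrowE)
  show "f \<boxplus> \<boxminus> f = zro (dm f) (cd f)" "\<boxminus> f \<boxplus> f = zro (dm f) (cd f)"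
    using assms arrowE[of f] r_neg[of f] l_neg[of f] by (simp_all add: madd_eq mneg_eq arr_iff)
qed

lemma madd_neg_cancel [simp]:
  assumes "ar f" "ar g" "dm g = dm f" "cd g = cd f"
  shows "f \<boxplus> (\<boxminus> f \<boxplus> g) = g" "\<boxminus> f \<boxplus> (f \<boxplus> g) = g"
        "f \<boxplus> (g \<boxplus> \<boxminus> f) = g" "\<boxminus> f \<boxplus> (g \<boxplus> f) = g"
proof -
  show 1: "f \<boxplus> (\<boxminus> f \<boxplus> g) = g" "\<boxminus> f \<boxplus> (f \<boxplus> g) = g"
    using assms madd_assoc[of f "\<boxminus> f" g] madd_assoc[of "\<boxminus> f" f g] by simp_all
  show "f \<boxplus> (g \<boxplus> \<boxminus> f) = g" "\<boxminus> f \<boxplus> (g \<boxplus> f) = g"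
    using assms madd_comm[of g "\<boxminus> f"] madd_comm[of g f] 1 by simp_all
qed

lemma neg_unique:
  assumes "ar f" "ar g" "dm g = dm f" "cd g = cd f" "f \<boxplus> g = zro (dm f) (cd f)"
  shows "g = \<boxminus> f"
  using madd_neg_cancel(2)[of f g] assms by simp

lemma mneg_mneg [simp]: "ar f \<Longrightarrow> \<boxminus> (\<boxminus> f) = f"
  using neg_unique[of "\<boxminus> f" f] by simp

lemma mneg_zro [simp]: "ob X \<Longrightarrow> ob Y \<Longrightarrow> \<boxminus> (zro X Y) = zro X Y"
  using neg_unique[of "zro X Y" "zro X Y"] by simp

lemma mneg_madd [simp]:
  assumes "ar f" "ar g" "dm g = dm f" "cd g = cd f"
  shows "\<boxminus> (f \<boxplus> g) = \<boxminus> f \<boxplus> \<boxminus> g"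
proof -
  have "g \<boxplus> (\<boxminus> f \<boxplus> \<boxminus> g) = \<boxminus> f \<boxplus> (g \<boxplus> \<boxminus> g)"
    by (rule madd_lcomm) (use assms in simp_all)
  then have "g \<boxplus> (\<boxminus> f \<boxplus> \<boxminus> g) = \<boxminus> f" using assms arrowE[of f] by simp
  then show ?thesis by (intro neg_unique[symmetric]) (use assms in simp_all)
qed

lemma cmp_madd [simp]:
  assumes "ar f" "ar f'" "ar g" "dm f' = dm f" "cd f' = cd f" "cd f = dm g"
  shows "g \<bullet> (f \<boxplus> f') = g \<bullet> f \<boxplus> g \<bullet> f'"
  using comp_add_right[of "dm f" "cd f" "cd g" f f' g] assms arrowE(1,2)[of f] arrowE(1,2)[of g]
  by (simp add: arr_iff madd_eq)

lemma madd_cmp [simp]: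
  assumes "ar f" "ar g" "ar g'" "dm g' = dm g" "cd g' = cd g" "cd f = dm g"
  shows "(g \<boxplus> g') \<bullet> f = g \<bullet> f \<boxplus> g' \<bullet> f"
  using comp_add_left[of "dm f" "cd f" "cd g" f g g'] assms arrowE(1,2)[of f] arrowE(1,2)[of g]
  by (simp add: arr_iff madd_eq)

lemma idem_zro:
  assumes "ar f" "f \<boxplus> f = f" shows "f = zro (dm f) (cd f)"
  using madd_neg_cancel(2)[of f f] assms by simp

lemma cmp_zro [simp]: "ar g \<Longrightarrow> ob X \<Longrightarrow> dm g = Y \<Longrightarrow> g \<bullet> zro X Y = zro X (cd g)"
proof -
  assume a: "ar g" "ob X" "dm g = Y"
  then have [simp]: "ob Y" using arrowE by blast
  have "g \<bullet> zro X Y \<boxplus> g \<bullet> zro X Y = g \<bullet> zro X Y"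
    using cmp_madd[of "zro X Y" "zro X Y" g] a by simp
  then show ?thesis using idem_zro[of "g \<bullet> zro X Y"] a by simp
qed

lemma zro_cmp [simp]: "ar f \<Longrightarrow> ob Z \<Longrightarrow> cd f = Y \<Longrightarrow> zro Y Z \<bullet> f = zro (dm f) Z"
proof -
  assume a: "ar f" "ob Z" "cd f = Y"
  then have [simp]: "ob Y" using arrowE by blast
  have "zro Y Z \<bullet> f \<boxplus> zro Y Z \<bullet> f = zro Y Z \<bullet> f"
    using madd_cmp[of f "zro Y Z" "zro Y Z"] a by simp
  then show ?thesis using idem_zro[of "zro Y Z \<bullet> f"] a by simp
qed

lemma cmp_mneg [simp]: "ar f \<Longrightarrow> ar g \<Longrightarrow> cd f = dm g \<Longrightarrow> g \<bullet> \<boxminus> f = \<boxminus> (g \<bullet> f)"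
  using neg_unique[of "g \<bullet> f" "g \<bullet> \<boxminus> f"] cmp_madd[of f "\<boxminus> f" g, symmetric] arrowE[of f] by simp

lemma mneg_cmp [simp]: "ar f \<Longrightarrow> ar g \<Longrightarrow> cd f = dm g \<Longrightarrow> (\<boxminus> g) \<bullet> f = \<boxminus> (g \<bullet> f)"
  using neg_unique[of "g \<bullet> f" "(\<boxminus> g) \<bullet> f"] madd_cmp[of f g "\<boxminus> g", symmetric] arrowE[of g] by simp

subsection \<open>Isomorphisms\<close>

definition mutually_inverse :: "'m \<Rightarrow> 'm \<Rightarrow> bool" where
  "mutually_inverse f g \<longleftrightarrow> ar f \<and> ar g \<and> cd f = dm g \<and> cd g = dm f \<and>
     g \<bullet> f = idt (dm f) \<and> f \<bullet> g = idt (dm g)"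

lemma iso_arr_iff:
  assumes "ob X" "ob Y"
  shows "iso_arr C X Y f \<longleftrightarrow> (\<exists>g. mutually_inverse f g \<and> dm f = X \<and> cd f = Y)"
  unfolding iso_arr_def mutually_inverse_def using assms by (auto simp: arr_iff) metis

lemma mutually_inverse_sym: "mutually_inverse f g \<Longrightarrow> mutually_inverse g f"
  unfolding mutually_inverse_def by auto

text \<open>\<open>cmp_assoc\<close> makes simp bracket composites to the right, which hides
  \<open>g \<bullet> f\<close> inside \<open>g \<bullet> (f \<bullet> h)\<close>. The last two rules
  cancel in that position; \<open>biproductD\<close> carries rules of the same shape.\<close>

lemma mutually_inverse_simps:
  assumes "mutually_inverse f g"
  shows "ar f" "ar g" "dm g = cd f" "cd g = dm f"
    "g \<bullet> f = idt (dm f)" "f \<bullet> g = idt (cd f)"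
    "\<And>h. ar h \<Longrightarrow> cd h = dm f \<Longrightarrow> g \<bullet> (f \<bullet> h) = h"
    "\<And>h. ar h \<Longrightarrow> cd h = cd f \<Longrightarrow> f \<bullet> (g \<bullet> h) = h"
proof -
  show *: "ar f" "ar g" "dm g = cd f" "cd g = dm f" "g \<bullet> f = idt (dm f)" "f \<bullet> g = idt (cd f)"
    using assms unfolding mutually_inverse_def by auto
  show "g \<bullet> (f \<bullet> h) = h" if "ar h" "cd h = dm f" for h
    using that * cmp_assoc[of h f g] by simp
  show "f \<bullet> (g \<bullet> h) = h" if "ar h" "cd h = cd f" for h
    using that * cmp_assoc[of h g f] by simp
qed

lemma iso_arrE:
  assumes "iso_arr C X Y f" "ob X" "ob Y"
  obtains g where "mutually_inverse f g" "\<guillemotleft>f : X \<rightarrow> Y\<guillemotright>" "\<guillemotleft>g : Y \<rightarrow> X\<guillemotright>"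
proof -
  obtain g where g: "mutually_inverse f g" "dm f = X" "cd f = Y"
    using assms iso_arr_iff by auto
  from that[OF g(1)] mutually_inverse_simps[OF g(1)] g(2,3) show ?thesis by simp
qed

lemma iso_arrI: "mutually_inverse f g \<Longrightarrow> dm f = X \<Longrightarrow> cd f = Y \<Longrightarrow> iso_arr C X Y f"
  using iso_arr_iff[of X Y] mutually_inverse_simps ob_dm ob_cd by metis

lemma mutually_inverseI:
  "\<lbrakk>\<guillemotleft>f : X \<rightarrow> Y\<guillemotright>; \<guillemotleft>g : Y \<rightarrow> X\<guillemotright>; g \<bullet> f = idt X; f \<bullet> g = idt Y\<rbrakk> \<Longrightarrow> mutually_inverse f g"
  unfolding mutually_inverse_def by auto

lemma mutually_inverse_idt: "ob X \<Longrightarrow> mutually_inverse (idt X) (idt X)"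
  unfolding mutually_inverse_def by auto

lemma mutually_inverse_cmp:
  assumes "mutually_inverse f f'" "mutually_inverse g g'" "cd f = dm g"
  shows "mutually_inverse (g \<bullet> f) (f' \<bullet> g')"
proof -
  note [simp] = mutually_inverse_simps[OF assms(1)] mutually_inverse_simps[OF assms(2)] assms(3)
  show ?thesis unfolding mutually_inverse_def by simp
qed

lemma isomorphicI: "mutually_inverse f g \<Longrightarrow> dm f = X \<Longrightarrow> cd f = Y \<Longrightarrow> isomorphic C X Y"
  unfolding isomorphic_def using iso_arrI by blast

lemma isomorphicE:
  assumes "isomorphic C X Y" "ob X" "ob Y"
  obtains f g where "mutually_inverse f g" "\<guillemotleft>f : X \<rightarrow> Y\<guillemotright>" "\<guillemotleft>g : Y \<rightarrow> X\<guillemotright>"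
proof -
  obtain f where "iso_arr C X Y f" using assms(1) unfolding isomorphic_def by blast
  from iso_arrE[OF this assms(2,3)] that show ?thesis by metis
qed

lemma isomorphic_refl: "ob X \<Longrightarrow> isomorphic C X X"
  using isomorphicI[OF mutually_inverse_idt] by simp

lemma isomorphic_sym: "isomorphic C X Y \<Longrightarrow> ob X \<Longrightarrow> ob Y \<Longrightarrow> isomorphic C Y X"
  using isomorphicI mutually_inverse_sym by (metis isomorphicE)

lemma isomorphic_trans:
  assumes "isomorphic C X Y" "isomorphic C Y Z" "ob X" "ob Y" "ob Z"
  shows "isomorphic C X Z"
proof -
  obtain f f' where f: "mutually_inverse f f'" "\<guillemotleft>f : X \<rightarrow> Y\<guillemotright>"
    using isomorphicE[of X Y] assms by metis
  obtain g g' where g: "mutually_inverse g g'" "\<guillemotleft>g : Y \<rightarrow> Z\<guillemotright>"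
    using isomorphicE[of Y Z] assms by metis
  show ?thesis using isomorphicI[OF mutually_inverse_cmp[OF f(1) g(1)]] f g by simp
qed

text \<open>\<open>(1 + w)(1 - w) = 1 - w^2\<close>. The five lemmas below rest on this: an
  endomorphism of a triangle that is the identity on two terms differs from the identity on the
  third by a square-zero morphism.\<close>

lemma square_zero_inverse:
  assumes "\<guillemotleft>w : X \<rightarrow> X\<guillemotright>" "w \<bullet> w = zro X X"
  shows "mutually_inverse (idt X \<boxplus> w) (idt X \<boxplus> \<boxminus> w)"
proof -
  have "ob X" using assms ob_dm by blast
  then show ?thesis
    by (intro mutually_inverseI) (use assms in simp_all)
qed

subsection \<open>Biproducts\<close>

lemma biproductD:
  assumes "biproduct C A B S i j p q"
  shows "ob A" "ob B" "ob S" "ar i" "dm i = A" "cd i = S" "ar j" "dm j = B" "cd j = S"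
    "ar p" "dm p = S" "cd p = A" "ar q" "dm q = S" "cd q = B"
    "p \<bullet> i = idt A" "q \<bullet> j = idt B" "q \<bullet> i = zro A B" "p \<bullet> j = zro B A"
    "\<And>h. ar h \<Longrightarrow> cd h = A \<Longrightarrow> p \<bullet> (i \<bullet> h) = h"
    "\<And>h. ar h \<Longrightarrow> cd h = B \<Longrightarrow> q \<bullet> (j \<bullet> h) = h"
    "\<And>h. ar h \<Longrightarrow> cd h = A \<Longrightarrow> q \<bullet> (i \<bullet> h) = zro (dm h) B"
    "\<And>h. ar h \<Longrightarrow> cd h = B \<Longrightarrow> p \<bullet> (j \<bullet> h) = zro (dm h) A"
proof -
  show *: "ob A" "ob B" "ob S" "ar i" "dm i = A" "cd i = S" "ar j" "dm j = B" "cd j = S"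
    "ar p" "dm p = S" "cd p = A" "ar q" "dm q = S" "cd q = B"
    "p \<bullet> i = idt A" "q \<bullet> j = idt B" "q \<bullet> i = zro A B" "p \<bullet> j = zro B A"
    using assms unfolding biproduct_def by (auto simp: arr_iff)
  show "p \<bullet> (i \<bullet> h) = h" if "ar h" "cd h = A" for h
    using that * cmp_assoc[of h i p] by simp
  show "q \<bullet> (j \<bullet> h) = h" if "ar h" "cd h = B" for h
    using that * cmp_assoc[of h j q] by simp
  show "q \<bullet> (i \<bullet> h) = zro (dm h) B" if "ar h" "cd h = A" for h
    using that * cmp_assoc[of h i q] by simp
  show "p \<bullet> (j \<bullet> h) = zro (dm h) A" if "ar h" "cd h = B" for h
    using that * cmp_assoc[of h j p] by simp
qed

lemma biproduct_id: "biproduct C A B S i j p q \<Longrightarrow> i \<bullet> p \<boxplus> j \<bullet> q = idt S"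
proof -
  assume b: "biproduct C A B S i j p q"
  note [simp] = biproductD[OF b]
  show ?thesis using b unfolding biproduct_def by (simp add: madd_eq)
qed

lemma biproductI:
  assumes "\<guillemotleft>i : A \<rightarrow> S\<guillemotright>" "\<guillemotleft>j : B \<rightarrow> S\<guillemotright>" "\<guillemotleft>p : S \<rightarrow> A\<guillemotright>" "\<guillemotleft>q : S \<rightarrow> B\<guillemotright>"
    "p \<bullet> i = idt A" "q \<bullet> j = idt B" "q \<bullet> i = zro A B" "p \<bullet> j = zro B A"
    "i \<bullet> p \<boxplus> j \<bullet> q = idt S"
  shows "biproduct C A B S i j p q"
proof -
  have [simp]: "ob A" "ob B" "ob S" using assms ob_dm ob_cd by blast+
  show ?thesis unfolding biproduct_def using assms by (simp add: arr_iff madd_eq)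
qed

lemma biproduct_decomp:
  assumes "biproduct C A B S i j p q" "ar f" "cd f = S"
  shows "f = i \<bullet> (p \<bullet> f) \<boxplus> j \<bullet> (q \<bullet> f)"
proof -
  note [simp] = biproductD[OF assms(1)]
  have "(i \<bullet> p \<boxplus> j \<bullet> q) \<bullet> f = f" using biproduct_id[OF assms(1)] assms by simp
  then show ?thesis using assms by simp
qed

lemma biproduct_codecomp:
  assumes "biproduct C A B S i j p q" "ar f" "dm f = S"
  shows "f = (f \<bullet> i) \<bullet> p \<boxplus> (f \<bullet> j) \<bullet> q"
proof -
  note [simp] = biproductD[OF assms(1)]
  have "f \<bullet> (i \<bullet> p \<boxplus> j \<bullet> q) = f" using biproduct_id[OF assms(1)] assms by simp
  then show ?thesis using assms by simp
qed

lemma biproduct_ext: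
  assumes "biproduct C A B S i j p q" "ar f" "cd f = S" "ar g" "cd g = S"
    "p \<bullet> f = p \<bullet> g" "q \<bullet> f = q \<bullet> g"
  shows "f = g"
  using biproduct_decomp[OF assms(1-3)] biproduct_decomp[OF assms(1,4,5)] assms(6,7) by simp

lemma biproduct_swap:
  assumes "biproduct C A B S i j p q" shows "biproduct C B A S j i q p"
proof -
  note [simp] = biproductD[OF assms]
  show ?thesis
    by (rule biproductI) (use biproduct_id[OF assms] in \<open>simp_all add: madd_comm\<close>)
qed

text \<open>Supplies the change of sign in \<open>homotopy_pushout\<close>.\<close>

lemma biproduct_neg:
  assumes "biproduct C A B S i j p q" shows "biproduct C A B S i (\<boxminus> j) p (\<boxminus> q)"
proof -
  note [simp] = biproductD[OF assms]
  show ?thesis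
    by (rule biproductI) (use biproduct_id[OF assms] in simp_all)
qed

text \<open>A change of coordinates: \<open>A\<close> is embedded anew as the graph of
  \<open>f\<close>, and the projection to \<open>B\<close> is corrected so that it vanishes on this
  graph.\<close>

lemma biproduct_shear:
  assumes "biproduct C A B S i j p q" "\<guillemotleft>f : A \<rightarrow> B\<guillemotright>"
  shows "biproduct C A B S (i \<boxplus> j \<bullet> f) j p (q \<boxplus> \<boxminus> (f \<bullet> p))"
proof -
  note [simp] = biproductD[OF assms(1)]
  show ?thesis
    by (rule biproductI)
      (use assms biproduct_id[OF assms(1)] in \<open>simp_all add: madd_lcomm[of "j \<bullet> (f \<bullet> p)"]\<close>)
qed

lemma biproduct_zero_right:
  assumes "zero_object C Z" "ob A"
  shows "biproduct C A Z A (idt A) (zro Z A) (idt A) (zro A Z)"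
proof -
  have [simp]: "ob Z" "idt Z = zro Z Z" using assms unfolding zero_object_def by auto
  show ?thesis by (rule biproductI) (use assms in simp_all)
qed

lemma zero_object_arr:
  assumes "zero_object C Z" "ar f"
  shows "dm f = Z \<Longrightarrow> f = zro Z (cd f)" "cd f = Z \<Longrightarrow> f = zro (dm f) Z"
proof -
  have [simp]: "ob Z" "idt Z = zro Z Z" using assms unfolding zero_object_def by auto
  show "f = zro Z (cd f)" if "dm f = Z"
    using idt_right[of f Z] assms that arrowE[of f] by simp
  show "f = zro (dm f) Z" if "cd f = Z"
    using idt_left[of f Z] assms that arrowE[of f] by simp
qed

end

lemma (in linear_category) linear_category_opp: "linear_category K (opp C)"
proof (rule linear_category.intro)
  show "\<And>X Y. \<lbrakk>X \<in> Obj (opp C); Y \<in> Obj (opp C)\<rbrakk> \<Longrightarrow> vectorspace K (Hom (opp C) X Y)"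
    by (simp add: hom_vectorspace)
  show "X = X' \<and> Y = Y'" if "X \<in> Obj (opp C)" "Y \<in> Obj (opp C)" "X' \<in> Obj (opp C)" "Y' \<in> Obj (opp C)"
    "f \<in> arr (opp C) X Y" "f \<in> arr (opp C) X' Y'" for X Y X' Y' f
    using hom_disjoint[of Y X Y' X' f] that by simp
qed (simp_all add: id_closed comp_closed id_left id_right comp_assoc comp_add_left comp_add_right
    comp_smult_left comp_smult_right)

lemma (in additive_linear_category) additive_linear_category_opp: "additive_linear_category K (opp C)"
proof (intro additive_linear_category.intro additive_linear_category_axioms.intro linear_category_opp)
  show "\<exists>Z. zero_object (opp C) Z" using ex_zero_object by simp
  show "\<exists>S i j p q. biproduct (opp C) A B S i j p q" if "A \<in> Obj (opp C)" "B \<in> Obj (opp C)" for A B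
    using ex_biproduct[of A B] that by (simp, blast)
qed

context linear_category
begin

lemma seqs_iff: "ob A \<Longrightarrow> ob Z \<Longrightarrow>
    (x, y) \<in> seqs C A Z \<longleftrightarrow> ar x \<and> ar y \<and> dm x = A \<and> cd x = dm y \<and> cd y = Z"
  unfolding seqs_def using arrowE by (auto simp: arr_iff)

lemma seq_equiv_iff: "ob A \<Longrightarrow> ob Z \<Longrightarrow>
    ((x, y), (x', y')) \<in> seq_equiv C A Z \<longleftrightarrow> (x, y) \<in> seqs C A Z \<and> (x', y') \<in> seqs C A Z \<and>
      (\<exists>b b'. mutually_inverse b b' \<and> dm b = cd x \<and> cd b = cd x' \<and> b \<bullet> x = x' \<and> y' \<bullet> b = y)"
  (is "_ \<Longrightarrow> _ \<Longrightarrow> ?l \<longleftrightarrow> ?r")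
proof
  assume [simp]: "ob A" "ob Z"
  assume ?l
  then obtain B B' b where b: "ob B" "ob B'" "x \<in> arr C A B" "y \<in> arr C B Z"
     "x' \<in> arr C A B'" "y' \<in> arr C B' Z"
     "iso_arr C B B' b" "b \<bullet> x = x'" "y' \<bullet> b = y"
    unfolding seq_equiv_def by blast
  then obtain b' where "mutually_inverse b b'" "dm b = B" "cd b = B'" by (auto simp: iso_arr_iff)
  with b show ?r by (auto simp: arr_iff seqs_iff)
next
  assume [simp]: "ob A" "ob Z"
  assume r: ?r
  then obtain b b' where b: "mutually_inverse b b'" "dm b = cd x" "cd b = cd x'" "b \<bullet> x = x'" "y' \<bullet> b = y"
    by blast
  have "ar x" "ar x'" using r by (simp_all add: seqs_iff)
  then have [simp]: "ob (cd x)" "ob (cd x')" by (simp_all only: arrowE(2))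
  have "iso_arr C (cd x) (cd x') b" using b by (auto simp: iso_arr_iff)
  moreover have "x \<in> arr C A (cd x)" "y \<in> arr C (cd x) Z" "x' \<in> arr C A (cd x')" "y' \<in> arr C (cd x') Z"
    using r by (auto simp: seqs_iff intro!: in_hom_arr)
  ultimately show ?l unfolding seq_equiv_def using b(4,5) \<open>ob (cd x)\<close> \<open>ob (cd x')\<close> by blast
qed

lemma equiv_seq_equiv:
  assumes [simp]: "ob A" "ob Z" shows "equiv (seqs C A Z) (seq_equiv C A Z)"
proof (intro equivI)
  show "seq_equiv C A Z \<subseteq> seqs C A Z \<times> seqs C A Z"
    by (auto simp: seq_equiv_iff)
  show "refl_on (seqs C A Z) (seq_equiv C A Z)"
  proof (rule refl_onI)
    fix s assume "s \<in> seqs C A Z"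
    then obtain x y where s: "s = (x, y)" "(x, y) \<in> seqs C A Z" by (cases s) auto
    then show "(s, s) \<in> seq_equiv C A Z"
      using mutually_inverse_idt[of "cd x"] arrowE(2)[of x]
      by (auto simp: seq_equiv_iff seqs_iff intro!: exI[of _ "idt (cd x)"])
  qed
  show "sym (seq_equiv C A Z)"
  proof (rule symI)
    fix s t assume st: "(s, t) \<in> seq_equiv C A Z"
    obtain x y x' y' where e: "s = (x, y)" "t = (x', y')" by (cases s, cases t) auto
    obtain b b' where b: "mutually_inverse b b'" "dm b = cd x" "cd b = cd x'" "b \<bullet> x = x'" "y' \<bullet> b = y"
      and q: "(x, y) \<in> seqs C A Z" "(x', y') \<in> seqs C A Z" using st e by (auto simp: seq_equiv_iff)
    note [simp] = mutually_inverse_simps[OF b(1)]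
    have ty: "ar x" "ar y'" "cd x' = dm y'" using q by (simp_all add: seqs_iff)
    have "b' \<bullet> x' = x" unfolding b(4)[symmetric] using b(2) ty by simp
    moreover have "y \<bullet> b' = y'" unfolding b(5)[symmetric] using b(2,3) ty by simp
    ultimately have "b' \<bullet> x' = x" "y \<bullet> b' = y'" by simp_all
    then show "(t, s) \<in> seq_equiv C A Z"
      unfolding e seq_equiv_iff[OF assms] using q b(2,3) mutually_inverse_sym[OF b(1)]
      by (intro conjI exI[of _ b'] exI[of _ b]) simp_all
  qed
  show "trans (seq_equiv C A Z)"
  proof (rule transI)
    fix s t u assume st: "(s, t) \<in> seq_equiv C A Z" "(t, u) \<in> seq_equiv C A Z"
    obtain x y x' y' x'' y'' where e: "s = (x, y)" "t = (x', y')" "u = (x'', y'')"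
      by (cases s, cases t, cases u) auto
    obtain b b' where b: "mutually_inverse b b'" "dm b = cd x" "cd b = cd x'" "b \<bullet> x = x'" "y' \<bullet> b = y"
      and q: "(x, y) \<in> seqs C A Z" "(x', y') \<in> seqs C A Z" using st e by (auto simp: seq_equiv_iff)
    obtain c c' where c: "mutually_inverse c c'" "dm c = cd x'" "cd c = cd x''" "c \<bullet> x' = x''" "y'' \<bullet> c = y'"
      and q': "(x'', y'') \<in> seqs C A Z" using st e by (auto simp: seq_equiv_iff)
    note [simp] = mutually_inverse_simps[OF b(1)] mutually_inverse_simps[OF c(1)]
    have "(c \<bullet> b) \<bullet> x = x''" using b c q by (simp add: seqs_iff)
    moreover have "y'' \<bullet> (c \<bullet> b) = y"
      using b c q q' cmp_assoc[of b c y''] by (simp add: seqs_iff)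
    ultimately show "(s, u) \<in> seq_equiv C A Z"
      unfolding e seq_equiv_iff[OF assms]
      using q q' b(2,3) c(2,3) mutually_inverse_cmp[OF b(1) c(1)]
      by (intro conjI exI[of _ "c \<bullet> b"] exI[of _ "b' \<bullet> c'"]) simp_all
  qed
qed

text \<open>Reversing a sequence also reverses the comparison isomorphism of the middle terms; the
  symmetry of the equivalence repairs this.\<close>

lemma seq_equiv_opp:
  assumes "ob A" "ob Z"
  shows "((x, y), (x', y')) \<in> seq_equiv (opp C) A Z \<longleftrightarrow> ((y, x), (y', x')) \<in> seq_equiv C Z A"
proof -
  have *: "((y, x), (y', x')) \<in> seq_equiv C Z A"
    if "((x, y), (x', y')) \<in> seq_equiv (opp C) A Z" for x y x' y'
  proof -
    from that obtain B B' b where b: "ob B" "ob B'" "x \<in> arr C B A" "y \<in> arr C Z B"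
     "x' \<in> arr C B' A" "y' \<in> arr C Z B'" "iso_arr C B' B b" "x \<bullet> b = x'" "b \<bullet> y' = y"
      unfolding seq_equiv_def by auto
    then have "((y', x'), (y, x)) \<in> seq_equiv C Z A" unfolding seq_equiv_def by auto
    then show ?thesis using equiv_seq_equiv[OF assms(2,1)] by (meson equivE symD)
  qed
  interpret op: linear_category K "opp C" by (rule linear_category_opp)
  show ?thesis
  proof
    assume "((y, x), (y', x')) \<in> seq_equiv C Z A"
    then have "((y', x'), (y, x)) \<in> seq_equiv C Z A"
      using equiv_seq_equiv[OF assms(2,1)] by (meson equivE symD)
    then show "((x, y), (x', y')) \<in> seq_equiv (opp C) A Z"
      unfolding seq_equiv_def by auto
  qed (rule *)
qed

end

text \<open>The axioms are self-dual or occur in dual pairs. In the instances for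
  \<open>opp C\<close> triangles are read backwards, and \<open>push\<close> and \<open>pull\<close>
  change places, as do \<open>dm\<close> and \<open>cd\<close>.\<close>

lemma (in extriangulated_category) extriangulated_category_opp: "extriangulated_category K (opp C)"
proof -
  show ?thesis
  proof (intro extriangulated_category.intro extriangulated_category_axioms.intro additive_linear_category_opp)
    fix Z A \<delta> assume a: "Z \<in> Obj (opp C)" "A \<in> Obj (opp C)" "\<delta> \<in> exts (opp C) Z A"
    then have "Rlz C A Z \<delta> \<in> seqs C Z A // seq_equiv C Z A" using Rlz_class[of A Z \<delta>] by simp
    then obtain y x where yx: "(y, x) \<in> seqs C Z A" "Rlz C A Z \<delta> = seq_equiv C Z A `` {(y, x)}"
      by (auto elim!: quotientE)
    have "Rlz (opp C) Z A \<delta> = seq_equiv (opp C) A Z `` {(x, y)}"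
      unfolding opp_simps yx(2) using a seq_equiv_opp[of A Z x y] by auto
    moreover have "(x, y) \<in> seqs (opp C) A Z" using yx(1) unfolding seqs_def by auto
    ultimately show "Rlz (opp C) Z A \<delta> \<in> seqs (opp C) A Z // seq_equiv (opp C) A Z"
      by (simp add: quotientI)
  next
    fix A B Z x y \<delta> A' B' Z' x' y' \<delta>' a c
    assume "etriangle (opp C) A B Z x y \<delta>" "etriangle (opp C) A' B' Z' x' y' \<delta>'"
      "a \<in> arr (opp C) A A'" "c \<in> arr (opp C) Z Z'"
      "pushout_ext (opp C) Z a \<delta> = pullback_ext (opp C) A' c \<delta>'"
    then show "\<exists>b\<in>arr (opp C) B B'. cmp (opp C) b x = cmp (opp C) x' a \<and> cmp (opp C) y' b = cmp (opp C) c y"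
      using Rlz_morphism[of Z' B' A' y' x' \<delta>' Z B A y x \<delta> c a] by fastforce
  next
    fix A B Z x y \<delta> A' B' Z' x' y' \<delta>' SA iA jA pA qA SB iB jB pB qB SZ iZ jZ pZ qZ
    assume a: "etriangle (opp C) A B Z x y \<delta>" "etriangle (opp C) A' B' Z' x' y' \<delta>'"
      "biproduct (opp C) A A' SA iA jA pA qA" "biproduct (opp C) B B' SB iB jB pB qB"
      "biproduct (opp C) Z Z' SZ iZ jZ pZ qZ"
    then have t: "tri Z B A y x \<delta>" "tri Z' B' A' y' x' \<delta>'"
      and b: "biproduct C A A' SA pA qA iA jA" "biproduct C B B' SB pB qB iB jB"
        "biproduct C Z Z' SZ pZ qZ iZ jZ" by simp_all
    note [simp] = biproductD[OF b(1)] biproductD[OF b(2)] biproductD[OF b(3)]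
    have "ar x" "dm x = B" "cd x = A" "ar y" "dm y = Z" "cd y = B"
      "ar x'" "dm x' = B'" "cd x' = A'" "ar y'" "dm y' = Z'" "cd y' = B'"
      using t unfolding etriangle_def by (auto simp: arr_iff)
    then show "(add (Hom (opp C) SA SB) (cmp (opp C) iB (cmp (opp C) x pA)) (cmp (opp C) jB (cmp (opp C) x' qA)),
          add (Hom (opp C) SB SZ) (cmp (opp C) iZ (cmp (opp C) y pB)) (cmp (opp C) jZ (cmp (opp C) y' qB)))
        \<in> Rlz (opp C) SZ SA (add (Ext (opp C) SZ SA) (Emap (opp C) pZ iA \<delta>) (Emap (opp C) qZ jA \<delta>'))"
      using Rlz_sum[OF t(1,2) b(3,2,1)] by simp
  next
    fix A Z S i j p q assume "biproduct (opp C) A Z S i j p q"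
    then show "(i, q) \<in> Rlz (opp C) Z A (zero (Ext (opp C) Z A))"
      using Rlz_zero[OF biproduct_swap, of A Z S p q i j] by simp
  next
    show "ET3 (opp C)" "ET4 (opp C)" "ET3 (opp (opp C))" "ET4 (opp (opp C))"
      using ET3 ET4 ET3_op ET4_op by simp_all
  next
    show "\<And>Z A. \<lbrakk>Z \<in> Obj (opp C); A \<in> Obj (opp C)\<rbrakk> \<Longrightarrow> abelian_group (Ext (opp C) Z A)"
      by (simp add: ext_abelian_group)
  qed (simp_all add: Emap_closed Emap_add Emap_id Emap_comp Emap_biadditive_left Emap_biadditive_right)
qed

section \<open>Exact sequences of an \<open>\<E>\<close>-triangle\<close>

context linear_category
begin

lemma mutually_inverse_opp [simp]: "linear_category.mutually_inverse (opp C) f g = mutually_inverse f g"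
  unfolding mutually_inverse_def linear_category.mutually_inverse_def[OF linear_category_opp] by auto

end

context extriangulated_category
begin

section \<open>Functoriality and additivity of \<open>push\<close> and \<open>pull\<close>\<close>

abbreviation ex0 where "ex0 Z A \<equiv> \<zero>\<^bsub>Ext C Z A\<^esub>"

lemma triD:
  assumes "tri A B Z x y \<delta>"
  shows "ob A" "ob B" "ob Z" "ar x" "dm x = A" "cd x = B" "ar y" "dm y = B" "cd y = Z" "\<delta> \<in> exts C Z A"
  using assms unfolding etriangle_def by (auto simp: arr_iff)

lemma ex0_closed [simp]: "ob Z \<Longrightarrow> ob A \<Longrightarrow> ex0 Z A \<in> exts C Z A"
  using ext_abelian_group abelian_groupE(2) by blast

lemma push_closed [simp]:
  "ob Z \<Longrightarrow> ar a \<Longrightarrow> cd a = A' \<Longrightarrow> \<delta> \<in> exts C Z (dm a) \<Longrightarrow> push Z a \<delta> \<in> exts C Z A'"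
  unfolding pushout_ext_def using arrowE[of a] by (auto intro: Emap_closed simp: arr_iff)

lemma pull_closed [simp]:
  "ob A \<Longrightarrow> ar c \<Longrightarrow> dm c = Z' \<Longrightarrow> \<delta> \<in> exts C (cd c) A \<Longrightarrow> pull A c \<delta> \<in> exts C Z' A"
  unfolding pullback_ext_def using arrowE[of c] by (auto intro: Emap_closed simp: arr_iff)

lemma push_idt [simp]: "ob Z \<Longrightarrow> ob A \<Longrightarrow> \<delta> \<in> exts C Z A \<Longrightarrow> push Z (idt A) \<delta> = \<delta>"
  unfolding pushout_ext_def by (rule Emap_id)

lemma pull_idt [simp]: "ob Z \<Longrightarrow> ob A \<Longrightarrow> \<delta> \<in> exts C Z A \<Longrightarrow> pull A (idt Z) \<delta> = \<delta>"
  unfolding pullback_ext_def by (rule Emap_id)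

lemma push_cmp [simp]:
  assumes "ob Z" "ar a" "ar a'" "cd a = dm a'" "\<delta> \<in> exts C Z (dm a)"
  shows "push Z (a' \<bullet> a) \<delta> = push Z a' (push Z a \<delta>)"
  using Emap_comp[of Z Z Z "dm a" "dm a'" "cd a'" "idt Z" "idt Z" a a' \<delta>] assms arrowE[of a] arrowE[of a']
  unfolding pushout_ext_def by (simp add: arr_iff)

lemma pull_cmp [simp]:
  assumes "ob A" "ar c" "ar c'" "cd c' = dm c" "\<delta> \<in> exts C (cd c) A"
  shows "pull A (c \<bullet> c') \<delta> = pull A c' (pull A c \<delta>)"
  using Emap_comp[of "cd c" "dm c" "dm c'" A A A c c' "idt A" "idt A" \<delta>] assms arrowE[of c] arrowE[of c']
  unfolding pullback_ext_def by (simp add: arr_iff)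

lemma Emap_eq:
  assumes "ar a" "dm a = A" "ar c" "cd c = Z" "\<delta> \<in> exts C Z A"
  shows "Emap C c a \<delta> = push (dm c) a (pull A c \<delta>)" "Emap C c a \<delta> = pull (cd a) c (push Z a \<delta>)"
  using Emap_comp[of Z "dm c" "dm c" A A "cd a" c "idt (dm c)" "idt A" a \<delta>]
    Emap_comp[of Z Z "dm c" A "cd a" "cd a" "idt Z" c a "idt (cd a)" \<delta>]
    assms arrowE[of c] arrowE[of a]
  unfolding pullback_ext_def pushout_ext_def by (auto simp: arr_iff)

text \<open>Both sides are \<open>Emap C c a \<delta>\<close>, computed in the two possible
  orders.\<close>

lemma push_pull:
  assumes "ar a" "dm a = A" "cd a = A'" "ar c" "dm c = Z'" "cd c = Z" "\<delta> \<in> exts C Z A"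
  shows "push Z' a (pull A c \<delta>) = pull A' c (push Z a \<delta>)"
  using Emap_eq[OF assms(1,2,4,6,7)] assms by simp

lemma ext_idem:
  assumes "ob Z" "ob A" "\<delta> \<in> exts C Z A" "\<delta> \<oplus>\<^bsub>Ext C Z A\<^esub> \<delta> = \<delta>"
  shows "\<delta> = ex0 Z A"
proof -
  interpret abelian_group "Ext C Z A" using assms by (simp add: ext_abelian_group)
  show ?thesis using assms r_neg1[of \<delta> \<delta>] l_neg[of \<delta>] by simp
qed

lemma push_ex0 [simp]:
  assumes "ob Z" "ar a" "dm a = A" shows "push Z a (ex0 Z A) = ex0 Z (cd a)"
proof -
  have [simp]: "ob A" "ob (cd a)" using assms arrowE by auto
  interpret abelian_group "Ext C Z A" using assms by (simp add: ext_abelian_group)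
  have "push Z a (ex0 Z A) \<oplus>\<^bsub>Ext C Z (cd a)\<^esub> push Z a (ex0 Z A) = push Z a (ex0 Z A)"
    using Emap_add[of Z Z A "cd a" "idt Z" a "ex0 Z A" "ex0 Z A"] assms
    unfolding pushout_ext_def by (simp add: arr_iff)
  then show ?thesis using ext_idem[of Z "cd a" "push Z a (ex0 Z A)"] assms by simp
qed

lemma pull_ex0 [simp]:
  assumes "ob A" "ar c" "cd c = Z" shows "pull A c (ex0 Z A) = ex0 (dm c) A"
  using extriangulated_category.push_ex0[OF extriangulated_category_opp, of A c Z] assms by simp

lemma push_madd:
  assumes "ob Z" "ar a" "ar a'" "dm a' = dm a" "cd a' = cd a" "\<delta> \<in> exts C Z (dm a)"
  shows "push Z (a \<boxplus> a') \<delta> = push Z a \<delta> \<oplus>\<^bsub>Ext C Z (cd a)\<^esub> push Z a' \<delta>"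
  using Emap_biadditive_right[of Z Z "dm a" "cd a" "idt Z" a a' \<delta>] assms arrowE[of a]
  unfolding pushout_ext_def by (simp add: arr_iff madd_eq)

lemma pull_madd:
  assumes "ob A" "ar c" "ar c'" "dm c' = dm c" "cd c' = cd c" "\<delta> \<in> exts C (cd c) A"
  shows "pull A (c \<boxplus> c') \<delta> = pull A c \<delta> \<oplus>\<^bsub>Ext C (dm c) A\<^esub> pull A c' \<delta>"
  using extriangulated_category.push_madd[OF extriangulated_category_opp, of A c c' \<delta>] assms by simp

lemma push_zro [simp]:
  assumes "ob Z" "ob A" "ob A'" "\<delta> \<in> exts C Z A" shows "push Z (zro A A') \<delta> = ex0 Z A'"
  using ext_idem[of Z A' "push Z (zro A A') \<delta>"] push_madd[of Z "zro A A'" "zro A A'" \<delta>] assms by simp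

lemma pull_zro [simp]:
  assumes "ob A" "ob Z" "ob Z'" "\<delta> \<in> exts C Z A" shows "pull A (zro Z' Z) \<delta> = ex0 Z' A"
  using extriangulated_category.push_zro[OF extriangulated_category_opp, of A Z Z' \<delta>] assms by simp

text \<open>Turns an equation between two pushouts into the vanishing of one, the form to which
  \<open>extend_to_middle\<close> applies.\<close>

lemma push_diff:
  assumes "ob Z" "ar a" "ar a'" "dm a' = dm a" "cd a' = cd a" "\<delta> \<in> exts C Z (dm a)"
  shows "push Z (a \<boxplus> \<boxminus> a') \<delta> = ex0 Z (cd a) \<longleftrightarrow> push Z a \<delta> = push Z a' \<delta>"
proof -
  have [simp]: "ob (dm a)" "ob (cd a)" using assms arrowE by auto
  interpret abelian_group "Ext C Z (cd a)" using assms by (simp add: ext_abelian_group)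
  have c: "push Z a \<delta> \<in> exts C Z (cd a)" "push Z a' \<delta> \<in> exts C Z (cd a)" "push Z (\<boxminus> a') \<delta> \<in> exts C Z (cd a)"
    using assms by simp_all
  have "push Z a' \<delta> \<oplus>\<^bsub>Ext C Z (cd a)\<^esub> push Z (\<boxminus> a') \<delta> = ex0 Z (cd a)"
    using push_madd[of Z a' "\<boxminus> a'" \<delta>] assms by simp
  moreover have "push Z (a \<boxplus> \<boxminus> a') \<delta> = push Z a \<delta> \<oplus>\<^bsub>Ext C Z (cd a)\<^esub> push Z (\<boxminus> a') \<delta>"
    using push_madd[of Z a "\<boxminus> a'" \<delta>] assms by simp
  ultimately show ?thesis using c minus_equality by metis
qed

lemma pull_diff:
  assumes "ob A" "ar c" "ar c'" "dm c' = dm c" "cd c' = cd c" "\<delta> \<in> exts C (cd c) A"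
  shows "pull A (c \<boxplus> \<boxminus> c') \<delta> = ex0 (dm c) A \<longleftrightarrow> pull A c \<delta> = pull A c' \<delta>"
  using extriangulated_category.push_diff[OF extriangulated_category_opp, of A c c' \<delta>] assms by simp

subsection \<open>Morphisms of triangles\<close>

lemma tri_morphism:
  assumes "tri A B Z x y \<delta>" "tri A' B' Z' x' y' \<delta>'" "\<guillemotleft>a : A \<rightarrow> A'\<guillemotright>" "\<guillemotleft>c : Z \<rightarrow> Z'\<guillemotright>"
    "push Z a \<delta> = pull A' c \<delta>'"
  shows "\<exists>b. \<guillemotleft>b : B \<rightarrow> B'\<guillemotright> \<and> b \<bullet> x = x' \<bullet> a \<and> y' \<bullet> b = c \<bullet> y"
  using Rlz_morphism[OF assms(1,2) in_hom_arr[OF assms(3)] in_hom_arr[OF assms(4)] assms(5)]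
    triD[OF assms(1)] triD[OF assms(2)] by (auto simp: arr_iff)

lemma tri_fill_right:
  assumes "tri A B Z x y \<delta>" "tri A' B' Z' x' y' \<delta>'" "\<guillemotleft>a : A \<rightarrow> A'\<guillemotright>" "\<guillemotleft>b : B \<rightarrow> B'\<guillemotright>"
    "b \<bullet> x = x' \<bullet> a"
  shows "\<exists>c. \<guillemotleft>c : Z \<rightarrow> Z'\<guillemotright> \<and> c \<bullet> y = y' \<bullet> b \<and> push Z a \<delta> = pull A' c \<delta>'"
proof -
  have "\<exists>c \<in> arr C Z Z'. c \<bullet> y = y' \<bullet> b \<and> push Z a \<delta> = pull A' c \<delta>'"
    using ET3 assms in_hom_arr[OF assms(3)] in_hom_arr[OF assms(4)] unfolding ET3_def by blast
  then show ?thesis using triD[OF assms(1)] triD[OF assms(2)] by (auto simp: arr_iff)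
qed

lemma tri_fill_left:
  assumes "tri A B Z x y \<delta>" "tri A' B' Z' x' y' \<delta>'" "\<guillemotleft>b : B \<rightarrow> B'\<guillemotright>" "\<guillemotleft>c : Z \<rightarrow> Z'\<guillemotright>"
    "y' \<bullet> b = c \<bullet> y"
  shows "\<exists>a. \<guillemotleft>a : A \<rightarrow> A'\<guillemotright> \<and> x' \<bullet> a = b \<bullet> x \<and> push Z a \<delta> = pull A' c \<delta>'"
  using extriangulated_category.tri_fill_right[OF extriangulated_category_opp,
      of Z' B' A' y' x' \<delta>' Z B A y x \<delta> c b] assms by auto

lemma tri_split:
  "biproduct C A Z S i j p q \<Longrightarrow> tri A S Z i q (ex0 Z A)"
  using Rlz_zero[of A Z S i j p q] biproductD[of A Z S i j p q] unfolding etriangle_def by (auto simp: arr_iff)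

text \<open>The triangles \<open>A = A -> 0\<close> and \<open>0 -> A = A\<close> serve as probes:
  the exactness statements below come from filling a morphism of triangles that starts at one of
  them, or from the dual of such an argument.\<close>

lemma tri_idt_zero:
  assumes "zero_object C O'" "ob A"
  shows "tri A A O' (idt A) (zro A O') (ex0 O' A)"
  by (rule tri_split) (rule biproduct_zero_right[OF assms])

lemma tri_zero_idt:
  assumes "zero_object C O'" "ob A"
  shows "tri O' A A (zro O' A) (idt A) (ex0 A O')"
  by (rule tri_split) (rule biproduct_swap[OF biproduct_zero_right[OF assms]])

section \<open>Exactness at the terms of a triangle\<close>

lemma tri_cmp_zero:
  assumes t: "tri A B Z x y \<delta>" shows "y \<bullet> x = zro A Z"
proof -
  note [simp] = triD[OF t]
  obtain O' where O': "zero_object C O'" using ex_zero_object by blast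
  then have [simp]: "ob O'" unfolding zero_object_def by simp
  obtain c where c: "\<guillemotleft>c : O' \<rightarrow> Z\<guillemotright>" "c \<bullet> zro A O' = y \<bullet> x"
    using tri_fill_right[OF tri_idt_zero[OF O' triD(1)[OF t]] t, of "idt A" x] by auto
  then show ?thesis by simp
qed

lemma tri_cmp_zero_assoc:
  assumes "tri A B Z x y \<delta>" "ar h" "cd h = A" shows "y \<bullet> (x \<bullet> h) = zro (dm h) Z"
  using tri_cmp_zero[OF assms(1)] triD[OF assms(1)] assms cmp_assoc[of h x y] by simp

text \<open>The pair \<open>(f, 0)\<close> forms the right square of a morphism from
  \<open>W = W -> 0\<close>; its left component is the lift.\<close>

lemma lift_to_left:
  assumes t: "tri A B Z x y \<delta>" and f: "\<guillemotleft>f : W \<rightarrow> B\<guillemotright>" "y \<bullet> f = zro W Z"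
  shows "\<exists>a. \<guillemotleft>a : W \<rightarrow> A\<guillemotright> \<and> x \<bullet> a = f"
proof -
  note [simp] = triD[OF t]
  obtain O' where O': "zero_object C O'" using ex_zero_object by blast
  have [simp]: "ob O'" "ob W" using O' f ob_dm unfolding zero_object_def by auto
  show ?thesis
    using tri_fill_left[OF tri_idt_zero[OF O' \<open>ob W\<close>] t, of f "zro O' Z"] f by auto
qed

lemma extend_to_right:
  assumes t: "tri A B Z x y \<delta>" and f: "\<guillemotleft>f : B \<rightarrow> W\<guillemotright>" "f \<bullet> x = zro A W"
  shows "\<exists>a. \<guillemotleft>a : Z \<rightarrow> W\<guillemotright> \<and> a \<bullet> y = f"
  using extriangulated_category.lift_to_left[OF extriangulated_category_opp, of Z B A y x \<delta> f W] assms
  by auto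

text \<open>In the morphism from \<open>0 -> B = B\<close> with components \<open>1\<close> and
  \<open>y\<close>, the left component starts at a zero object, and it pushes the zero extension to
  \<open>pull A y \<delta>\<close>.\<close>

lemma tri_pull_zero: assumes t: "tri A B Z x y \<delta>" shows "pull A y \<delta> = ex0 B A"
proof -
  note [simp] = triD[OF t]
  obtain O' where O': "zero_object C O'" using ex_zero_object by blast
  then have [simp]: "ob O'" unfolding zero_object_def by simp
  obtain a where a: "\<guillemotleft>a : O' \<rightarrow> A\<guillemotright>" "push B a (ex0 B O') = pull A y \<delta>"
    using tri_fill_left[OF tri_zero_idt[OF O' triD(2)[OF t]] t, of "idt B" y] by auto
  then show ?thesis by simp
qed

lemma tri_push_zero: "tri A B Z x y \<delta> \<Longrightarrow> push Z x \<delta> = ex0 Z B"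
  using extriangulated_category.tri_pull_zero[OF extriangulated_category_opp, of Z B A y x \<delta>] by simp

text \<open>The hypothesis makes \<open>(0, c)\<close> a morphism from the zero extension to
  \<open>\<delta>\<close>, and its realization on \<open>0 -> W = W\<close> is the lift.\<close>

lemma lift_to_middle:
  assumes t: "tri A B Z x y \<delta>" and c: "\<guillemotleft>c : W \<rightarrow> Z\<guillemotright>" "pull A c \<delta> = ex0 W A"
  shows "\<exists>b. \<guillemotleft>b : W \<rightarrow> B\<guillemotright> \<and> y \<bullet> b = c"
proof -
  note [simp] = triD[OF t]
  obtain O' where O': "zero_object C O'" using ex_zero_object by blast
  have [simp]: "ob O'" "ob W" using O' c ob_dm unfolding zero_object_def by auto
  show ?thesis
    using tri_morphism[OF tri_zero_idt[OF O' \<open>ob W\<close>] t, of "zro O' A" c] c by auto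
qed

lemma extend_to_middle:
  assumes "tri A B Z x y \<delta>" "\<guillemotleft>a : A \<rightarrow> W\<guillemotright>" "push Z a \<delta> = ex0 Z W"
  shows "\<exists>b. \<guillemotleft>b : B \<rightarrow> W\<guillemotright> \<and> b \<bullet> x = a"
  using extriangulated_category.lift_to_middle[OF extriangulated_category_opp, of Z B A y x \<delta> a W] assms
  by auto

lemma ex_tri:
  assumes "ob Z" "ob A" "\<delta> \<in> exts C Z A" obtains B x y where "tri A B Z x y \<delta>"
proof -
  obtain x y where "(x, y) \<in> seqs C A Z" "Rlz C Z A \<delta> = seq_equiv C A Z `` {(x, y)}"
    using Rlz_class[OF assms] by (auto elim!: quotientE)
  then have "(x, y) \<in> seqs C A Z" "(x, y) \<in> Rlz C Z A \<delta>"
    using equiv_seq_equiv[of A Z] assms equiv_class_self by fastforce+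
  then show ?thesis using that assms unfolding etriangle_def seqs_def by auto
qed

lemma tri_equiv:
  assumes t: "tri A B Z x y \<delta>" and b: "mutually_inverse b b'" "dm b = B" "cd b = B'"
  shows "tri A B' Z (b \<bullet> x) (y \<bullet> b') \<delta>"
proof -
  note [simp] = triD[OF t] mutually_inverse_simps[OF b(1)] b(2,3)
  have ob': "ob B'" using b ob_cd mutually_inverse_simps(1) by blast
  have "((x, y), (b \<bullet> x, y \<bullet> b')) \<in> seq_equiv C A Z"
    unfolding seq_equiv_iff[OF triD(1,3)[OF t]]
    by (intro conjI exI[of _ b] exI[of _ b'] b(1)) (simp_all add: seqs_iff)
  moreover have "(x, y) \<in> Rlz C Z A \<delta>" using t unfolding etriangle_def by simp
  ultimately have "(b \<bullet> x, y \<bullet> b') \<in> Rlz C Z A \<delta>"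
    using in_quotient_imp_closed[OF equiv_seq_equiv Rlz_class] triD(1,3,10)[OF t] by blast
  then show ?thesis unfolding etriangle_def using ob' by (simp add: arr_iff)
qed

section \<open>Five lemmas and transport of triangles along isomorphisms\<close>

lemma tri_endo_right_iso:
  assumes t: "tri A B Z x y \<delta>" and c: "\<guillemotleft>c : Z \<rightarrow> Z\<guillemotright>" "c \<bullet> y = y" "pull A c \<delta> = \<delta>"
  shows "\<exists>c'. mutually_inverse c c'"
proof -
  note [simp] = triD[OF t]
  define w where "w = c \<boxplus> \<boxminus> (idt Z)"
  have w: "\<guillemotleft>w : Z \<rightarrow> Z\<guillemotright>" "w \<bullet> y = zro B Z" "idt Z \<boxplus> w = c" using c unfolding w_def by simp_all
  have "pull A w \<delta> = ex0 Z A" unfolding w_def using pull_diff[of A c "idt Z" \<delta>] c by simp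
  then obtain s where s: "\<guillemotleft>s : Z \<rightarrow> B\<guillemotright>" "y \<bullet> s = w" using lift_to_middle[OF t] w by blast
  \<comment> \<open>\<open>w\<close> kills \<open>y\<close> and also factors through
    \<open>y\<close>, so its square is zero.\<close>
  have "w \<bullet> w = (w \<bullet> y) \<bullet> s" using s w(1) by simp
  then have "w \<bullet> w = zro Z Z" using w(2) s(1) by simp
  then show ?thesis using square_zero_inverse[of w Z] w by auto
qed

text \<open>\<open>u \<bullet> g\<close> is a left inverse of \<open>f\<close> and
  \<open>g \<bullet> v\<close> a right inverse, so they coincide.\<close>

lemma inverse_of_two_sided:
  assumes "\<guillemotleft>f : X \<rightarrow> Y\<guillemotright>" "\<guillemotleft>g : Y \<rightarrow> X\<guillemotright>" "mutually_inverse (g \<bullet> f) u" "mutually_inverse (f \<bullet> g) v"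
  shows "\<exists>f'. mutually_inverse f f'"
proof -
  note [simp] = mutually_inverse_simps(2)[OF assms(3)] mutually_inverse_simps(2)[OF assms(4)]
  have u: "dm u = X" "cd u = X" "u \<bullet> (g \<bullet> f) = idt X"
    using mutually_inverse_simps(3-5)[OF assms(3)] assms(1,2) by simp_all
  have v: "dm v = Y" "cd v = Y" "f \<bullet> (g \<bullet> v) = idt Y"
    using mutually_inverse_simps(3,4,6)[OF assms(4)] assms(1,2) by simp_all
  have "u \<bullet> g = (u \<bullet> g) \<bullet> (f \<bullet> (g \<bullet> v))" using u v assms(1,2) by simp
  also have "\<dots> = (u \<bullet> (g \<bullet> f)) \<bullet> (g \<bullet> v)" using u(1,2) v(1,2) assms(1,2) by simp
  also have "\<dots> = g \<bullet> v" unfolding u(3) using v assms(1,2) by simp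
  finally have "f \<bullet> (u \<bullet> g) = idt Y" using v by simp
  moreover have "(u \<bullet> g) \<bullet> f = idt X" using u assms(1,2) by simp
  ultimately have "mutually_inverse f (u \<bullet> g)"
    by (intro mutually_inverseI[of _ X Y]) (use u v assms(1,2) in simp_all)
  then show ?thesis by blast
qed

text \<open>A candidate \<open>d\<close> for the inverse is any filler of the inverse pair
  \<open>(a', b')\<close>. The composites \<open>d c\<close> and \<open>c d\<close> need not be
  identities, but they fix deflation and extension, so \<open>tri_endo_right_iso\<close> makes them
  invertible.\<close>

lemma tri_right_iso:
  assumes t: "tri A B Z x y \<delta>" and t': "tri A' B' Z' x' y' \<delta>'"
    and a: "mutually_inverse a a'" "\<guillemotleft>a : A \<rightarrow> A'\<guillemotright>" and b: "mutually_inverse b b'" "\<guillemotleft>b : B \<rightarrow> B'\<guillemotright>"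
    and c: "\<guillemotleft>c : Z \<rightarrow> Z'\<guillemotright>" "b \<bullet> x = x' \<bullet> a" "c \<bullet> y = y' \<bullet> b" "push Z a \<delta> = pull A' c \<delta>'"
  shows "\<exists>c'. mutually_inverse c c'"
proof -
  note [simp] = triD[OF t] triD[OF t'] mutually_inverse_simps[OF a(1)] mutually_inverse_simps[OF b(1)] c(1)
    a(2) b(2)
  have "b' \<bullet> x' = b' \<bullet> ((x' \<bullet> a) \<bullet> a')" by simp
  also have "\<dots> = x \<bullet> a'" unfolding c(2)[symmetric] by simp
  finally obtain d where d: "\<guillemotleft>d : Z' \<rightarrow> Z\<guillemotright>" "d \<bullet> y' = y \<bullet> b'" "push Z' a' \<delta>' = pull A d \<delta>"
    using tri_fill_right[OF t' t, of a' b'] by auto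
  note [simp] = d(1)
  have "(d \<bullet> c) \<bullet> y = (d \<bullet> y') \<bullet> b" using c by simp
  then have 1: "(d \<bullet> c) \<bullet> y = y" using d(2) by simp
  have 2: "pull A (d \<bullet> c) \<delta> = push Z a' (push Z a \<delta>)"
    unfolding c(4) using push_pull[of a' A' A c Z Z' \<delta>'] d(3) by simp
  have 3: "pull A (d \<bullet> c) \<delta> = \<delta>" unfolding 2 using push_cmp[of Z a a' \<delta>, symmetric] by simp
  have "(c \<bullet> d) \<bullet> y' = (c \<bullet> y) \<bullet> b'" using d(2) by simp
  then have 4: "(c \<bullet> d) \<bullet> y' = y'" using c(3) by simp
  have 5: "pull A' (c \<bullet> d) \<delta>' = push Z' a (push Z' a' \<delta>')"
    unfolding d(3) using push_pull[of a A A' d Z' Z \<delta>] c(4) by simp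
  have 6: "pull A' (c \<bullet> d) \<delta>' = \<delta>'" unfolding 5 using push_cmp[of Z' a' a \<delta>', symmetric] by simp
  obtain u where "mutually_inverse (d \<bullet> c) u" using tri_endo_right_iso[OF t _ 1 3] by auto
  moreover obtain v where "mutually_inverse (c \<bullet> d) v" using tri_endo_right_iso[OF t' _ 4 6] by auto
  ultimately show ?thesis using inverse_of_two_sided[OF c(1) d(1)] by blast
qed

lemma tri_left_iso:
  assumes t: "tri A B Z x y \<delta>" and t': "tri A' B' Z' x' y' \<delta>'"
    and b: "mutually_inverse b b'" "\<guillemotleft>b : B \<rightarrow> B'\<guillemotright>" and c: "mutually_inverse c c'" "\<guillemotleft>c : Z \<rightarrow> Z'\<guillemotright>"
    and a: "\<guillemotleft>a : A \<rightarrow> A'\<guillemotright>" "b \<bullet> x = x' \<bullet> a" "c \<bullet> y = y' \<bullet> b" "push Z a \<delta> = pull A' c \<delta>'"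
  shows "\<exists>a'. mutually_inverse a a'"
  using extriangulated_category.tri_right_iso[OF extriangulated_category_opp,
      of Z' B' A' y' x' \<delta>' Z B A y x \<delta> c c' b b' a] assms
    linear_category.mutually_inverse_opp[OF linear_category_axioms] by auto

lemma tri_endo_middle_iso:
  assumes t: "tri A B Z x y \<delta>" and b: "\<guillemotleft>b : B \<rightarrow> B\<guillemotright>" "b \<bullet> x = x" "y \<bullet> b = y"
  shows "\<exists>b'. mutually_inverse b b'"
proof -
  note [simp] = triD[OF t]
  define w where "w = b \<boxplus> \<boxminus> (idt B)"
  have w: "\<guillemotleft>w : B \<rightarrow> B\<guillemotright>" "w \<bullet> x = zro A B" "y \<bullet> w = zro B Z" "idt B \<boxplus> w = b"
    using b unfolding w_def by simp_all
  obtain s where s: "\<guillemotleft>s : B \<rightarrow> A\<guillemotright>" "x \<bullet> s = w" using lift_to_left[OF t] w by blast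
  have "w \<bullet> w = (w \<bullet> x) \<bullet> s" using s w(1) by simp
  then have "w \<bullet> w = zro B B" using w(2) s(1) by simp
  then show ?thesis using square_zero_inverse[of w B] w by auto
qed

lemma tri_middle_iso:
  assumes t: "tri A B Z x y \<delta>" and t': "tri A' B' Z' x' y' \<delta>'"
    and a: "mutually_inverse a a'" "\<guillemotleft>a : A \<rightarrow> A'\<guillemotright>" and c: "mutually_inverse c c'" "\<guillemotleft>c : Z \<rightarrow> Z'\<guillemotright>"
    and e: "push Z a \<delta> = pull A' c \<delta>'"
  shows "\<exists>b b'. mutually_inverse b b' \<and> \<guillemotleft>b : B \<rightarrow> B'\<guillemotright> \<and> b \<bullet> x = x' \<bullet> a \<and> y' \<bullet> b = c \<bullet> y"
proof -
  note [simp] = triD[OF t] triD[OF t'] mutually_inverse_simps[OF a(1)] mutually_inverse_simps[OF c(1)]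
    a(2) c(2)
  obtain b where b: "\<guillemotleft>b : B \<rightarrow> B'\<guillemotright>" "b \<bullet> x = x' \<bullet> a" "y' \<bullet> b = c \<bullet> y"
    using tri_morphism[OF t t' a(2) c(2) e] by blast
  have "push Z' a' \<delta>' = push Z' a' (pull A' c' (pull A' c \<delta>'))"
    using pull_cmp[of A' c c' \<delta>'] by simp
  also have "\<dots> = pull A c' (push Z a' (push Z a \<delta>))"
    unfolding e[symmetric] using push_pull[of a' A' A c' Z' Z "push Z a \<delta>"] by simp
  also have "\<dots> = pull A c' \<delta>" using push_cmp[of Z a a' \<delta>] by simp
  finally obtain d where d: "\<guillemotleft>d : B' \<rightarrow> B\<guillemotright>" "d \<bullet> x' = x \<bullet> a'" "y \<bullet> d = c' \<bullet> y'"
    using tri_morphism[OF t' t, of a' c'] by auto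
  note [simp] = b(1) d(1)
  have "(d \<bullet> b) \<bullet> x = (d \<bullet> x') \<bullet> a" using b(2) by simp
  then have 1: "(d \<bullet> b) \<bullet> x = x" using d(2) by simp
  have "y \<bullet> (d \<bullet> b) = (y \<bullet> d) \<bullet> b" by simp
  also have "\<dots> = y" unfolding d(3) using b(3) by simp
  finally have 2: "y \<bullet> (d \<bullet> b) = y" .
  have "(b \<bullet> d) \<bullet> x' = (b \<bullet> x) \<bullet> a'" using d(2) by simp
  then have 3: "(b \<bullet> d) \<bullet> x' = x'" using b(2) by simp
  have "y' \<bullet> (b \<bullet> d) = (y' \<bullet> b) \<bullet> d" by simp
  also have "\<dots> = y'" unfolding b(3) using d(3) by simp
  finally have 4: "y' \<bullet> (b \<bullet> d) = y'" .
  obtain u where "mutually_inverse (d \<bullet> b) u" using tri_endo_middle_iso[OF t _ 1 2] by auto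
  moreover obtain v where "mutually_inverse (b \<bullet> d) v" using tri_endo_middle_iso[OF t' _ 3 4] by auto
  ultimately show ?thesis using inverse_of_two_sided[OF b(1) d(1)] b by blast
qed

text \<open>\<open>tri_equiv\<close> changes the middle term only. For the end terms, the
  transported extension is realized by some triangle, whose middle term
  \<open>tri_middle_iso\<close> identifies with \<open>B\<close>.\<close>

lemma tri_transport:
  assumes t: "tri A B Z x y \<delta>"
    and a: "mutually_inverse a a'" "\<guillemotleft>a : A \<rightarrow> A'\<guillemotright>" and b: "mutually_inverse b b'" "\<guillemotleft>b : B \<rightarrow> B'\<guillemotright>"
    and c: "mutually_inverse c c'" "\<guillemotleft>c : Z \<rightarrow> Z'\<guillemotright>"
  shows "tri A' B' Z' (b \<bullet> (x \<bullet> a')) (c \<bullet> (y \<bullet> b')) (push Z' a (pull A c' \<delta>))"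
proof -
  note [simp] = triD[OF t] mutually_inverse_simps[OF a(1)] mutually_inverse_simps[OF b(1)]
    mutually_inverse_simps[OF c(1)] a(2) b(2) c(2)
  have [simp]: "ob A'" "ob B'" "ob Z'" using a b c ob_cd by blast+
  let ?d = "push Z' a (pull A c' \<delta>)"
  obtain E x1 y1 where t1: "tri A' E Z' x1 y1 ?d" using ex_tri[of Z' A' ?d] by auto
  have "pull A' c ?d = push Z a (pull A c (pull A c' \<delta>))"
    using push_pull[of a A A' c Z Z' "pull A c' \<delta>"] by simp
  then have "push Z a \<delta> = pull A' c ?d" using pull_cmp[of A c' c \<delta>, symmetric] by simp
  then obtain e e' where e: "mutually_inverse e e'" "\<guillemotleft>e : B \<rightarrow> E\<guillemotright>" "e \<bullet> x = x1 \<bullet> a" "y1 \<bullet> e = c \<bullet> y"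
    using tri_middle_iso[OF t t1 a c] by blast
  note [simp] = mutually_inverse_simps[OF e(1)] e(2) triD[OF t1]
  have "tri A' B' Z' ((b \<bullet> e') \<bullet> x1) (y1 \<bullet> (e \<bullet> b')) ?d"
    by (rule tri_equiv[OF t1 mutually_inverse_cmp[OF mutually_inverse_sym[OF e(1)] b(1)]]) simp_all
  moreover have "(b \<bullet> e') \<bullet> x1 = b \<bullet> (x \<bullet> a')"
  proof -
    have "(b \<bullet> e') \<bullet> x1 = b \<bullet> (e' \<bullet> ((x1 \<bullet> a) \<bullet> a'))" by simp
    also have "\<dots> = b \<bullet> (x \<bullet> a')" unfolding e(3)[symmetric] by simp
    finally show ?thesis .
  qed
  moreover have "y1 \<bullet> (e \<bullet> b') = c \<bullet> (y \<bullet> b')"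
    using cmp_assoc[of b' e y1] cmp_assoc[of b' y c] e(4) by simp
  ultimately show ?thesis by simp
qed

lemma ET4_rule:
  assumes "tri A B D f f' \<delta>" "tri B Y F g g' \<delta>'"
  shows "\<exists>E h' d e \<delta>''. tri A Y E (g \<bullet> f) h' \<delta>'' \<and> tri D E F d e (push F f' \<delta>') \<and>
    h' \<bullet> g = d \<bullet> f' \<and> e \<bullet> h' = g' \<and> pull A d \<delta>'' = \<delta> \<and> push E f \<delta>'' = pull B e \<delta>'"
  using ET4[unfolded ET4_def, rule_format, OF conjI[OF assms]] by (elim exE conjE) (intro exI conjI; simp)

lemma ET4_op_rule:
  assumes "tri D B A f' f \<delta>" "tri F Y B g' g \<delta>'"
  shows "\<exists>E h' d e \<delta>''. tri E Y A h' (f \<bullet> g) \<delta>'' \<and> tri F E D e d (pull F f' \<delta>') \<and>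
    g \<bullet> h' = f' \<bullet> d \<and> h' \<bullet> e = g' \<and> push A d \<delta>'' = \<delta> \<and> pull E f \<delta>'' = push B e \<delta>'"
  using extriangulated_category.ET4_rule[OF extriangulated_category_opp, of A B D f f' \<delta> Y F g g' \<delta>'] assms
  by auto

end

section \<open>Homotopy cartesian squares\<close>

context extriangulated_category
begin

lemma ext_add_zero [simp]:
  assumes "ob Z" "ob A" "\<delta> \<in> exts C Z A" shows "\<delta> \<oplus>\<^bsub>Ext C Z A\<^esub> ex0 Z A = \<delta>"
proof -
  interpret abelian_group "Ext C Z A" using assms by (simp add: ext_abelian_group)
  show ?thesis using assms by simp
qed

lemma tri_unique:
  assumes t: "tri A B Z x y \<delta>" and t': "tri A B' Z x' y' \<delta>"
  obtains b b' where "mutually_inverse b b'" "\<guillemotleft>b : B \<rightarrow> B'\<guillemotright>" "b \<bullet> x = x'" "y' \<bullet> b = y"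
proof -
  note [simp] = triD[OF t] triD[OF t']
  have "\<exists>b b'. mutually_inverse b b' \<and> \<guillemotleft>b : B \<rightarrow> B'\<guillemotright> \<and> b \<bullet> x = x' \<bullet> idt A \<and> y' \<bullet> b = idt Z \<bullet> y"
    by (rule tri_middle_iso[OF t t' mutually_inverse_idt _ mutually_inverse_idt]) simp_all
  then show ?thesis using that by auto
qed

lemma tri_sum_left:
  assumes t: "tri A B Z x y \<delta>" and bA: "biproduct C A D SA iA jA pA qA"
    and bB: "biproduct C B D SB iB jB pB qB"
  shows "tri SA SB Z (iB \<bullet> (x \<bullet> pA) \<boxplus> jB \<bullet> qA) (y \<bullet> pB) (push Z iA \<delta>)"
proof -
  note [simp] = triD[OF t] biproductD[OF bA] biproductD[OF bB]
  obtain O' where O': "zero_object C O'" using ex_zero_object by blast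
  then have [simp]: "ob O'" unfolding zero_object_def by simp
  \<comment> \<open>Reading \<open>Z\<close> as \<open>Z \<oplus> 0\<close> lets the sum with the
    triangle \<open>D = D -> 0\<close> end in \<open>Z\<close> again.\<close>
  have bZ: "biproduct C Z O' Z (idt Z) (zro O' Z) (idt Z) (zro Z O')"
    by (rule biproduct_zero_right[OF O']) simp
  have "Emap C (idt Z) iA \<delta> = push Z iA \<delta>" by (simp add: pushout_ext_def)
  moreover have "Emap C (zro Z O') jA (ex0 O' D) = ex0 Z SA"
    using Emap_eq(1)[of jA D "zro Z O'" O' "ex0 O' D"] by simp
  ultimately show ?thesis
    using Rlz_sum[OF t tri_idt_zero[OF O' biproductD(2)[OF bA]] bA bB bZ] unfolding etriangle_def
    by (simp add: madd_eq arr_iff)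
qed

lemma tri_sum_right:
  assumes t: "tri A B Z x y \<delta>" and bB: "biproduct C B D SB iB jB pB qB"
    and bZ: "biproduct C Z D SZ iZ jZ pZ qZ"
  shows "tri A SB SZ (iB \<bullet> x) (iZ \<bullet> (y \<bullet> pB) \<boxplus> jZ \<bullet> qB) (pull A pZ \<delta>)"
  using extriangulated_category.tri_sum_left[OF extriangulated_category_opp,
      of Z B A y x \<delta> D SZ pZ qZ iZ jZ SB pB qB iB jB] assms triD[OF t] biproductD[OF bB] biproductD[OF bZ]
  by simp

text \<open>
  The extension \<open>e\<^sup>*\<delta>\<close> is needed to identify the connecting morphisms of this triangle; the sign
  makes the first morphism the pair \<open>(x, f)\<close>.
\<close>

lemma homotopy_pushout:
  assumes t: "tri A B Z x y \<delta>" and f: "\<guillemotleft>f : A \<rightarrow> D\<guillemotright>"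
    and t': "tri D E Z d e (push Z f \<delta>)" and S: "biproduct C B D S i j p q"
  shows "\<exists>c. \<guillemotleft>c : B \<rightarrow> E\<guillemotright> \<and> tri A S E (i \<bullet> x \<boxplus> j \<bullet> f) (c \<bullet> p \<boxplus> \<boxminus> (d \<bullet> q)) (pull A e \<delta>) \<and> e \<bullet> c = y"
proof -
  note [simp] = triD[OF t] f triD[OF t']
  \<comment> \<open>The octahedron yields the inflation \<open>(x, -f)\<close>. Negating
    \<open>j\<close> and \<open>q\<close> at the end moves the sign to the second morphism.\<close>
  have *: "\<exists>c. \<guillemotleft>c : B \<rightarrow> E\<guillemotright> \<and> tri A S E (i \<bullet> x \<boxplus> \<boxminus> (j \<bullet> f)) (c \<bullet> p \<boxplus> d \<bullet> q) (pull A e \<delta>) \<and> e \<bullet> c = y"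
    if S: "biproduct C B D S i j p q" for i j p q
  proof -
    note [simp] = biproductD[OF S]
    obtain S1 i1 j1 p1 q1 where S1: "biproduct C A D S1 i1 j1 p1 q1" using ex_biproduct[of A D] by auto
    note [simp] = biproductD[OF S1]
    \<comment> \<open>The graph of \<open>-f\<close> as a split inflation
      \<open>A -> A \<oplus> D\<close> with cone \<open>D\<close>. Followed by the sum of
      \<open>x\<close> and the identity of \<open>D\<close>, it becomes
      \<open>(x, -f)\<close>.\<close>
    have "tri A S1 D (i1 \<boxplus> j1 \<bullet> (\<boxminus> f)) (q1 \<boxplus> \<boxminus> (\<boxminus> f \<bullet> p1)) (ex0 D A)"
      by (rule tri_split[OF biproduct_shear[OF S1]]) simp
    then have T1: "tri A S1 D (i1 \<boxplus> \<boxminus> (j1 \<bullet> f)) (q1 \<boxplus> f \<bullet> p1) (ex0 D A)" by simp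
    have T2: "tri S1 S Z (i \<bullet> (x \<bullet> p1) \<boxplus> j \<bullet> q1) (y \<bullet> p) (push Z i1 \<delta>)"
      by (rule tri_sum_left[OF t S1 S])
    obtain E0 h' d0 e0 \<delta>'' where
      h: "tri A S E0 ((i \<bullet> (x \<bullet> p1) \<boxplus> j \<bullet> q1) \<bullet> (i1 \<boxplus> \<boxminus> (j1 \<bullet> f))) h' \<delta>''"
      and d0: "tri D E0 Z d0 e0 (push Z (q1 \<boxplus> f \<bullet> p1) (push Z i1 \<delta>))"
      and eq: "h' \<bullet> (i \<bullet> (x \<bullet> p1) \<boxplus> j \<bullet> q1) = d0 \<bullet> (q1 \<boxplus> f \<bullet> p1)" "e0 \<bullet> h' = y \<bullet> p"
        "push E0 (i1 \<boxplus> \<boxminus> (j1 \<bullet> f)) \<delta>'' = pull S1 e0 (push Z i1 \<delta>)"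
      using ET4_rule[OF T1 T2] by blast
    note [simp] = triD[OF h] triD[OF d0]
    have "(i \<bullet> (x \<bullet> p1) \<boxplus> j \<bullet> q1) \<bullet> (i1 \<boxplus> \<boxminus> (j1 \<bullet> f)) = i \<bullet> x \<boxplus> \<boxminus> (j \<bullet> f)" by simp
    then have h1: "tri A S E0 (i \<bullet> x \<boxplus> \<boxminus> (j \<bullet> f)) h' \<delta>''" using h by simp
    have "push Z (q1 \<boxplus> f \<bullet> p1) (push Z i1 \<delta>) = push Z ((q1 \<boxplus> f \<bullet> p1) \<bullet> i1) \<delta>"
      by (subst push_cmp) simp_all
    then have d1: "tri D E0 Z d0 e0 (push Z f \<delta>)" using d0 by simp
    have "(h' \<bullet> (i \<bullet> (x \<bullet> p1) \<boxplus> j \<bullet> q1)) \<bullet> j1 = (d0 \<bullet> (q1 \<boxplus> f \<bullet> p1)) \<bullet> j1" unfolding eq(1) ..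
    then have hj: "h' \<bullet> j = d0" by simp
    \<comment> \<open>\<open>p1\<close> retracts the split inflation, so the last equation of the
      octahedron determines \<open>\<delta>''\<close>.\<close>
    have "\<delta>'' = push E0 (p1 \<bullet> (i1 \<boxplus> \<boxminus> (j1 \<bullet> f))) \<delta>''" by simp
    also have "\<dots> = push E0 p1 (pull S1 e0 (push Z i1 \<delta>))" unfolding eq(3)[symmetric] by (subst push_cmp) simp_all
    also have "\<dots> = pull A e0 (push Z (p1 \<bullet> i1) \<delta>)"
      using push_pull[of p1 S1 A e0 E0 Z "push Z i1 \<delta>"] push_cmp[of Z i1 p1 \<delta>] by simp
    finally have d'': "\<delta>'' = pull A e0 \<delta>" by simp
    \<comment> \<open>\<open>E0\<close> and the given \<open>E\<close> both realize the pushout of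
      \<open>\<delta>\<close> along \<open>f\<close>.\<close>
    obtain b b' where b: "mutually_inverse b b'" "\<guillemotleft>b : E0 \<rightarrow> E\<guillemotright>" "b \<bullet> d0 = d" "e \<bullet> b = e0"
      by (rule tri_unique[OF d1 t'])
    note [simp] = mutually_inverse_simps[OF b(1)] b(2)
    have eb: "e0 \<bullet> b' = e" using cmp_assoc[of b' b e] b(4) by simp
    have "tri A S E (idt S \<bullet> ((i \<bullet> x \<boxplus> \<boxminus> (j \<bullet> f)) \<bullet> idt A)) (b \<bullet> (h' \<bullet> idt S)) (push E (idt A) (pull A b' \<delta>''))"
      by (rule tri_transport[OF h1 mutually_inverse_idt _ mutually_inverse_idt _ b(1)]) simp_all
    moreover have "pull A b' \<delta>'' = pull A e \<delta>" unfolding d'' eb[symmetric] by (subst pull_cmp) simp_all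
    ultimately have 1: "tri A S E (i \<bullet> x \<boxplus> \<boxminus> (j \<bullet> f)) (b \<bullet> h') (pull A e \<delta>)" by simp
    have "b \<bullet> h' = ((b \<bullet> h') \<bullet> i) \<bullet> p \<boxplus> ((b \<bullet> h') \<bullet> j) \<bullet> q" by (rule biproduct_codecomp[OF S]) simp_all
    moreover have "(b \<bullet> h') \<bullet> j = d" using hj b(3) by simp
    ultimately have 2: "b \<bullet> h' = (b \<bullet> (h' \<bullet> i)) \<bullet> p \<boxplus> d \<bullet> q" by simp
    have "e \<bullet> (b \<bullet> (h' \<bullet> i)) = (e \<bullet> b) \<bullet> (h' \<bullet> i)" by simp
    also have "\<dots> = (e0 \<bullet> h') \<bullet> i" unfolding b(4) by simp
    also have "\<dots> = y" unfolding eq(2) by simp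
    finally have "e \<bullet> (b \<bullet> (h' \<bullet> i)) = y" .
    then show ?thesis using 1 unfolding 2 by (intro exI[of _ "b \<bullet> (h' \<bullet> i)"]) simp
  qed
  note [simp] = biproductD[OF S]
  show ?thesis using *[OF biproduct_neg[OF S]] by simp
qed

text \<open>
  Cancels the summand \<open>M = M \<rightarrow> 0\<close> from a triangle. The axioms only let one add it, so the comparison
  goes through a realization \<open>X \<rightarrow> L1 \<rightarrow> N\<close> of the component of \<open>\<delta>\<close> in \<open>\<E>(N,X)\<close>.
\<close>

lemma tri_cancel_idt:
  assumes t: "tri W B' N h (p \<bullet> b2) \<delta>" and B': "biproduct C M L B' a1 a2 b1 b2"
    and W: "biproduct C X M W e s r' r" and h: "h \<bullet> s = a1" and p: "\<guillemotleft>p : L \<rightarrow> N\<guillemotright>"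
  shows "tri X L N (b2 \<bullet> (h \<bullet> e)) p (push N r' \<delta>)"
proof -
  note [simp] = triD[OF t] biproductD[OF B'] biproductD[OF W] p
  let ?f = "b1 \<bullet> (h \<bullet> e)"
  let ?e = "e \<boxplus> s \<bullet> (\<boxminus> ?f)"
  \<comment> \<open>The copy of \<open>X\<close> in \<open>W\<close> is tilted along
    \<open>M\<close> until \<open>h\<close> sends it into the summand \<open>L\<close>; the
    projection of \<open>W\<close> to \<open>M\<close> then becomes
    \<open>b1 \<bullet> h\<close>.\<close>
  have W1: "biproduct C X M W ?e s r' (r \<boxplus> \<boxminus> ((\<boxminus> ?f) \<bullet> r'))"
    by (rule biproduct_shear[OF W]) simp
  have "b1 \<bullet> h = ((b1 \<bullet> h) \<bullet> e) \<bullet> r' \<boxplus> ((b1 \<bullet> h) \<bullet> s) \<bullet> r" by (rule biproduct_codecomp[OF W]) simp_all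
  then have b1h: "b1 \<bullet> h = r \<boxplus> ?f \<bullet> r'" using h by (simp add: madd_comm)
  have W2: "biproduct C X M W ?e s r' (b1 \<bullet> h)" using W1 unfolding b1h by simp
  note [simp] = biproductD[OF W2]
  let ?z = "push N r' \<delta>"
  obtain L1 x1 y1 where t1: "tri X L1 N x1 y1 ?z" using ex_tri[of N X ?z] by auto
  note [simp] = triD[OF t1]
  obtain B1 i1 i2 p1 p2 where B1: "biproduct C L1 M B1 i1 i2 p1 p2" using ex_biproduct[of L1 M] by auto
  note [simp] = biproductD[OF B1]
  have t2: "tri W B1 N (i1 \<bullet> (x1 \<bullet> r') \<boxplus> i2 \<bullet> (b1 \<bullet> h)) (y1 \<bullet> p1) (push N ?e ?z)"
    by (rule tri_sum_left[OF t1 W2 B1])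
  have id: "?e \<bullet> r' \<boxplus> s \<bullet> (b1 \<bullet> h) = idt W" by (rule biproduct_id[OF W2])
  \<comment> \<open>The component of \<open>\<delta>\<close> along \<open>M\<close> vanishes because
    \<open>h\<close> is the inflation of its triangle; so \<open>\<delta>\<close> is recovered from
    its component along \<open>X\<close>.\<close>
  have "push N (b1 \<bullet> h) \<delta> = push N b1 (push N h \<delta>)" by simp
  also have "\<dots> = ex0 N M" unfolding tri_push_zero[OF t] by simp
  finally have "push N (s \<bullet> (b1 \<bullet> h)) \<delta> = ex0 N W" by (subst push_cmp) simp_all
  then have "push N (?e \<bullet> r') \<delta> = push N (?e \<bullet> r' \<boxplus> s \<bullet> (b1 \<bullet> h)) \<delta>"
    by (subst push_madd) simp_all
  also have "\<dots> = \<delta>" unfolding id by simp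
  finally have ez: "push N ?e ?z = \<delta>" by (subst (asm) push_cmp) simp_all
  obtain b b' where b: "mutually_inverse b b'" "\<guillemotleft>b : B1 \<rightarrow> B'\<guillemotright>"
      "b \<bullet> (i1 \<bullet> (x1 \<bullet> r') \<boxplus> i2 \<bullet> (b1 \<bullet> h)) = h" "(p \<bullet> b2) \<bullet> b = y1 \<bullet> p1"
    by (rule tri_unique[OF t2[unfolded ez] t])
  note [simp] = mutually_inverse_simps[OF b(1)] b(2)
  have "(b \<bullet> (i1 \<bullet> (x1 \<bullet> r') \<boxplus> i2 \<bullet> (b1 \<bullet> h))) \<bullet> s = h \<bullet> s" unfolding b(3) by simp
  \<comment> \<open>The comparison isomorphism maps one copy of \<open>M\<close> identically to the
    other. It is therefore triangular, and its entry from \<open>L1\<close> to \<open>L\<close> is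
    inverted by the corresponding entry of \<open>b'\<close>.\<close>
  then have bi2: "b \<bullet> i2 = a1" using h by simp
  have a1b: "b' \<bullet> a1 = i2" unfolding bi2[symmetric] by simp
  have "b2 \<bullet> (b \<bullet> ((i1 \<bullet> p1 \<boxplus> i2 \<bullet> p2) \<bullet> (b' \<bullet> a2))) = idt L"
    unfolding biproduct_id[OF B1] by simp
  moreover have "b \<bullet> (i2 \<bullet> (p2 \<bullet> (b' \<bullet> a2))) = a1 \<bullet> (p2 \<bullet> (b' \<bullet> a2))"
    using cmp_assoc[of "p2 \<bullet> (b' \<bullet> a2)" i2 b] bi2 by simp
  ultimately have inv1: "(b2 \<bullet> (b \<bullet> i1)) \<bullet> (p1 \<bullet> (b' \<bullet> a2)) = idt L" by simp
  have "p1 \<bullet> (b' \<bullet> ((a1 \<bullet> b1 \<boxplus> a2 \<bullet> b2) \<bullet> (b \<bullet> i1))) = idt L1"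
    unfolding biproduct_id[OF B'] by simp
  moreover have "b' \<bullet> (a1 \<bullet> (b1 \<bullet> (b \<bullet> i1))) = i2 \<bullet> (b1 \<bullet> (b \<bullet> i1))"
    using cmp_assoc[of "b1 \<bullet> (b \<bullet> i1)" a1 b'] a1b by simp
  ultimately have inv2: "(p1 \<bullet> (b' \<bullet> a2)) \<bullet> (b2 \<bullet> (b \<bullet> i1)) = idt L1" by simp
  have iso: "mutually_inverse (b2 \<bullet> (b \<bullet> i1)) (p1 \<bullet> (b' \<bullet> a2))"
    by (rule mutually_inverseI[OF _ _ inv2 inv1]) simp_all
  have 1: "tri X L N ((b2 \<bullet> (b \<bullet> i1)) \<bullet> x1) (y1 \<bullet> (p1 \<bullet> (b' \<bullet> a2))) ?z"
    by (rule tri_equiv[OF t1 iso]) simp_all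
  have "(b \<bullet> (i1 \<bullet> (x1 \<bullet> r') \<boxplus> i2 \<bullet> (b1 \<bullet> h))) \<bullet> ?e = h \<bullet> ?e" unfolding b(3) by simp
  moreover have "(b1 \<bullet> h) \<bullet> ?e = zro X M" by (rule biproductD(18)[OF W2])
  moreover have "h \<bullet> (s \<bullet> ?f) = a1 \<bullet> ?f" using cmp_assoc[of ?f s h] h by simp
  ultimately have "b \<bullet> (i1 \<bullet> x1) = h \<bullet> e \<boxplus> \<boxminus> (a1 \<bullet> ?f)" by simp
  then have "b2 \<bullet> (b \<bullet> (i1 \<bullet> x1)) = b2 \<bullet> (h \<bullet> e)" by simp
  then have 2: "(b2 \<bullet> (b \<bullet> i1)) \<bullet> x1 = b2 \<bullet> (h \<bullet> e)" by simp
  have "y1 \<bullet> (p1 \<bullet> (b' \<bullet> a2)) = ((p \<bullet> b2) \<bullet> b) \<bullet> (b' \<bullet> a2)" unfolding b(4) by simp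
  then have "y1 \<bullet> (p1 \<bullet> (b' \<bullet> a2)) = p" by simp
  then show ?thesis using 1 2 by simp
qed

text \<open>
  The octahedron on the deflations \<open>M \<oplus> L \<rightarrow> L \<oplus> Y\<close> and \<open>v\<close> contains a triangle \<open>X \<rightarrow> W \<rightarrow> M\<close>. Its
  extension is the pullback of \<open>\<delta>\<close> along the deflation of its own triangle, hence zero. So \<open>W = X \<oplus> M\<close>,
  and the summand \<open>M\<close> can be cancelled.
\<close>

lemma deflation_parallel:
  assumes t: "tri M S N w v \<epsilon>" and S: "biproduct C L Y S iL iY pL pY"
    and f: "tri X M Y f (pY \<bullet> w) \<delta>"
  shows "\<exists>g \<delta>'. tri X L N g (v \<bullet> iL) \<delta>'"
proof -
  note [simp] = triD[OF t] biproductD[OF S] triD[OF f]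
  let ?m = "pL \<bullet> w" let ?y = "pY \<bullet> w"
  have w: "w = iL \<bullet> ?m \<boxplus> iY \<bullet> ?y" by (rule biproduct_decomp[OF S]) simp_all
  obtain B' a1 a2 b1 b2 where B': "biproduct C M L B' a1 a2 b1 b2" using ex_biproduct[of M L] by auto
  note [simp] = biproductD[OF B']
  have 1: "tri X B' S (a1 \<bullet> f) (iY \<bullet> (?y \<bullet> b1) \<boxplus> iL \<bullet> b2) (pull X pY \<delta>)"
    by (rule tri_sum_right[OF f B' biproduct_swap[OF S]])
  let ?n = "a2 \<bullet> (?m \<bullet> b1)"
  \<comment> \<open>This shear of \<open>M \<oplus> L\<close> turns the deflation with components
    \<open>?y\<close> and the identity of \<open>L\<close> into \<open>?u\<close>. The composite of
    \<open>v\<close> with \<open>?u\<close> ignores \<open>M\<close>, since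
    \<open>v \<bullet> w\<close> is zero.\<close>
  have "mutually_inverse (idt B' \<boxplus> ?n) (idt B' \<boxplus> \<boxminus> ?n)"
    by (rule square_zero_inverse) simp_all
  then have th: "mutually_inverse (idt B' \<boxplus> \<boxminus> ?n) (idt B' \<boxplus> ?n)" by (rule mutually_inverse_sym)
  let ?u = "w \<bullet> b1 \<boxplus> iL \<bullet> b2"
  have 2: "tri X B' S ((idt B' \<boxplus> \<boxminus> ?n) \<bullet> (a1 \<bullet> f))
      ((iY \<bullet> (?y \<bullet> b1) \<boxplus> iL \<bullet> b2) \<bullet> (idt B' \<boxplus> ?n)) (pull X pY \<delta>)"
    by (rule tri_equiv[OF 1 th]) simp_all
  have "(iY \<bullet> (?y \<bullet> b1) \<boxplus> iL \<bullet> b2) \<bullet> (idt B' \<boxplus> ?n) = (iL \<bullet> ?m \<boxplus> iY \<bullet> ?y) \<bullet> b1 \<boxplus> iL \<bullet> b2"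
    by (simp add: madd_ac)
  then have "(iY \<bullet> (?y \<bullet> b1) \<boxplus> iL \<bullet> b2) \<bullet> (idt B' \<boxplus> ?n) = ?u" using w by simp
  then have 3: "tri X B' S (a1 \<bullet> f \<boxplus> \<boxminus> (a2 \<bullet> (?m \<bullet> f))) ?u (pull X pY \<delta>)" using 2 by simp
  obtain W h e r \<delta>'' where W: "tri W B' N h (v \<bullet> ?u) \<delta>''" "tri X W M e r (pull X w (pull X pY \<delta>))"
    and eq: "?u \<bullet> h = w \<bullet> r" "h \<bullet> e = a1 \<bullet> f \<boxplus> \<boxminus> (a2 \<bullet> (?m \<bullet> f))"
    using ET4_op_rule[OF t 3] by blast
  note [simp] = triD[OF W(1)] triD[OF W(2)]
  have vw: "v \<bullet> w = zro M N" by (rule tri_cmp_zero[OF t])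
  have "v \<bullet> ?u = (v \<bullet> w) \<bullet> b1 \<boxplus> (v \<bullet> iL) \<bullet> b2" by simp
  then have vu: "v \<bullet> ?u = (v \<bullet> iL) \<bullet> b2" unfolding vw by simp
  have "pull X w (pull X pY \<delta>) = pull X ?y \<delta>" by (subst pull_cmp) simp_all
  also have "\<dots> = ex0 M X" by (rule tri_pull_zero[OF f])
  finally have sp: "pull X w (pull X pY \<delta>) = ex0 M X" .
  obtain s0 where s0: "\<guillemotleft>s0 : M \<rightarrow> W\<guillemotright>" "r \<bullet> s0 = idt M"
    using lift_to_middle[OF W(2), of "idt M" M] sp by auto
  note [simp] = s0
  \<comment> \<open>A section of \<open>r\<close> is free up to morphisms \<open>M -> X\<close>. The
    coordinates of \<open>h \<bullet> s0\<close> deviate from those of \<open>a1\<close> by the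
    image of some \<open>\<tau> : M -> X\<close>; subtracting \<open>e \<bullet> \<tau>\<close>
    gives a section that \<open>h\<close> sends to \<open>a1\<close>, as the cancellation of
    \<open>M\<close> requires.\<close>
  let ?al = "b1 \<bullet> (h \<bullet> s0)" let ?be = "b2 \<bullet> (h \<bullet> s0)"
  have "(?u \<bullet> h) \<bullet> s0 = w" unfolding eq(1) by simp
  then have wab: "w \<bullet> ?al \<boxplus> iL \<bullet> ?be = w" by simp
  have "pY \<bullet> (w \<bullet> ?al \<boxplus> iL \<bullet> ?be) = ?y" unfolding wab ..
  then have "?y \<bullet> (?al \<boxplus> \<boxminus> (idt M)) = zro M Y" by simp
  then obtain \<tau> where tau: "\<guillemotleft>\<tau> : M \<rightarrow> X\<guillemotright>" "f \<bullet> \<tau> = ?al \<boxplus> \<boxminus> (idt M)" using lift_to_left[OF f, of "?al \<boxplus> \<boxminus> (idt M)" M] by auto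
  note [simp] = tau(1)
  have ft: "?al \<boxplus> \<boxminus> (f \<bullet> \<tau>) = idt M" unfolding tau(2) by simp
  have "pL \<bullet> (w \<bullet> ?al \<boxplus> iL \<bullet> ?be) = ?m" unfolding wab ..
  then have mab: "?m \<bullet> ?al \<boxplus> ?be = ?m" by simp
  let ?s = "s0 \<boxplus> \<boxminus> (e \<bullet> \<tau>)"
  have "r \<bullet> e = zro X M" by (rule tri_cmp_zero[OF W(2)])
  then have "r \<bullet> (e \<bullet> \<tau>) = zro M M" using cmp_assoc[of \<tau> e r] by simp
  then have rs: "r \<bullet> ?s = idt M" by simp
  have hs: "h \<bullet> ?s = a1"
  proof (rule biproduct_ext[OF B'])
    have he: "h \<bullet> (e \<bullet> \<tau>) = a1 \<bullet> (f \<bullet> \<tau>) \<boxplus> \<boxminus> (a2 \<bullet> (?m \<bullet> (f \<bullet> \<tau>)))"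
      using cmp_assoc[of \<tau> e h] eq(2) by simp
    show "b1 \<bullet> (h \<bullet> ?s) = b1 \<bullet> a1" using ft he by simp
    have "?be \<boxplus> ?m \<bullet> (f \<bullet> \<tau>) = zro M L"
    proof -
      have "?m \<bullet> (f \<bullet> \<tau>) = ?m \<bullet> ?al \<boxplus> \<boxminus> ?m" unfolding tau(2) by simp
      then have "?be \<boxplus> ?m \<bullet> (f \<bullet> \<tau>) = (?m \<bullet> ?al \<boxplus> ?be) \<boxplus> \<boxminus> ?m" by (simp add: madd_lcomm)
      then show ?thesis unfolding mab by simp
    qed
    then show "b2 \<bullet> (h \<bullet> ?s) = b2 \<bullet> a1" using he by simp
  qed simp_all
  obtain s where s: "\<guillemotleft>s : M \<rightarrow> W\<guillemotright>" and rs: "r \<bullet> s = idt M" and hs: "h \<bullet> s = a1"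
    using that[of ?s] rs hs by simp
  note [simp] = s
  obtain \<rho> where rho: "\<guillemotleft>\<rho> : W \<rightarrow> X\<guillemotright>" "\<rho> \<bullet> e = idt X"
    using extend_to_middle[OF W(2), of "idt X" X] sp by auto
  note [simp] = rho
  let ?\<rho> = "\<rho> \<boxplus> \<boxminus> (\<rho> \<bullet> (s \<bullet> r))"
  have re: "r \<bullet> e = zro X M" by (rule tri_cmp_zero[OF W(2)])
  have rsr: "r \<bullet> (s \<bullet> h) = h" if "ar h" "cd h = M" for h
    using cmp_assoc[of h s r] rs that by simp
  then have "r \<bullet> (idt W \<boxplus> \<boxminus> (s \<bullet> r)) = zro W M" by simp
  then obtain t where t: "\<guillemotleft>t : W \<rightarrow> X\<guillemotright>" "e \<bullet> t = idt W \<boxplus> \<boxminus> (s \<bullet> r)"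
    using lift_to_left[OF W(2), of "idt W \<boxplus> \<boxminus> (s \<bullet> r)" W] by auto
  have "?\<rho> = \<rho> \<bullet> (idt W \<boxplus> \<boxminus> (s \<bullet> r))" by simp
  also have "\<dots> = (\<rho> \<bullet> e) \<bullet> t" unfolding t(2)[symmetric] using t(1) by (subst cmp_assoc) simp_all
  also have "\<dots> = t" using t(1) by simp
  finally have rt: "?\<rho> = t" .
  have "biproduct C X M W e s t r"
  proof (rule biproductI)
    show "t \<bullet> e = idt X" unfolding rt[symmetric] using re by simp
    show "t \<bullet> s = zro M X" unfolding rt[symmetric] using rs cmp_assoc[of s r s] by simp
    show "e \<bullet> t \<boxplus> s \<bullet> r = idt W" unfolding t(2) by simp
  qed (use t rs re in simp_all)
  from tri_cancel_idt[OF W(1)[unfolded vu] B' this hs, of] show ?thesis by auto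
qed

text \<open>Pushing out \<open>M -> L -> Z\<close> along \<open>pY \<bullet> w\<close> gives
  \<open>Y -> E -> Z\<close>. The homotopy pushout triangle \<open>M -> S -> E\<close> has the same
  inflation \<open>w\<close> as the given triangle, so \<open>E\<close> and \<open>N\<close> are
  isomorphic. The sign in \<open>\<boxminus> u\<close> undoes the one in the deflation of that
  triangle.\<close>

lemma inflation_parallel:
  assumes t: "tri M S N w v \<epsilon>" and S: "biproduct C L Y S iL iY pL pY"
    and f: "tri M L Z (pL \<bullet> w) f \<delta>"
  shows "\<exists>g \<delta>'. tri Y N Z (v \<bullet> iY) g \<delta>'"
proof -
  note [simp] = triD[OF t] biproductD[OF S] triD[OF f]
  obtain E d e where d: "tri Y E Z d e (push Z (pY \<bullet> w) \<delta>)" using ex_tri[of Z Y "push Z (pY \<bullet> w) \<delta>"] by auto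
  note [simp] = triD[OF d]
  obtain c where c: "\<guillemotleft>c : L \<rightarrow> E\<guillemotright>"
    "tri M S E (iL \<bullet> (pL \<bullet> w) \<boxplus> iY \<bullet> (pY \<bullet> w)) (c \<bullet> pL \<boxplus> \<boxminus> (d \<bullet> pY)) (pull M e \<delta>)"
    using homotopy_pushout[OF f _ d S] by auto
  note [simp] = c(1)
  have w: "iL \<bullet> (pL \<bullet> w) \<boxplus> iY \<bullet> (pY \<bullet> w) = w" by (rule biproduct_decomp[OF S, symmetric]) simp_all
  note t' = c(2)[unfolded w]
  obtain u where u: "\<guillemotleft>u : E \<rightarrow> N\<guillemotright>" "u \<bullet> (c \<bullet> pL \<boxplus> \<boxminus> (d \<bullet> pY)) = v \<bullet> idt S"
      "push E (idt M) (pull M e \<delta>) = pull M u \<epsilon>"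
    using tri_fill_right[OF t' t, of "idt M" "idt S"] by auto
  then obtain u' where u': "mutually_inverse u u'"
    using tri_right_iso[OF t' t mutually_inverse_idt[of M] _ mutually_inverse_idt[of S] _ u(1)] by auto
  note [simp] = u(1) mutually_inverse_simps[OF u']
  have "(u \<bullet> (c \<bullet> pL \<boxplus> \<boxminus> (d \<bullet> pY))) \<bullet> iY = v \<bullet> iY" unfolding u(2) by simp
  then have ud: "\<boxminus> u \<bullet> d = v \<bullet> iY" by simp
  have "mutually_inverse (\<boxminus> u) (\<boxminus> u')" by (rule mutually_inverseI[of _ E N]) simp_all
  from tri_equiv[OF d this] have "tri Y N Z (\<boxminus> u \<bullet> d) (e \<bullet> \<boxminus> u') (push Z (pY \<bullet> w) \<delta>)" by simp
  then show ?thesis unfolding ud by blast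
qed

text \<open>Duality exchanges \<open>M\<close> with \<open>N\<close> and inflations with deflations,
  so the converse implication is \<open>inflation_parallel\<close> in \<open>opp C\<close>.\<close>

lemma deflation_parallel_iff:
  assumes t: "tri M S N w v \<epsilon>" and S: "biproduct C L Y S iL iY pL pY"
  shows "(\<exists>f \<delta>. tri X M Y f (pY \<bullet> w) \<delta>) \<longleftrightarrow> (\<exists>g \<delta>. tri X L N g (v \<bullet> iL) \<delta>)"
  using deflation_parallel[OF t S, of X]
    extriangulated_category.inflation_parallel[OF extriangulated_category_opp,
      of N S M v w \<epsilon> L Y pL pY iL iY X] assms by auto

lemma inflation_parallel_iff:
  assumes t: "tri M S N w v \<epsilon>" and S: "biproduct C L Y S iL iY pL pY"
  shows "(\<exists>f \<delta>. tri M L Z (pL \<bullet> w) f \<delta>) \<longleftrightarrow> (\<exists>g \<delta>. tri Y N Z (v \<bullet> iY) g \<delta>)"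
  using inflation_parallel[OF t S, of Z]
    extriangulated_category.deflation_parallel[OF extriangulated_category_opp,
      of N S M v w \<epsilon> L Y pL pY iL iY Z] assms by auto

end

section \<open>Satellites of half exact functors\<close>

text \<open>The common abstraction of \<open>Hom(X,-)\<close> and all
  \<open>\<E>\<^sub>I\<^sup>-\<^sup>n(X,-)\<close>. Exactness is required at the middle term only,
  and this is what passes to the satellite.\<close>

locale half_exact_functor = extriangulated_category K C
  for K :: "'k ring" and C :: "('k, 'o, 'm, 'e) ext_data" +
  fixes F :: "'o \<Rightarrow> ('k, 'v) module" and act :: "'o \<Rightarrow> 'o \<Rightarrow> 'm \<Rightarrow> 'v \<Rightarrow> 'v"
  assumes F_vectorspace: "ob Y \<Longrightarrow> vectorspace K (F Y)"
    and act_closed: "\<lbrakk>ar f; dm f = X; cd f = Y; h \<in> carrier (F X)\<rbrakk> \<Longrightarrow> act X Y f h \<in> carrier (F Y)"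
    and act_add: "\<lbrakk>ar f; dm f = X; cd f = Y; h \<in> carrier (F X); h' \<in> carrier (F X)\<rbrakk>
      \<Longrightarrow> act X Y f (h \<oplus>\<^bsub>F X\<^esub> h') = act X Y f h \<oplus>\<^bsub>F Y\<^esub> act X Y f h'"
    and act_smult: "\<lbrakk>ar f; dm f = X; cd f = Y; h \<in> carrier (F X); r \<in> carrier K\<rbrakk>
      \<Longrightarrow> act X Y f (r \<odot>\<^bsub>F X\<^esub> h) = r \<odot>\<^bsub>F Y\<^esub> act X Y f h"
    and act_idt: "\<lbrakk>ob X; h \<in> carrier (F X)\<rbrakk> \<Longrightarrow> act X X (idt X) h = h"
    and act_cmp: "\<lbrakk>ar f; ar g; dm f = X; cd f = Y; dm g = Y; cd g = Z; h \<in> carrier (F X)\<rbrakk>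
      \<Longrightarrow> act X Z (g \<bullet> f) h = act Y Z g (act X Y f h)"
    and act_madd: "\<lbrakk>ar f; ar g; dm f = X; cd f = Y; dm g = X; cd g = Y; h \<in> carrier (F X)\<rbrakk>
      \<Longrightarrow> act X Y (f \<boxplus> g) h = act X Y f h \<oplus>\<^bsub>F Y\<^esub> act X Y g h"
    and act_exact: "\<lbrakk>tri A B Z x y \<delta>; h \<in> carrier (F B); act B Z y h = \<zero>\<^bsub>F Z\<^esub>\<rbrakk>
      \<Longrightarrow> \<exists>h' \<in> carrier (F A). act A B x h' = h"
begin

abbreviation F0 where "F0 X \<equiv> \<zero>\<^bsub>F X\<^esub>"

lemma F_abelian_group: "ob Y \<Longrightarrow> abelian_group (F Y)"
  using F_vectorspace[of Y] unfolding vectorspace_def by (blast dest: Module.module.axioms(2))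

lemma F0_closed [simp]: "ob Y \<Longrightarrow> F0 Y \<in> carrier (F Y)"
  using F_abelian_group abelian_groupE(2) by blast

lemma F_idem:
  assumes "ob Y" "h \<in> carrier (F Y)" "h \<oplus>\<^bsub>F Y\<^esub> h = h" shows "h = F0 Y"
proof -
  interpret abelian_group "F Y" using assms by (simp add: F_abelian_group)
  show ?thesis using assms r_neg1[of h h] l_neg[of h] by simp
qed

lemma F0_add [simp]:
  assumes "ob Y" "h \<in> carrier (F Y)" shows "F0 Y \<oplus>\<^bsub>F Y\<^esub> h = h" "h \<oplus>\<^bsub>F Y\<^esub> F0 Y = h"
proof -
  interpret abelian_group "F Y" using assms by (simp add: F_abelian_group)
  show "F0 Y \<oplus>\<^bsub>F Y\<^esub> h = h" "h \<oplus>\<^bsub>F Y\<^esub> F0 Y = h" using assms by simp_all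
qed

lemma act_F0 [simp]: "ar f \<Longrightarrow> dm f = X \<Longrightarrow> cd f = Y \<Longrightarrow> act X Y f (F0 X) = F0 Y"
  using F_idem[of Y "act X Y f (F0 X)"] act_add[of f X Y "F0 X" "F0 X"] arrowE[of f]
    act_closed[of f X Y "F0 X"] by auto

lemma act_zro [simp]: "ob X \<Longrightarrow> ob Y \<Longrightarrow> h \<in> carrier (F X) \<Longrightarrow> act X Y (zro X Y) h = F0 Y"
  using F_idem[of Y "act X Y (zro X Y) h"] act_madd[of "zro X Y" "zro X Y" X Y h]
    act_closed[of "zro X Y" X Y h] by auto

lemma act_mneg_zero:
  assumes "ar f" "dm f = X" "cd f = Y" "h \<in> carrier (F X)" "act X Y f h = F0 Y"
  shows "act X Y (\<boxminus> f) h = F0 Y"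
proof -
  have [simp]: "ob Y" using assms(1,3) ob_cd by blast
  show ?thesis
    using act_cmp[of f "\<boxminus> (idt Y)" X Y Y h] assms arrowE[of f] by auto
qed

end

locale half_exact_with_syzygies = half_exact_functor K C F act
  for K :: "'k ring" and C :: "('k, 'o, 'm, 'e) ext_data"
    and F :: "'o \<Rightarrow> ('k, 'v) module" and act :: "'o \<Rightarrow> 'o \<Rightarrow> 'm \<Rightarrow> 'v \<Rightarrow> 'v" +
  fixes S :: "('o, 'm, 'e) syzygies"
  assumes choice: "syzygy_choice C S" and enough: "enough_projectives C"
begin

text \<open>The left satellite of \<open>F\<close>, computed on the chosen syzygies; for
  \<open>negext_I C S n X\<close> it is \<open>negext_I C S (Suc n) X\<close>. As a subspace of
  \<open>F (sK S Y)\<close> it inherits all operations.\<close>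

definition sat :: "'o \<Rightarrow> ('k, 'v) module" where
  "sat Y = (F (sK S Y)) \<lparr> carrier :=
     {h \<in> carrier (F (sK S Y)). act (sK S Y) (sG S Y) (sk S Y) h = F0 (sG S Y)} \<rparr>"

definition sat_act :: "'o \<Rightarrow> 'o \<Rightarrow> 'm \<Rightarrow> 'v \<Rightarrow> 'v" where
  "sat_act Y Y' f h = act (sK S Y) (sK S Y') (syzygy_map C S Y Y' f) h"

abbreviation satc where "satc Y \<equiv> carrier (sat Y)"

lemma satc_iff: "h \<in> satc Y \<longleftrightarrow>
    h \<in> carrier (F (sK S Y)) \<and> act (sK S Y) (sG S Y) (sk S Y) h = F0 (sG S Y)"
  unfolding sat_def by simp

lemma sat_sel [simp]: "\<zero>\<^bsub>sat Y\<^esub> = F0 (sK S Y)" "add (sat Y) = add (F (sK S Y))"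
    "smult (sat Y) = smult (F (sK S Y))"
  unfolding sat_def by simp_all

lemma syz:
  assumes "ob Y" shows "tri (sK S Y) (sG S Y) Y (sk S Y) (sg S Y) (sd S Y)"
    "ob A \<Longrightarrow> \<delta> \<in> exts C Y A \<Longrightarrow> pull A (sg S Y) \<delta> = ex0 (sG S Y) A"
  using choice assms unfolding syzygy_choice_def projective_morphism_def by auto

lemma syzD [simp]:
  assumes "ob Y"
  shows "ob (sK S Y)" "ob (sG S Y)" "ar (sk S Y)" "dm (sk S Y) = sK S Y" "cd (sk S Y) = sG S Y"
    "ar (sg S Y)" "dm (sg S Y) = sG S Y" "cd (sg S Y) = Y" "sd S Y \<in> exts C Y (sK S Y)"
  using triD[OF syz(1)[OF assms]] by simp_all

text \<open>As \<open>sg\<close> is a projective morphism, \<open>f \<bullet> sg S Y\<close> lifts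
  through the deflation \<open>y\<close> whether or not \<open>sG S Y\<close> is projective. The
  lift completes to a morphism of triangles.\<close>

lemma ex_syzygy_lift:
  assumes t: "tri P B Z x y \<delta>" and f: "\<guillemotleft>f : Y \<rightarrow> Z\<guillemotright>"
  shows "\<exists>f'. \<guillemotleft>f' : sK S Y \<rightarrow> P\<guillemotright> \<and> push Y f' (sd S Y) = pull P f \<delta>"
proof -
  note [simp] = triD[OF t] f
  have [simp]: "ob Y" using f ob_dm by blast
  have "pull P (f \<bullet> sg S Y) \<delta> = ex0 (sG S Y) P"
    using syz(2)[of Y P "pull P f \<delta>"] by simp
  then obtain s where s: "\<guillemotleft>s : sG S Y \<rightarrow> B\<guillemotright>" "y \<bullet> s = f \<bullet> sg S Y"
    using lift_to_middle[OF t, of "f \<bullet> sg S Y" "sG S Y"] by auto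
  show ?thesis using tri_fill_left[OF syz(1) t s(1) f s(2)] by auto
qed

lemma syzygy_map:
  assumes f: "\<guillemotleft>f : Y \<rightarrow> Y'\<guillemotright>"
  shows "\<guillemotleft>syzygy_map C S Y Y' f : sK S Y \<rightarrow> sK S Y'\<guillemotright>"
    "push Y (syzygy_map C S Y Y' f) (sd S Y) = pull (sK S Y') f (sd S Y')"
proof -
  have [simp]: "ob Y" "ob Y'" using f ob_dm ob_cd by blast+
  obtain f' where "\<guillemotleft>f' : sK S Y \<rightarrow> sK S Y'\<guillemotright> \<and> push Y f' (sd S Y) = pull (sK S Y') f (sd S Y')"
    using ex_syzygy_lift[OF syz(1) f] by auto
  then have "f' \<in> arr C (sK S Y) (sK S Y') \<and> push Y f' (sd S Y) = pull (sK S Y') f (sd S Y')"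
    by (simp add: arr_iff)
  from someI[of "\<lambda>f'. f' \<in> arr C (sK S Y) (sK S Y') \<and> push Y f' (sd S Y) = pull (sK S Y') f (sd S Y')", OF this]
  show "\<guillemotleft>syzygy_map C S Y Y' f : sK S Y \<rightarrow> sK S Y'\<guillemotright>"
    "push Y (syzygy_map C S Y Y' f) (sd S Y) = pull (sK S Y') f (sd S Y')"
    unfolding syzygy_map_def by (auto simp: arr_iff)
qed

text \<open>The difference of two such morphisms extends over \<open>sk\<close>, and
  \<open>satc\<close> consists of what \<open>sk\<close> kills. Thus neither the action on
  satellites nor the connecting map depends on the chosen lift.\<close>

lemma act_unique:
  assumes "ob Y" "ob P" "\<guillemotleft>u : sK S Y \<rightarrow> P\<guillemotright>" "\<guillemotleft>u' : sK S Y \<rightarrow> P\<guillemotright>"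
    "push Y u (sd S Y) = push Y u' (sd S Y)" "h \<in> satc Y"
  shows "act (sK S Y) P u h = act (sK S Y) P u' h"
proof -
  note [simp] = assms(1-4)
  have "push Y (u \<boxplus> \<boxminus> u') (sd S Y) = ex0 Y P" using push_diff[of Y u u' "sd S Y"] assms(5) by simp
  then obtain r where r: "\<guillemotleft>r : sG S Y \<rightarrow> P\<guillemotright>" "r \<bullet> sk S Y = u \<boxplus> \<boxminus> u'"
    using extend_to_middle[OF syz(1)[OF assms(1)], of "u \<boxplus> \<boxminus> u'" P] by auto
  have u: "u = u' \<boxplus> r \<bullet> sk S Y" unfolding r(2) by simp
  have h: "h \<in> carrier (F (sK S Y))" "act (sK S Y) (sG S Y) (sk S Y) h = F0 (sG S Y)"
    using assms(6) satc_iff by auto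
  have "act (sK S Y) P (r \<bullet> sk S Y) h = F0 P" using h r(1) by (subst act_cmp[where Y = "sG S Y"]) simp_all
  then show ?thesis unfolding u using h(1) r(1) act_closed[of u' "sK S Y" P h]
    by (subst act_madd) simp_all
qed

lemma sat_act_eq:
  assumes "\<guillemotleft>f : Y \<rightarrow> Y'\<guillemotright>" "\<guillemotleft>u : sK S Y \<rightarrow> sK S Y'\<guillemotright>"
    "push Y u (sd S Y) = pull (sK S Y') f (sd S Y')" "h \<in> satc Y"
  shows "sat_act Y Y' f h = act (sK S Y) (sK S Y') u h"
  unfolding sat_act_def using assms syzygy_map[OF assms(1)] ob_dm[of f Y] ob_cd[of f Y']
  by (intro act_unique) simp_all

text \<open>With the identity as \<open>f\<close> this concerns the connecting map
  \<open>sat Z -> F P\<close>; with a chosen syzygy triangle as \<open>t\<close> it concerns the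
  action of \<open>f\<close> on satellites.\<close>

lemma connecting_closed:
  assumes t: "tri P B Z x y \<delta>" and u: "\<guillemotleft>u : sK S Y \<rightarrow> P\<guillemotright>" and f: "\<guillemotleft>f : Y \<rightarrow> Z\<guillemotright>"
    and e: "push Y u (sd S Y) = pull P f \<delta>" and h: "h \<in> satc Y"
  shows "act (sK S Y) P u h \<in> carrier (F P)" "act P B x (act (sK S Y) P u h) = F0 B"
proof -
  note [simp] = triD[OF t] u f
  have [simp]: "ob Y" using f ob_dm by blast
  have h: "h \<in> carrier (F (sK S Y))" "act (sK S Y) (sG S Y) (sk S Y) h = F0 (sG S Y)"
    using h satc_iff by auto
  show "act (sK S Y) P u h \<in> carrier (F P)" using h by (intro act_closed) simp_all
  obtain s where s: "\<guillemotleft>s : sG S Y \<rightarrow> B\<guillemotright>" "s \<bullet> sk S Y = x \<bullet> u"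
    using tri_morphism[OF syz(1) t u f e] by auto
  have "act P B x (act (sK S Y) P u h) = act (sK S Y) B (x \<bullet> u) h"
    using h by (subst act_cmp[where Y = P]) simp_all
  also have "\<dots> = F0 B" unfolding s(2)[symmetric] using h s(1)
    by (subst act_cmp[where Y = "sG S Y"]) simp_all
  finally show "act P B x (act (sK S Y) P u h) = F0 B" .
qed

lemma sat_act_closed:
  assumes "\<guillemotleft>f : Y \<rightarrow> Y'\<guillemotright>" "h \<in> satc Y" shows "sat_act Y Y' f h \<in> satc Y'"
  using connecting_closed[OF syz(1)[of Y'] syzygy_map(1)[OF assms(1)] assms(1) syzygy_map(2)[OF assms(1)] assms(2)]
    ob_cd[of f Y'] assms unfolding sat_act_def satc_iff by auto

text \<open>
  The homotopy pushout of \<open>K \<rightarrow> G \<rightarrow> Z\<close> along \<open>u\<close> turns \<open>P \<rightarrow> B \<rightarrow> Z\<close> into a triangle \<open>K \<rightarrow> G \<oplus> P \<rightarrow> B\<close>.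
  Half exactness for it is exactness at \<open>F P\<close> of the long sequence; iterating moves one step to the left.
\<close>

lemma rotate:
  assumes t: "tri P B Z x y \<delta>" and u: "\<guillemotleft>u : sK S Z \<rightarrow> P\<guillemotright>" "push Z u (sd S Z) = \<delta>"
  obtains Q i j p q c where "biproduct C (sG S Z) P Q i j p q" "\<guillemotleft>c : sG S Z \<rightarrow> B\<guillemotright>" "y \<bullet> c = sg S Z"
    "tri (sK S Z) Q B (i \<bullet> sk S Z \<boxplus> j \<bullet> u) (c \<bullet> p \<boxplus> \<boxminus> (x \<bullet> q)) (pull (sK S Z) y (sd S Z))"
proof -
  note [simp] = triD[OF t] u(1)
  obtain Q i j p q where Q: "biproduct C (sG S Z) P Q i j p q" using ex_biproduct[of "sG S Z" P] by auto
  have t': "tri P B Z x y (push Z u (sd S Z))" unfolding u(2) by (rule t)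
  show ?thesis using homotopy_pushout[OF syz(1) u(1) t' Q] that[OF Q] by auto
qed

text \<open>The element \<open>(0, a)\<close> of \<open>F Q\<close> is killed by the deflation
  \<open>(c, -x)\<close>, so it comes from \<open>F (sK S Z)\<close>. Its first coordinate says that
  the preimage lies in \<open>satc Z\<close>, its second that \<open>u\<close> sends the preimage to
  \<open>a\<close>.\<close>

lemma connecting_onto:
  assumes t: "tri P B Z x y \<delta>" and u: "\<guillemotleft>u : sK S Z \<rightarrow> P\<guillemotright>" "push Z u (sd S Z) = \<delta>"
    and a: "a \<in> carrier (F P)" "act P B x a = F0 B"
  shows "\<exists>h \<in> satc Z. act (sK S Z) P u h = a"
proof -
  note [simp] = triD[OF t] u(1)
  obtain Q i j p q c where Q: "biproduct C (sG S Z) P Q i j p q" and c: "\<guillemotleft>c : sG S Z \<rightarrow> B\<guillemotright>"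
    and "y \<bullet> c = sg S Z" and t': "tri (sK S Z) Q B (i \<bullet> sk S Z \<boxplus> j \<bullet> u) (c \<bullet> p \<boxplus> \<boxminus> (x \<bullet> q)) (pull (sK S Z) y (sd S Z))"
    by (rule rotate[OF t u])
  note [simp] = biproductD[OF Q] c
  let ?w = "i \<bullet> sk S Z \<boxplus> j \<bullet> u" let ?v = "c \<bullet> p \<boxplus> \<boxminus> (x \<bullet> q)"
  have ja: "act P Q j a \<in> carrier (F Q)" using a by (intro act_closed) simp_all
  have "act Q B ?v (act P Q j a) = act P B (?v \<bullet> j) a" by (rule act_cmp[symmetric]) (use a in simp_all)
  also have "?v \<bullet> j = \<boxminus> x" by simp
  also have "act P B (\<boxminus> x) a = F0 B" using a by (intro act_mneg_zero) simp_all
  finally obtain h where h: "h \<in> carrier (F (sK S Z))" "act (sK S Z) Q ?w h = act P Q j a"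
    using act_exact[OF t' ja] by auto
  have "act (sK S Z) (sG S Z) (p \<bullet> ?w) h = act Q (sG S Z) p (act P Q j a)"
    unfolding h(2)[symmetric] by (rule act_cmp) (use h in simp_all)
  also have "\<dots> = act P (sG S Z) (p \<bullet> j) a" by (rule act_cmp[symmetric]) (use a in simp_all)
  finally have 1: "act (sK S Z) (sG S Z) (sk S Z) h = F0 (sG S Z)" using a by simp
  have "act (sK S Z) P (q \<bullet> ?w) h = act Q P q (act P Q j a)"
    unfolding h(2)[symmetric] by (rule act_cmp) (use h in simp_all)
  also have "\<dots> = act P P (q \<bullet> j) a" by (rule act_cmp[symmetric]) (use a in simp_all)
  finally have 2: "act (sK S Z) P u h = a" using a by (simp add: act_idt)
  show ?thesis using h 1 2 satc_iff by blast
qed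

text \<open>This is \<open>connecting_onto\<close> for the rotated triangle. Its extension is the
  pullback of \<open>sd S Z\<close> along \<open>y\<close>, so its connecting map is
  \<open>sat_act B Z y\<close>; the two conditions on \<open>h\<close> say that its inflation kills
  \<open>h\<close>.\<close>

lemma connecting_kernel:
  assumes t: "tri P B Z x y \<delta>" and u: "\<guillemotleft>u : sK S Z \<rightarrow> P\<guillemotright>" "push Z u (sd S Z) = \<delta>"
    and h: "h \<in> satc Z" "act (sK S Z) P u h = F0 P"
  shows "\<exists>b \<in> satc B. sat_act B Z y b = h"
proof -
  note [simp] = triD[OF t] u(1)
  obtain Q i j p q c where Q: "biproduct C (sG S Z) P Q i j p q" and c: "\<guillemotleft>c : sG S Z \<rightarrow> B\<guillemotright>"
    and "y \<bullet> c = sg S Z" and t': "tri (sK S Z) Q B (i \<bullet> sk S Z \<boxplus> j \<bullet> u) (c \<bullet> p \<boxplus> \<boxminus> (x \<bullet> q)) (pull (sK S Z) y (sd S Z))"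
    by (rule rotate[OF t u])
  note [simp] = biproductD[OF Q] c
  have h1: "h \<in> carrier (F (sK S Z))" "act (sK S Z) (sG S Z) (sk S Z) h = F0 (sG S Z)"
    using h satc_iff by auto
  have "act (sK S Z) Q (i \<bullet> sk S Z \<boxplus> j \<bullet> u) h = F0 Q"
    using h1 h(2) by (simp add: act_madd act_cmp[where Y = "sG S Z"] act_cmp[where Y = P])
  then obtain b where b: "b \<in> satc B" "act (sK S B) (sK S Z) (syzygy_map C S B Z y) b = h"
    using connecting_onto[OF t' syzygy_map(1) syzygy_map(2) h1(1)] by auto
  then show ?thesis unfolding sat_act_def by blast
qed

text \<open>The deflation \<open>sg\<close> onto a projective object splits, so
  \<open>sd S P\<close> is zero. Identity and zero morphism of the syzygy then have the same
  pushout, and \<open>act_unique\<close> equates their actions.\<close>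

lemma sat_projective:
  assumes P: "projective C P" and h: "h \<in> satc P" shows "h = F0 (sK S P)"
proof -
  have [simp]: "ob P" using P unfolding projective_def by simp
  have "deflation C (sG S P) P (sg S P)" unfolding deflation_def using syz(1)[of P] by auto
  then obtain r where r: "\<guillemotleft>r : P \<rightarrow> sG S P\<guillemotright>" "sg S P \<bullet> r = idt P"
    using P in_hom_arr[of "idt P" P P] unfolding projective_def by (fastforce simp: arr_iff)
  have "pull (sK S P) (sg S P \<bullet> r) (sd S P) = pull (sK S P) r (pull (sK S P) (sg S P) (sd S P))"
    using r(1) by (intro pull_cmp) simp_all
  then have "sd S P = ex0 P (sK S P)" unfolding r(2) using r(1) syz(2)[of P] by simp
  then have "push P (idt (sK S P)) (sd S P) = push P (zro (sK S P) (sK S P)) (sd S P)" by simp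
  then have "act (sK S P) (sK S P) (idt (sK S P)) h = act (sK S P) (sK S P) (zro (sK S P) (sK S P)) h"
    by (intro act_unique) (use h in simp_all)
  then show ?thesis using h satc_iff by (simp add: act_idt)
qed

lemma sat_act_idt:
  assumes "ob Y" "h \<in> satc Y" shows "sat_act Y Y (idt Y) h = h"
proof -
  have "sat_act Y Y (idt Y) h = act (sK S Y) (sK S Y) (idt (sK S Y)) h"
    by (rule sat_act_eq) (use assms in simp_all)
  then show ?thesis using assms satc_iff by (simp add: act_idt)
qed

lemma sat_act_cmp:
  assumes f: "\<guillemotleft>f : X \<rightarrow> Y\<guillemotright>" and g: "\<guillemotleft>g : Y \<rightarrow> Z\<guillemotright>" and h: "h \<in> satc X"
  shows "sat_act X Z (g \<bullet> f) h = sat_act Y Z g (sat_act X Y f h)"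
proof -
  have [simp]: "ob X" "ob Y" "ob Z" using f g ob_dm ob_cd by blast+
  let ?f = "syzygy_map C S X Y f" let ?g = "syzygy_map C S Y Z g"
  note [simp] = f g syzygy_map(1)[OF f] syzygy_map(1)[OF g]
  have "push X (?g \<bullet> ?f) (sd S X) = push X ?g (pull (sK S Y) f (sd S Y))"
    using syzygy_map(2)[OF f] by simp
  also have "\<dots> = pull (sK S Z) f (push Y ?g (sd S Y))"
    by (rule push_pull) simp_all
  also have "\<dots> = pull (sK S Z) (g \<bullet> f) (sd S Z)" using syzygy_map(2)[OF g] by simp
  finally have e: "push X (?g \<bullet> ?f) (sd S X) = pull (sK S Z) (g \<bullet> f) (sd S Z)" .
  have "sat_act X Z (g \<bullet> f) h = act (sK S X) (sK S Z) (?g \<bullet> ?f) h"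
    by (rule sat_act_eq[OF _ _ e h]) simp_all
  also have "\<dots> = sat_act Y Z g (sat_act X Y f h)"
    unfolding sat_act_def using h satc_iff by (intro act_cmp) simp_all
  finally show ?thesis .
qed

lemma sat_act_madd:
  assumes f: "\<guillemotleft>f : X \<rightarrow> Y\<guillemotright>" and g: "\<guillemotleft>g : X \<rightarrow> Y\<guillemotright>" and h: "h \<in> satc X"
  shows "sat_act X Y (f \<boxplus> g) h = sat_act X Y f h \<oplus>\<^bsub>F (sK S Y)\<^esub> sat_act X Y g h"
proof -
  have [simp]: "ob X" "ob Y" using f g ob_dm ob_cd by blast+
  let ?f = "syzygy_map C S X Y f" let ?g = "syzygy_map C S X Y g"
  note [simp] = f g syzygy_map(1)[OF f] syzygy_map(1)[OF g]
  have "push X (?f \<boxplus> ?g) (sd S X) = pull (sK S Y) (f \<boxplus> g) (sd S Y)"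
    using push_madd[of X ?f ?g "sd S X"] pull_madd[of "sK S Y" f g "sd S Y"]
      syzygy_map(2)[OF f] syzygy_map(2)[OF g] by simp
  then have "sat_act X Y (f \<boxplus> g) h = act (sK S X) (sK S Y) (?f \<boxplus> ?g) h"
    by (intro sat_act_eq h) simp_all
  then show ?thesis unfolding sat_act_def using h satc_iff by (simp add: act_madd)
qed

lemma sat_vectorspace:
  assumes [simp]: "ob Y" shows "vectorspace K (sat Y)"
proof -
  interpret V: vectorspace K "F (sK S Y)" by (simp add: F_vectorspace)
  interpret W: vectorspace K "F (sG S Y)" by (simp add: F_vectorspace)
  have "subspace K (satc Y) (F (sK S Y))"
    unfolding subspace_def submodule_def
    by (auto simp: satc_iff act_add act_smult V.vectorspace_axioms V.module_axioms)
  then show ?thesis using V.subspace_is_vs unfolding sat_def by simp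
qed

text \<open>Rotation only gives \<open>b\<close> as the image of an element of \<open>sat Q\<close>
  with \<open>Q = G \<oplus> P\<close>, and \<open>sat G\<close> may be nonzero. However,
  \<open>c\<close> equals a morphism through a projective object \<open>Pr\<close> plus one through
  \<open>x\<close>. As \<open>sat Pr\<close> is zero, the contribution of \<open>G\<close> can be
  moved into \<open>P\<close>.\<close>

lemma sat_exact:
  assumes t: "tri P B Z x y \<delta>" and b: "b \<in> satc B" "sat_act B Z y b = F0 (sK S Z)"
  shows "\<exists>a \<in> satc P. sat_act P B x a = b"
proof -
  note [simp] = triD[OF t]
  obtain u where u: "\<guillemotleft>u : sK S Z \<rightarrow> P\<guillemotright>" "push Z u (sd S Z) = \<delta>"
    using ex_syzygy_lift[OF t, of "idt Z" Z] by auto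
  obtain Q i j p q c where Q: "biproduct C (sG S Z) P Q i j p q" and c: "\<guillemotleft>c : sG S Z \<rightarrow> B\<guillemotright>"
    and yc: "y \<bullet> c = sg S Z"
    and t': "tri (sK S Z) Q B (i \<bullet> sk S Z \<boxplus> j \<bullet> u) (c \<bullet> p \<boxplus> \<boxminus> (x \<bullet> q)) (pull (sK S Z) y (sd S Z))"
    by (rule rotate[OF t u])
  note [simp] = u(1) biproductD[OF Q] c
  have y: "\<guillemotleft>y : B \<rightarrow> Z\<guillemotright>" by simp
  obtain e where e: "e \<in> satc Q" "sat_act Q B (c \<bullet> p \<boxplus> \<boxminus> (x \<bullet> q)) e = b"
    using connecting_kernel[OF t' syzygy_map[OF y] b(1)] b(2) unfolding sat_act_def[of B Z y] by blast
  obtain A0 Pr x0 \<pi> \<delta>0 where Pr: "tri A0 Pr Z x0 \<pi> \<delta>0" "projective C Pr"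
    using enough triD(3)[OF t] unfolding enough_projectives_def by blast
  note [simp] = triD[OF Pr(1)]
  have "deflation C B Z y" unfolding deflation_def using t by blast
  moreover have "\<pi> \<in> arr C Pr Z" by (simp add: arr_iff)
  ultimately obtain s where s: "\<guillemotleft>s : Pr \<rightarrow> B\<guillemotright>" "y \<bullet> s = \<pi>"
    using Pr(2) unfolding projective_def by (fastforce simp: arr_iff)
  \<comment> \<open>\<open>sg\<close> lifts to \<open>Pr\<close> because it is a projective
    morphism; \<open>\<pi>\<close> lifted to \<open>B\<close> because \<open>Pr\<close> is a
    projective object.\<close>
  obtain l where l: "\<guillemotleft>l : sG S Z \<rightarrow> Pr\<guillemotright>" "\<pi> \<bullet> l = sg S Z"
    using lift_to_middle[OF Pr(1), of "sg S Z" "sG S Z"] syz(2)[of Z A0 \<delta>0] by auto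
  note [simp] = s(1) l(1)
  have "y \<bullet> (s \<bullet> l) = sg S Z" using cmp_assoc[of l s y] s(2) l(2) by simp
  then have "y \<bullet> (c \<boxplus> \<boxminus> (s \<bullet> l)) = zro (sG S Z) Z" using yc by simp
  then obtain \<tau> where tau: "\<guillemotleft>\<tau> : sG S Z \<rightarrow> P\<guillemotright>" "x \<bullet> \<tau> = c \<boxplus> \<boxminus> (s \<bullet> l)"
    using lift_to_left[OF t, of "c \<boxplus> \<boxminus> (s \<bullet> l)" "sG S Z"] by auto
  note [simp] = tau(1)
  have c': "c = s \<bullet> l \<boxplus> x \<bullet> \<tau>" unfolding tau(2) by simp
  have v: "c \<bullet> p \<boxplus> \<boxminus> (x \<bullet> q) = s \<bullet> (l \<bullet> p) \<boxplus> x \<bullet> (\<tau> \<bullet> p \<boxplus> \<boxminus> q)" unfolding c' by simp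
  have lp: "sat_act Q Pr (l \<bullet> p) e \<in> satc Pr" using e by (intro sat_act_closed) simp_all
  then have "sat_act Q Pr (l \<bullet> p) e = F0 (sK S Pr)" using sat_projective[OF Pr(2)] by blast
  then have "sat_act Q B (s \<bullet> (l \<bullet> p)) e = F0 (sK S B)"
    using e(1) syzygy_map(1)[OF s(1)] by (simp add: sat_act_cmp[where Y = Pr]) (simp add: sat_act_def)
  moreover have "sat_act Q P (\<tau> \<bullet> p \<boxplus> \<boxminus> q) e \<in> satc P" using e by (intro sat_act_closed) simp_all
  moreover have "sat_act Q B (x \<bullet> (\<tau> \<bullet> p \<boxplus> \<boxminus> q)) e = sat_act P B x (sat_act Q P (\<tau> \<bullet> p \<boxplus> \<boxminus> q) e)"
    using e by (intro sat_act_cmp) simp_all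
  moreover have "sat_act P B x (sat_act Q P (\<tau> \<bullet> p \<boxplus> \<boxminus> q) e) \<in> carrier (F (sK S B))"
    using sat_act_closed[of x P B] calculation(2) satc_iff by simp
  moreover have "sat_act Q B (s \<bullet> (l \<bullet> p) \<boxplus> x \<bullet> (\<tau> \<bullet> p \<boxplus> \<boxminus> q)) e =
    sat_act Q B (s \<bullet> (l \<bullet> p)) e \<oplus>\<^bsub>F (sK S B)\<^esub> sat_act Q B (x \<bullet> (\<tau> \<bullet> p \<boxplus> \<boxminus> q)) e"
    using e by (intro sat_act_madd) simp_all
  ultimately show ?thesis using e(2) unfolding v by auto
qed

lemma sat_half_exact: "half_exact_functor K C sat sat_act"
proof (intro half_exact_functor.intro half_exact_functor_axioms.intro extriangulated_category_axioms)
  fix f X Y h h' r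
  assume f: "ar f" "dm f = X" "cd f = Y" and h: "h \<in> satc X"
  then have f': "\<guillemotleft>f : X \<rightarrow> Y\<guillemotright>" and h1: "h \<in> carrier (F (sK S X))" by (auto simp: satc_iff)
  note [simp] = syzygy_map(1)[OF f']
  show "sat_act X Y f h \<in> satc Y" by (rule sat_act_closed[OF f' h])
  show "sat_act X Y f (h \<oplus>\<^bsub>sat X\<^esub> h') = sat_act X Y f h \<oplus>\<^bsub>sat Y\<^esub> sat_act X Y f h'" if "h' \<in> satc X"
    unfolding sat_act_def sat_sel using h that by (intro act_add) (simp_all add: satc_iff)
  show "sat_act X Y f (r \<odot>\<^bsub>sat X\<^esub> h) = r \<odot>\<^bsub>sat Y\<^esub> sat_act X Y f h" if "r \<in> carrier K"
    unfolding sat_act_def sat_sel using h1 that by (intro act_smult) simp_all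
qed (use sat_act_idt sat_act_cmp sat_act_madd sat_exact sat_vectorspace in auto)

end

section \<open>Counting\<close>

lemma card_kernel_image:
  assumes G: "abelian_group G" and H: "abelian_group H" and fin: "finite (carrier G)"
    and closed: "\<And>g. g \<in> carrier G \<Longrightarrow> f g \<in> carrier H"
    and add: "\<And>g g'. g \<in> carrier G \<Longrightarrow> g' \<in> carrier G \<Longrightarrow> f (g \<oplus>\<^bsub>G\<^esub> g') = f g \<oplus>\<^bsub>H\<^esub> f g'"
  shows "card (carrier G) = card {g \<in> carrier G. f g = \<zero>\<^bsub>H\<^esub>} * card (f ` carrier G)"
proof -
  interpret G: abelian_group G by (rule G)
  interpret H: abelian_group H by (rule H)
  let ?N = "{g \<in> carrier G. f g = \<zero>\<^bsub>H\<^esub>}"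
  have fibre: "card {g \<in> carrier G. f g = v} = card ?N" if "v \<in> f ` carrier G" for v
  proof -
    from that obtain g0 where g0: "g0 \<in> carrier G" "f g0 = v" by auto
    have "bij_betw (\<lambda>n. n \<oplus>\<^bsub>G\<^esub> g0) ?N {g \<in> carrier G. f g = v}"
    proof (rule bij_betw_byWitness[where f' = "\<lambda>g. g \<oplus>\<^bsub>G\<^esub> (\<ominus>\<^bsub>G\<^esub> g0)"])
      have "f g0 \<oplus>\<^bsub>H\<^esub> f (\<ominus>\<^bsub>G\<^esub> g0) = \<zero>\<^bsub>H\<^esub>"
      proof -
        have "f \<zero>\<^bsub>G\<^esub> \<oplus>\<^bsub>H\<^esub> f \<zero>\<^bsub>G\<^esub> = f \<zero>\<^bsub>G\<^esub>" using add[of "\<zero>\<^bsub>G\<^esub>" "\<zero>\<^bsub>G\<^esub>"] by simp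
        then have "f \<zero>\<^bsub>G\<^esub> = \<zero>\<^bsub>H\<^esub>"
          using H.r_neg1[of "f \<zero>\<^bsub>G\<^esub>" "f \<zero>\<^bsub>G\<^esub>"] H.l_neg[of "f \<zero>\<^bsub>G\<^esub>"] closed by simp
        then show ?thesis using add[of g0 "\<ominus>\<^bsub>G\<^esub> g0"] g0 by (simp add: G.r_neg)
      qed
      then show "(\<lambda>g. g \<oplus>\<^bsub>G\<^esub> (\<ominus>\<^bsub>G\<^esub> g0)) ` {g \<in> carrier G. f g = v} \<subseteq> ?N"
        unfolding g0(2) using g0(1) by (intro image_subsetI) (simp add: add)
      show "\<forall>n \<in> ?N. (n \<oplus>\<^bsub>G\<^esub> g0) \<oplus>\<^bsub>G\<^esub> (\<ominus>\<^bsub>G\<^esub> g0) = n"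
        using g0(1) by (simp add: G.a_assoc G.r_neg)
      show "\<forall>g \<in> {g \<in> carrier G. f g = v}. (g \<oplus>\<^bsub>G\<^esub> (\<ominus>\<^bsub>G\<^esub> g0)) \<oplus>\<^bsub>G\<^esub> g0 = g"
        using g0(1) by (simp add: G.a_assoc G.l_neg)
      show "(\<lambda>n. n \<oplus>\<^bsub>G\<^esub> g0) ` ?N \<subseteq> {g \<in> carrier G. f g = v}"
      proof (rule image_subsetI)
        fix n assume "n \<in> ?N"
        then show "n \<oplus>\<^bsub>G\<^esub> g0 \<in> {g \<in> carrier G. f g = v}"
          using g0(1) closed[OF g0(1)] unfolding g0(2) by (simp add: add g0(2))
      qed
    qed
    then show ?thesis by (rule bij_betw_same_card[symmetric])
  qed
  have "card (carrier G) = (\<Sum>v \<in> f ` carrier G. card {g \<in> carrier G. f g = v})"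
    using sum.image_gen[OF fin, of "\<lambda>_. 1 :: nat" f] by simp
  also have "\<dots> = card ?N * card (f ` carrier G)" using fibre by simp
  finally show ?thesis .
qed

lemma (in half_exact_with_syzygies) connecting_image:
  assumes t: "tri P B Z x y \<delta>" and u: "\<guillemotleft>u : sK S Z \<rightarrow> P\<guillemotright>" "push Z u (sd S Z) = \<delta>"
  shows "act (sK S Z) P u ` satc Z = {a \<in> carrier (F P). act P B x a = F0 B}"
proof (intro equalityI subsetI)
  note [simp] = triD[OF t]
  have u': "push Z u (sd S Z) = pull P (idt Z) \<delta>" using u(2) by simp
  fix a assume "a \<in> act (sK S Z) P u ` satc Z"
  then show "a \<in> {a \<in> carrier (F P). act P B x a = F0 B}"
    using connecting_closed[OF t u(1) _ u'] by auto
next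
  fix a assume "a \<in> {a \<in> carrier (F P). act P B x a = F0 B}"
  then show "a \<in> act (sK S Z) P u ` satc Z"
    using connecting_onto[OF t u, of a] by blast
qed

text \<open>Multiplicativity along the exact sequence
  \<open>sat P -> sat B -> sat Z -> F P -> F B\<close>. The kernels of its first and last map appear
  as factors, and consecutive steps have them in common.\<close>

lemma (in half_exact_with_syzygies) card_half_exact_step:
  assumes t: "tri P B Z x y \<delta>" and fin: "finite (satc P)" "finite (satc B)" "finite (satc Z)"
  shows "card {a \<in> carrier (F P). act P B x a = F0 B} * card {a \<in> satc P. sat_act P B x a = F0 (sK S B)}
      * card (satc B) = card (satc P) * card (satc Z)"
proof -
  note [simp] = triD[OF t]
  interpret s: half_exact_functor K C sat sat_act by (rule sat_half_exact)
  obtain u where u: "\<guillemotleft>u : sK S Z \<rightarrow> P\<guillemotright>" "push Z u (sd S Z) = \<delta>"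
    using ex_syzygy_lift[OF t, of "idt Z" Z] by auto
  have g: "abelian_group (sat P)" "abelian_group (sat B)" "abelian_group (sat Z)" "abelian_group (F P)"
    by (simp_all add: s.F_abelian_group F_abelian_group)
  have yx: "sat_act B Z y (sat_act P B x a) = F0 (sK S Z)" if "a \<in> satc P" for a
    using s.act_cmp[of x y P B Z a] s.act_zro[of P Z a] that tri_cmp_zero[OF t] by simp
  have "card (satc P) = card {a \<in> satc P. sat_act P B x a = F0 (sK S B)} * card (sat_act P B x ` satc P)"
    using card_kernel_image[OF g(1,2) fin(1), of "sat_act P B x"] s.act_closed s.act_add by simp
  moreover have "card (satc B) = card {b \<in> satc B. sat_act B Z y b = F0 (sK S Z)} * card (sat_act B Z y ` satc B)"
    using card_kernel_image[OF g(2,3) fin(2), of "sat_act B Z y"] s.act_closed s.act_add by simp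
  moreover have "{b \<in> satc B. sat_act B Z y b = F0 (sK S Z)} = sat_act P B x ` satc P"
  proof (intro equalityI subsetI)
    fix b assume "b \<in> {b \<in> satc B. sat_act B Z y b = F0 (sK S Z)}"
    then show "b \<in> sat_act P B x ` satc P" using sat_exact[OF t, of b] by blast
  next
    fix b assume "b \<in> sat_act P B x ` satc P"
    then show "b \<in> {b \<in> satc B. sat_act B Z y b = F0 (sK S Z)}" using yx s.act_closed[of x P B] by auto
  qed
  moreover have "card (satc Z) = card {h \<in> satc Z. act (sK S Z) P u h = F0 P} * card (act (sK S Z) P u ` satc Z)"
  proof (subst card_kernel_image[OF g(3,4) fin(3), of "act (sK S Z) P u"])
    show "act (sK S Z) P u h \<in> carrier (F P)" if "h \<in> satc Z" for h
      using that u satc_iff by (intro act_closed) auto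
    show "act (sK S Z) P u (h \<oplus>\<^bsub>sat Z\<^esub> h') = act (sK S Z) P u h \<oplus>\<^bsub>F P\<^esub> act (sK S Z) P u h'"
      if "h \<in> satc Z" "h' \<in> satc Z" for h h'
      using that u satc_iff unfolding sat_sel by (intro act_add) auto
  qed simp
  moreover have "{h \<in> satc Z. act (sK S Z) P u h = F0 P} = sat_act B Z y ` satc B"
  proof (intro equalityI subsetI)
    fix h assume "h \<in> {h \<in> satc Z. act (sK S Z) P u h = F0 P}"
    then show "h \<in> sat_act B Z y ` satc B" using connecting_kernel[OF t u, of h] by blast
  next
    fix h assume "h \<in> sat_act B Z y ` satc B"
    then obtain b where b: "b \<in> satc B" "h = sat_act B Z y b" by auto
    have y: "\<guillemotleft>y : B \<rightarrow> Z\<guillemotright>" by simp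
    let ?k = "syzygy_map C S B Z y"
    note [simp] = syzygy_map(1)[OF y] u(1)
    \<comment> \<open>\<open>u \<bullet> ?k\<close> pushes \<open>sd S B\<close> to the pullback of
      \<open>\<delta>\<close> along \<open>y\<close>, which is zero; so it acts on
      \<open>satc B\<close> like the zero morphism.\<close>
    have "push B (u \<bullet> ?k) (sd S B) = push B u (pull (sK S Z) y (sd S Z))"
      using syzygy_map(2)[OF y] by simp
    also have "\<dots> = pull P y (push Z u (sd S Z))" by (rule push_pull) simp_all
    also have "\<dots> = push B (zro (sK S B) P) (sd S B)" unfolding u(2) using tri_pull_zero[OF t] by simp
    finally have "act (sK S B) P (u \<bullet> ?k) b = act (sK S B) P (zro (sK S B) P) b"
      using b by (intro act_unique) simp_all
    then have "act (sK S Z) P u (sat_act B Z y b) = F0 P"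
      unfolding sat_act_def using b by (simp add: act_cmp[where Y = "sK S Z"] satc_iff)
    then show "h \<in> {h \<in> satc Z. act (sK S Z) P u h = F0 P}"
      using b s.act_closed[of y B Z b] by simp
  qed
  moreover have "act (sK S Z) P u ` satc Z = {a \<in> carrier (F P). act P B x a = F0 B}"
    by (rule connecting_image[OF t u])
  ultimately have
    "card (satc P) = card {a \<in> satc P. sat_act P B x a = F0 (sK S B)} * card (sat_act P B x ` satc P)"
    "card (satc B) = card (sat_act P B x ` satc P) * card (sat_act B Z y ` satc B)"
    "card (satc Z) = card (sat_act B Z y ` satc B) * card {a \<in> carrier (F P). act P B x a = F0 B}"
    by (simp_all only:)
  then show ?thesis by (simp only: ac_simps)
qed

text \<open>For projective \<open>B\<close> the connecting map is injective, since
  \<open>sat B\<close> is zero. Satellites can thus be counted on any triangle with projective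
  middle term instead of the chosen one.\<close>

lemma (in half_exact_with_syzygies) card_sat_projective_cover:
  assumes t: "tri P B Z x y \<delta>" and B: "projective C B"
  shows "card (satc Z) = card {a \<in> carrier (F P). act P B x a = F0 B}"
proof -
  note [simp] = triD[OF t]
  obtain u where u: "\<guillemotleft>u : sK S Z \<rightarrow> P\<guillemotright>" "push Z u (sd S Z) = \<delta>"
    using ex_syzygy_lift[OF t, of "idt Z" Z] by auto
  interpret s: half_exact_functor K C sat sat_act by (rule sat_half_exact)
  interpret G: abelian_group "F (sK S Z)" by (simp add: F_abelian_group)
  interpret H: abelian_group "F P" by (simp add: F_abelian_group)
  interpret L: abelian_group "sat Z" by (simp add: s.F_abelian_group)
  have ker: "h = F0 (sK S Z)" if h: "h \<in> satc Z" "act (sK S Z) P u h = F0 P" for h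
  proof -
    obtain b where "b \<in> satc B" "sat_act B Z y b = h" using connecting_kernel[OF t u h] by blast
    then show ?thesis using sat_projective[OF B] s.act_F0[of y B Z] by auto
  qed
  have "inj_on (act (sK S Z) P u) (satc Z)"
  proof (rule inj_onI)
    fix h h' assume h: "h \<in> satc Z" "h' \<in> satc Z" "act (sK S Z) P u h = act (sK S Z) P u h'"
    let ?n = "\<ominus>\<^bsub>sat Z\<^esub> h'"
    have n: "?n \<in> satc Z" "h' \<oplus>\<^bsub>F (sK S Z)\<^esub> ?n = F0 (sK S Z)" using h L.r_neg[of h'] by auto
    have c: "h \<in> carrier (F (sK S Z))" "h' \<in> carrier (F (sK S Z))" "?n \<in> carrier (F (sK S Z))"
      using h n by (simp_all only: satc_iff)
    have "act (sK S Z) P u (h \<oplus>\<^bsub>F (sK S Z)\<^esub> ?n) = act (sK S Z) P u (h' \<oplus>\<^bsub>F (sK S Z)\<^esub> ?n)"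
      using u(1) c h(3) by (simp add: act_add)
    also have "\<dots> = F0 P" unfolding n(2) using u(1) by simp
    finally have "h \<oplus>\<^bsub>F (sK S Z)\<^esub> ?n = F0 (sK S Z)"
      using ker L.a_closed[OF h(1) n(1)] by simp
    then show "h = h'" using c n(2) G.minus_equality[of h ?n] G.minus_equality[of h' ?n] by simp
  qed
  moreover have "act (sK S Z) P u ` satc Z = {a \<in> carrier (F P). act P B x a = F0 B}"
    by (rule connecting_image[OF t u])
  ultimately show ?thesis using card_image by fastforce
qed

section \<open>The functors \<open>\<E>\<^sub>I\<^sup>-\<^sup>n(X,-)\<close>\<close>

context extriangulated_category
begin

lemma hom_half_exact:
  assumes [simp]: "ob X" shows "half_exact_functor K C (Hom C X) (\<lambda>Y Y' f h. f \<bullet> h)"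
proof (intro half_exact_functor.intro half_exact_functor_axioms.intro extriangulated_category_axioms)
  show "\<And>Y. ob Y \<Longrightarrow> vectorspace K (Hom C X Y)" by (simp add: hom_vectorspace)
  fix f Y Z h assume f: "ar f" "dm f = Y" "cd f = Z" and h: "h \<in> arr C X Y"
  have [simp]: "ob Y" "ob Z" using f ob_dm ob_cd by blast+
  have f': "f \<in> arr C Y Z" and h': "\<guillemotleft>h : X \<rightarrow> Y\<guillemotright>" using f h by (simp_all add: arr_iff)
  show "f \<bullet> h \<in> arr C X Z" using f h' by (simp add: arr_iff)
  show "f \<bullet> (r \<odot>\<^bsub>Hom C X Y\<^esub> h) = r \<odot>\<^bsub>Hom C X Z\<^esub> (f \<bullet> h)" if "r \<in> carrier K" for r
    using comp_smult_right[of X Y Z h f r] f' h that by simp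
  show "f \<bullet> (h \<oplus>\<^bsub>Hom C X Y\<^esub> h1) = f \<bullet> h \<oplus>\<^bsub>Hom C X Z\<^esub> f \<bullet> h1" if "h1 \<in> arr C X Y" for h1
    using comp_add_right[of X Y Z h h1 f] f' h that by simp
  show "(f \<boxplus> g) \<bullet> h = f \<bullet> h \<oplus>\<^bsub>Hom C X Z\<^esub> g \<bullet> h" if "ar g" "dm g = Y" "cd g = Z" for g
    using f h' that by (simp add: madd_eq)
next
  fix A B Z x y \<delta> h assume t: "tri A B Z x y \<delta>" and h: "h \<in> arr C X B" "y \<bullet> h = zro X Z"
  note [simp] = triD[OF t]
  show "\<exists>h'\<in>arr C X A. x \<bullet> h' = h"
  proof -
    have "\<exists>a. \<guillemotleft>a : X \<rightarrow> A\<guillemotright> \<and> x \<bullet> a = h"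
      by (rule lift_to_left[OF t]) (use h in \<open>simp_all add: arr_iff\<close>)
    then show ?thesis using in_hom_arr by blast
  qed
qed (auto simp: arr_iff ob_dm ob_cd)

lemma negext_half_exact:
  assumes S: "syzygy_choice C S" "enough_projectives C" and X: "ob X"
  shows "half_exact_functor K C (negext_I C S n X) (negext_map C S n)"
proof (induction n)
  case 0
  have "negext_I C S 0 X = Hom C X" by (rule ext) (simp add: negext_I_def)
  moreover have "negext_map C S 0 = (\<lambda>Y Y' f h. f \<bullet> h)" by (intro ext) simp
  ultimately show ?case using hom_half_exact[OF X] by simp
next
  case (Suc n)
  then interpret h: half_exact_with_syzygies K C "negext_I C S n X" "negext_map C S n" S
    using S by (intro half_exact_with_syzygies.intro half_exact_with_syzygies_axioms.intro)
  \<comment> \<open>\<open>negext_set\<close> recurses on \<open>sK S Y\<close>, while the iterate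
    in \<open>negext_I\<close> unfolds on the outside; \<open>funpow_swap1\<close> reconciles the
    two.\<close>
  have "h.sat = negext_I C S (Suc n) X"
    by (rule ext) (simp add: h.sat_def negext_I_def funpow_swap1)
  moreover have "h.sat_act = negext_map C S (Suc n)"
    by (intro ext) (simp add: h.sat_act_def)
  ultimately show ?case using h.sat_half_exact by (simp only:)
qed

text \<open>The numbers \<open>k n\<close> mark the places where the long exact sequence is cut into
  segments of one degree each.\<close>

lemma
  assumes S: "syzygy_choice C S" "enough_projectives C" and X: "ob X"
    and t: "tri A B Z x y \<delta>"
  defines "k \<equiv> \<lambda>n. card {a \<in> carrier (negext_I C S n X A). negext_map C S n A B x a = \<zero>\<^bsub>negext_I C S n X B\<^esub>}"
    and "e \<equiv> \<lambda>n Y. card (carrier (negext_I C S n X Y))"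
  shows negext_card_step: "(\<And>n Y. ob Y \<Longrightarrow> finite (carrier (negext_I C S n X Y)))
      \<Longrightarrow> k n * k (Suc n) * e (Suc n) B = e (Suc n) A * e (Suc n) Z"
    and negext_card_projective_cover: "projective C B \<Longrightarrow> e (Suc n) Z = k n"
proof -
  interpret h: half_exact_with_syzygies K C "negext_I C S n X" "negext_map C S n" S
    using S X by (intro half_exact_with_syzygies.intro half_exact_with_syzygies_axioms.intro negext_half_exact)
  have sat: "h.sat = negext_I C S (Suc n) X"
    by (rule ext) (simp add: h.sat_def negext_I_def funpow_swap1)
  have sat_act: "h.sat_act = negext_map C S (Suc n)"
    by (intro ext) (simp add: h.sat_act_def)
  have z: "\<zero>\<^bsub>negext_I C S (Suc n) X B\<^esub> = \<zero>\<^bsub>negext_I C S n X (sK S B)\<^esub>"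
    by (simp add: negext_I_def funpow_swap1)
  show "k n * k (Suc n) * e (Suc n) B = e (Suc n) A * e (Suc n) Z"
    if "\<And>n Y. ob Y \<Longrightarrow> finite (carrier (negext_I C S n X Y))"
    using h.card_half_exact_step[OF t] that triD[OF t]
    unfolding k_def e_def sat sat_act z by blast
  show "e (Suc n) Z = k n" if "projective C B"
    using h.card_sat_projective_cover[OF t that] unfolding k_def e_def sat by blast
qed

end

lemma inflation_opp [simp]: "inflation (opp C) A B x = deflation C B A x"
  by (auto simp: deflation_def inflation_def)

lemma deflation_opp [simp]: "deflation (opp C) A B x = inflation C B A x"
  by (auto simp: deflation_def inflation_def)

lemma projective_opp [simp]: "projective (opp C) = injective C"
  by (rule ext) (simp add: projective_def injective_def, blast)

lemma injective_opp [simp]: "injective (opp C) = projective C"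
  by (rule ext) (simp add: projective_def injective_def, blast)

lemma enough_opp [simp]:
  "enough_projectives (opp C) = enough_injectives C" "enough_injectives (opp C) = enough_projectives C"
  by (auto simp: enough_projectives_def enough_injectives_def) blast+

lemma isomorphic_opp:
  assumes "linear_category K C" "X \<in> Obj C" "Y \<in> Obj C"
  shows "isomorphic (opp C) X Y \<longleftrightarrow> isomorphic C X Y"
proof -
  interpret linear_category K C by (rule assms)
  have "isomorphic (opp C) X Y \<longleftrightarrow> isomorphic C Y X" unfolding isomorphic_def by (metis iso_arr_opp)
  then show ?thesis using isomorphic_sym assms by blast
qed

section \<open>Finite-dimensional vector spaces\<close>

lemma (in vectorspace) finite_carrier:
  assumes "finite (carrier K)" "fin_dim" shows "finite (carrier V)"
proof -
  obtain A where A: "finite A" "A \<subseteq> carrier V" "span A = carrier V"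
    using assms(2) unfolding fin_dim_def by blast
  have "span A \<subseteq> (\<Union>B \<in> Pow A. (\<lambda>a. lincomb a B) ` (B \<rightarrow>\<^sub>E carrier K))"
  proof
    fix v assume "v \<in> span A"
    then obtain a B where B: "finite B" "B \<subseteq> A" "a \<in> B \<rightarrow> carrier K" "v = lincomb a B"
      unfolding span_def by blast
    have "lincomb a B = lincomb (restrict a B) B"
      unfolding lincomb_def using B A(2) by (intro finsum_cong') (auto intro!: smult_closed)
    moreover have "restrict a B \<in> B \<rightarrow>\<^sub>E carrier K" using B by auto
    ultimately show "v \<in> (\<Union>B \<in> Pow A. (\<lambda>a. lincomb a B) ` (B \<rightarrow>\<^sub>E carrier K))" using B by blast
  qed
  moreover have "finite (\<Union>B \<in> Pow A. (\<lambda>a. lincomb a B) ` (B \<rightarrow>\<^sub>E carrier K))"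
    using A(1) assms(1) by (auto intro!: finite_PiE dest: finite_subset)
  ultimately show ?thesis using A(3) finite_subset by metis
qed

lemma (in vectorspace) carrier_dim_zero:
  assumes "fin_dim" "dim = 0" shows "carrier V = {\<zero>\<^bsub>V\<^esub>}"
proof -
  have "\<exists>n A. finite A \<and> card A = n \<and> A \<subseteq> carrier V \<and> gen_set A"
    using assms(1) unfolding fin_dim_def by blast
  from LeastI_ex[OF this] have "\<exists>A. finite A \<and> card A = 0 \<and> A \<subseteq> carrier V \<and> gen_set A"
    using assms(2) unfolding dim_def by simp
  then have "span {} = carrier V" by auto
  moreover have "span {} \<subseteq> {\<zero>\<^bsub>V\<^esub>}" unfolding span_def lincomb_def by auto
  ultimately show ?thesis by blast
qed

section \<open>Morphisms \<open>(u, 0, v)\<close> of triangles\<close>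

context extriangulated_category
begin

text \<open>Since \<open>k \<bullet> u\<close> is zero, (ET3) provides one filler of
  \<open>(u, 0)\<close>, and two fillers differ by a morphism with zero pullback. The fillers form a
  coset whose size does not depend on \<open>u\<close>.\<close>

lemma card_fill_right:
  assumes t: "tri X J U j c \<delta>" and t': "tri L P Y k g \<delta>'" and u: "\<guillemotleft>u : X \<rightarrow> L\<guillemotright>" "k \<bullet> u = zro X P"
  shows "card {v \<in> arr C U Y. v \<bullet> c = zro J Y \<and> push U u \<delta> = pull L v \<delta>'} =
    card {v \<in> arr C U Y. v \<bullet> c = zro J Y \<and> pull L v \<delta>' = ex0 U L}"
proof -
  note [simp] = triD[OF t] triD[OF t'] u
  obtain v0 where v0: "\<guillemotleft>v0 : U \<rightarrow> Y\<guillemotright>" "v0 \<bullet> c = zro J Y" "push U u \<delta> = pull L v0 \<delta>'"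
    using tri_fill_right[OF t t', of u "zro J P"] by auto
  note [simp] = v0(1,2)
  have pd: "pull L (v \<boxplus> \<boxminus> v0) \<delta>' = ex0 U L \<longleftrightarrow> pull L v \<delta>' = pull L v0 \<delta>'" if "\<guillemotleft>v : U \<rightarrow> Y\<guillemotright>" for v
    using pull_diff[of L v v0 \<delta>'] that by simp
  have "bij_betw (\<lambda>v. v \<boxplus> \<boxminus> v0) {v \<in> arr C U Y. v \<bullet> c = zro J Y \<and> push U u \<delta> = pull L v \<delta>'}
    {v \<in> arr C U Y. v \<bullet> c = zro J Y \<and> pull L v \<delta>' = ex0 U L}"
  proof (rule bij_betw_byWitness[where f' = "\<lambda>v. v \<boxplus> v0"])
    show "(\<lambda>v. v \<boxplus> v0) ` {v \<in> arr C U Y. v \<bullet> c = zro J Y \<and> pull L v \<delta>' = ex0 U L}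
      \<subseteq> {v \<in> arr C U Y. v \<bullet> c = zro J Y \<and> push U u \<delta> = pull L v \<delta>'}"
    proof (rule image_subsetI)
      fix v assume v: "v \<in> {v \<in> arr C U Y. v \<bullet> c = zro J Y \<and> pull L v \<delta>' = ex0 U L}"
      then show "v \<boxplus> v0 \<in> {v \<in> arr C U Y. v \<bullet> c = zro J Y \<and> push U u \<delta> = pull L v \<delta>'}"
        using pd[of "v \<boxplus> v0"] v0(3) by (simp add: arr_iff)
    qed
    show "(\<lambda>v. v \<boxplus> \<boxminus> v0) ` {v \<in> arr C U Y. v \<bullet> c = zro J Y \<and> push U u \<delta> = pull L v \<delta>'}
      \<subseteq> {v \<in> arr C U Y. v \<bullet> c = zro J Y \<and> pull L v \<delta>' = ex0 U L}"
    proof (rule image_subsetI)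
      fix v assume v: "v \<in> {v \<in> arr C U Y. v \<bullet> c = zro J Y \<and> push U u \<delta> = pull L v \<delta>'}"
      then show "v \<boxplus> \<boxminus> v0 \<in> {v \<in> arr C U Y. v \<bullet> c = zro J Y \<and> pull L v \<delta>' = ex0 U L}"
        using pd[of v] v0(3) by (simp add: arr_iff)
    qed
  qed (simp_all add: arr_iff)
  then show ?thesis by (rule bij_betw_same_card)
qed

lemma card_fill_left:
  assumes t: "tri X J U j c \<delta>" and t': "tri L P Y k g \<delta>'" and v: "\<guillemotleft>v : U \<rightarrow> Y\<guillemotright>" "v \<bullet> c = zro J Y"
  shows "card {u \<in> arr C X L. k \<bullet> u = zro X P \<and> push U u \<delta> = pull L v \<delta>'} =
    card {u \<in> arr C X L. k \<bullet> u = zro X P \<and> push U u \<delta> = ex0 U L}"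
  using extriangulated_category.card_fill_right[OF extriangulated_category_opp,
      of Y P L g k \<delta>' U J X c j \<delta> v] assms by (simp add: eq_commute)

text \<open>
  The morphisms \<open>(u, 0, v)\<close> of triangles relate the kernels of \<open>k\<^sub>*\<close> and \<open>c\<^sup>*\<close>; both projections of this
  relation are onto, with fibres of constant size.
\<close>

lemma card_kernel_balance:
  assumes t: "tri X J U j c \<delta>" and t': "tri L P Y k g \<delta>'"
    and A: "finite A" "A \<subseteq> {u \<in> arr C X L. k \<bullet> u = zro X P}"
    and B: "finite B" "B \<subseteq> {v \<in> arr C U Y. v \<bullet> c = zro J Y}"
    and AB: "\<And>u v. \<lbrakk>u \<in> arr C X L; k \<bullet> u = zro X P; v \<in> arr C U Y; v \<bullet> c = zro J Y;
      push U u \<delta> = pull L v \<delta>'\<rbrakk> \<Longrightarrow> u \<in> A \<longleftrightarrow> v \<in> B"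
  shows "card A * card {v \<in> arr C U Y. v \<bullet> c = zro J Y \<and> pull L v \<delta>' = ex0 U L} =
    card B * card {u \<in> arr C X L. k \<bullet> u = zro X P \<and> push U u \<delta> = ex0 U L}"
proof -
  note [simp] = triD[OF t] triD[OF t']
  let ?R = "\<lambda>u v. push U u \<delta> = pull L v \<delta>'"
  have 1: "card {v \<in> B. ?R u v} = card {v \<in> arr C U Y. v \<bullet> c = zro J Y \<and> pull L v \<delta>' = ex0 U L}"
    if "u \<in> A" for u
  proof -
    have u: "\<guillemotleft>u : X \<rightarrow> L\<guillemotright>" "k \<bullet> u = zro X P" "u \<in> arr C X L" using that A(2) by (auto simp: arr_iff)
    have "{v \<in> B. ?R u v} = {v \<in> arr C U Y. v \<bullet> c = zro J Y \<and> ?R u v}"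
      using AB[OF u(3,2)] that B(2) by blast
    then show ?thesis using card_fill_right[OF t t' u(1,2)] by simp
  qed
  have 2: "card {u \<in> A. ?R u v} = card {u \<in> arr C X L. k \<bullet> u = zro X P \<and> push U u \<delta> = ex0 U L}"
    if "v \<in> B" for v
  proof -
    have v: "\<guillemotleft>v : U \<rightarrow> Y\<guillemotright>" "v \<bullet> c = zro J Y" "v \<in> arr C U Y" using that B(2) by (auto simp: arr_iff)
    have "{u \<in> A. ?R u v} = {u \<in> arr C X L. k \<bullet> u = zro X P \<and> ?R u v}"
      using AB[OF _ _ v(3,2)] that A(2) by blast
    then show ?thesis using card_fill_left[OF t t' v(1,2)] by simp
  qed
  have "(\<Sum>u\<in>A. card {v \<in> B. ?R u v}) =
    (\<Sum>v\<in>B. card {u \<in> arr C X L. k \<bullet> u = zro X P \<and> push U u \<delta> = ex0 U L})"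
    by (rule sum_multicount_gen[OF A(1) B(1)]) (use 2 in blast)
  then show ?thesis using 1 by simp
qed

text \<open>Extend \<open>u\<close> to \<open>s\<close> on \<open>J\<close>; as \<open>k s\<close>
  kills \<open>j\<close>, it descends to \<open>r\<close> on \<open>U\<close>, and
  \<open>v = g r\<close>. Another choice of \<open>s\<close> differs by some \<open>w c\<close>.
  Then \<open>r\<close> changes by \<open>k w\<close>, because precomposition with \<open>c\<close>
  is injective, and \<open>g k = 0\<close> leaves \<open>v\<close> unchanged.\<close>

lemma ex1_snake:
  assumes t: "tri X J U j c \<delta>" and t': "tri L P Y k g \<delta>'"
    and d: "inj_on (\<lambda>h. h \<bullet> c) (arr C U P)"
    and u: "\<guillemotleft>u : X \<rightarrow> L\<guillemotright>" "k \<bullet> u = zro X P" "push U u \<delta> = ex0 U L"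
  shows "\<exists>!v. v \<in> arr C U Y \<and> v \<bullet> c = zro J Y \<and> pull L v \<delta>' = ex0 U L \<and>
    (\<exists>s \<in> arr C J L. \<exists>r \<in> arr C U P. k \<bullet> s = r \<bullet> c \<and> s \<bullet> j = u \<and> g \<bullet> r = v)"
proof -
  note [simp] = triD[OF t] triD[OF t'] u(1)
  obtain s where s: "\<guillemotleft>s : J \<rightarrow> L\<guillemotright>" "s \<bullet> j = u" using extend_to_middle[OF t u(1,3)] by blast
  note [simp] = s
  have "(k \<bullet> s) \<bullet> j = zro X P" using u(2) by simp
  then obtain r where r: "\<guillemotleft>r : U \<rightarrow> P\<guillemotright>" "r \<bullet> c = k \<bullet> s"
    using extend_to_right[OF t, of "k \<bullet> s" P] by auto
  note [simp] = r(1)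
  have gk: "g \<bullet> (k \<bullet> h) = zro (dm h) Y" if "ar h" "cd h = L" for h
    using tri_cmp_zero_assoc[OF t' that] .
  show ?thesis
  proof (rule ex1I[of _ "g \<bullet> r"])
    have "pull L (g \<bullet> r) \<delta>' = ex0 U L" using tri_pull_zero[OF t'] by simp
    moreover have "\<exists>s' \<in> arr C J L. \<exists>r' \<in> arr C U P. k \<bullet> s' = r' \<bullet> c \<and> s' \<bullet> j = u \<and> g \<bullet> r' = g \<bullet> r"
      by (rule bexI[of _ s], rule bexI[of _ r]) (simp_all add: arr_iff r(2))
    ultimately show "g \<bullet> r \<in> arr C U Y \<and> (g \<bullet> r) \<bullet> c = zro J Y \<and> pull L (g \<bullet> r) \<delta>' = ex0 U L \<and>
      (\<exists>s \<in> arr C J L. \<exists>r' \<in> arr C U P. k \<bullet> s = r' \<bullet> c \<and> s \<bullet> j = u \<and> g \<bullet> r' = g \<bullet> r)"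
      using r(2) gk[of s] by (simp add: arr_iff)
  next
    fix v assume "v \<in> arr C U Y \<and> v \<bullet> c = zro J Y \<and> pull L v \<delta>' = ex0 U L \<and>
      (\<exists>s \<in> arr C J L. \<exists>r \<in> arr C U P. k \<bullet> s = r \<bullet> c \<and> s \<bullet> j = u \<and> g \<bullet> r = v)"
    then obtain s' r' where sr: "s' \<in> arr C J L" "r' \<in> arr C U P" and "k \<bullet> s' = r' \<bullet> c" "s' \<bullet> j = u" "g \<bullet> r' = v"
      by blast
    moreover from sr have "\<guillemotleft>s' : J \<rightarrow> L\<guillemotright>" "\<guillemotleft>r' : U \<rightarrow> P\<guillemotright>" by (simp_all add: arr_iff)
    ultimately have s': "\<guillemotleft>s' : J \<rightarrow> L\<guillemotright>" "\<guillemotleft>r' : U \<rightarrow> P\<guillemotright>" "k \<bullet> s' = r' \<bullet> c" "s' \<bullet> j = u" "g \<bullet> r' = v"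
      by blast+
    note [simp] = s'(1,2)
    have "(s' \<boxplus> \<boxminus> s) \<bullet> j = zro X L" using s'(4) by simp
    then obtain w where w: "\<guillemotleft>w : U \<rightarrow> L\<guillemotright>" "w \<bullet> c = s' \<boxplus> \<boxminus> s"
      using extend_to_right[OF t, of "s' \<boxplus> \<boxminus> s" L] by auto
    note [simp] = w(1)
    have "(r \<boxplus> k \<bullet> w) \<bullet> c = k \<bullet> s \<boxplus> k \<bullet> (w \<bullet> c)" using r(2) by simp
    also have "\<dots> = r' \<bullet> c" unfolding w(2) using s'(3) by simp
    finally have "r \<boxplus> k \<bullet> w = r'" using inj_onD[OF d, of "r \<boxplus> k \<bullet> w" r'] by (simp add: arr_iff)
    then have "g \<bullet> r' = g \<bullet> r" using gk[of w] by auto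
    then show "v = g \<bullet> r" using s'(5) by simp
  qed
qed

end

text \<open>The bijection is given as a relation, so that the snake can be used in both directions
  by duality without naming either map.\<close>

lemma card_eq_of_ex1:
  assumes "finite A" "finite B" "\<And>a. a \<in> A \<Longrightarrow> \<exists>!b. b \<in> B \<and> R a b" "\<And>b. b \<in> B \<Longrightarrow> \<exists>!a. a \<in> A \<and> R a b"
  shows "card A = card B"
proof -
  have 1: "card {b \<in> B. R a b} = 1" if "a \<in> A" for a
    using assms(3)[OF that] by (auto simp: card_1_singleton_iff)
  have 2: "card {a \<in> A. R a b} = 1" if "b \<in> B" for b
    using assms(4)[OF that] by (auto simp: card_1_singleton_iff)
  have "(\<Sum>a\<in>A. card {b \<in> B. R a b}) = (\<Sum>b\<in>B. 1)"
    by (rule sum_multicount_gen[OF assms(1,2)]) (use 2 in blast)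
  then show ?thesis using 1 by simp
qed

section \<open>Braces\<close>

text \<open>The assumptions are invariant under passing from \<open>C\<close>, \<open>S\<close>,
  \<open>T\<close> to \<open>opp C\<close>, \<open>T\<close>, \<open>S\<close>; through
  \<open>hall_setting_opp\<close> each lemma below has a dual. Conditions (c) and (d) are
  \<open>inj_mono\<close> and \<open>proj_mono\<close>.\<close>

locale hall_setting = extriangulated_category K C
  for K :: "'k ring" and C :: "('k, 'o, 'm, 'e) ext_data" +
  fixes S T :: "('o, 'm, 'e) syzygies"
  assumes finite_scalars: "finite (carrier K)"
    and choice_I: "syzygy_choice C S" and choice_II: "syzygy_choice (opp C) T"
    and enough_proj: "enough_projectives C" and enough_inj: "enough_injectives C"
    and finite_I: "negext_finite K C (negext_I C S)" and finite_II: "negext_finite K C (negext_II C T)"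
    and inj_mono: "\<And>I A B x. injective C I \<Longrightarrow> inflation C A B x \<Longrightarrow> inj_on (\<lambda>h. cmp C x h) (arr C I A)"
    and proj_mono: "\<And>P B Z y. projective C P \<Longrightarrow> deflation C B Z y \<Longrightarrow> inj_on (\<lambda>h. cmp C h y) (arr C Z P)"
begin

lemma hall_setting_opp: "hall_setting K (opp C) T S"
proof (intro hall_setting.intro hall_setting_axioms.intro extriangulated_category_opp)
  show "negext_finite K (opp C) (negext_I (opp C) T)"
    using finite_II unfolding negext_finite_def negext_II_def by simp
  show "negext_finite K (opp C) (negext_II (opp C) S)"
    using finite_I unfolding negext_finite_def negext_II_def by simp
qed (use finite_scalars choice_I choice_II enough_proj enough_inj inj_mono proj_mono in simp_all)

lemma half_exact_I: "ob X \<Longrightarrow> half_exact_functor K C (negext_I C S n X) (negext_map C S n)"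
  by (rule negext_half_exact[OF choice_I enough_proj])

lemma negext_vectorspace: "ob X \<Longrightarrow> ob Y \<Longrightarrow> vectorspace K (negext_I C S n X Y)"
  using half_exact_functor.F_vectorspace[OF half_exact_I] .

lemma negext_fin_dim: "ob X \<Longrightarrow> ob Y \<Longrightarrow> vectorspace.fin_dim K (negext_I C S n X Y)"
  using finite_I unfolding negext_finite_def by blast

lemma finite_negext [simp]: "ob X \<Longrightarrow> ob Y \<Longrightarrow> finite (carrier (negext_I C S n X Y))"
  using vectorspace.finite_carrier[OF negext_vectorspace finite_scalars negext_fin_dim] .

lemma finite_arr [simp]: "ob X \<Longrightarrow> ob Y \<Longrightarrow> finite (arr C X Y)"
  using finite_negext[of X Y 0] by (simp add: negext_I_def)

definition e :: "nat \<Rightarrow> 'o \<Rightarrow> 'o \<Rightarrow> nat" where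
  "e n X Y = card (carrier (negext_I C S n X Y))"

lemma zero_negext: "ob X \<Longrightarrow> ob Y \<Longrightarrow> \<zero>\<^bsub>negext_I C S n X Y\<^esub> \<in> carrier (negext_I C S n X Y)"
  using half_exact_functor.F0_closed[OF half_exact_I] .

lemma e_pos: "ob X \<Longrightarrow> ob Y \<Longrightarrow> e n X Y > 0"
  unfolding e_def using zero_negext finite_negext by (metis card_gt_0_iff empty_iff)

text \<open>The dimensions are the terms of a convergent series, so they tend to zero; being natural
  numbers, they are eventually zero.\<close>

lemma e_eventually: assumes "ob X" "ob Y" shows "\<exists>N. \<forall>n > N. e n X Y = 1"
proof -
  have "summable (\<lambda>n. real (vectorspace.dim K (negext_I C S n X Y)))"
    using finite_I assms unfolding negext_finite_def by blast
  then have "(\<lambda>n. real (vectorspace.dim K (negext_I C S n X Y))) \<longlonglongrightarrow> 0" by (rule summable_LIMSEQ_zero)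
  then have "eventually (\<lambda>n. real (vectorspace.dim K (negext_I C S n X Y)) < 1) sequentially"
    by (rule order_tendstoD(2)) simp
  then obtain N where N: "\<And>n. n \<ge> N \<Longrightarrow> vectorspace.dim K (negext_I C S n X Y) = 0"
    unfolding eventually_sequentially by auto
  have "e n X Y = 1" if "n > N" for n
    using vectorspace.carrier_dim_zero[OF negext_vectorspace[OF assms] negext_fin_dim[OF assms] N[of n]] that
    unfolding e_def by simp
  then show ?thesis by blast
qed

abbreviation b :: "'o \<Rightarrow> 'o \<Rightarrow> rat" where "b X Y \<equiv> brace_I C S X Y"

lemma b_prod:
  assumes "\<And>i. i > n \<Longrightarrow> e i X Y = 1"
  shows "b X Y = (\<Prod>i\<in>{1..n}. of_nat (e i X Y) powi ((-1) ^ i))"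
  unfolding brace_I_def alt_prod_def e_def[symmetric]
proof (rule prod.mono_neutral_left)
  show "{i. 0 < i \<and> e i X Y \<noteq> 1} \<subseteq> {1..n}" using assms by (auto simp: not_less[symmetric])
qed auto

lemma b_pos: assumes "ob X" "ob Y" shows "b X Y > 0"
proof -
  obtain N where "\<forall>n > N. e n X Y = 1" using e_eventually assms by blast
  then show ?thesis using b_prod[of N X Y] e_pos[OF assms] by (auto intro!: prod_pos)
qed

text \<open>The alternating product over the degrees of the long exact sequence telescopes down to
  the kernel in degree zero.\<close>

lemma card_kernel_brace:
  assumes t: "tri A B Z x y \<delta>" and X [simp]: "ob X"
  shows "of_nat (card {a \<in> arr C X A. x \<bullet> a = zro X B}) * b X A * b X Z = b X B"
proof -
  note [simp] = triD[OF t]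
  define k where "k n = card {a \<in> carrier (negext_I C S n X A).
    negext_map C S n A B x a = \<zero>\<^bsub>negext_I C S n X B\<^esub>}" for n
  have step: "k n * k (Suc n) * e (Suc n) X B = e (Suc n) X A * e (Suc n) X Z" for n
    unfolding k_def e_def by (rule negext_card_step[OF choice_I enough_proj X t]) simp
  have k_pos: "k n > 0" for n
    unfolding k_def using half_exact_functor.act_F0[OF half_exact_I[OF X], of x A B n] zero_negext[of X A n]
    by (auto simp: card_gt_0_iff)
  let ?s = "\<lambda>n (m::nat). (of_nat m :: rat) powi ((-1) ^ n)"
  have s_Suc: "?s (Suc n) m = inverse (?s n m)" for n m by (simp add: power_int_minus)
  have s_mult: "?s n (l * m) = ?s n l * ?s n m" for n l m by (simp add: power_int_mult_distrib)
  \<comment> \<open>Truncation after degree \<open>n\<close> leaves the kernel \<open>k n\<close> as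
    a remainder. It becomes trivial for large \<open>n\<close>, since \<open>k n\<close> is at most
    \<open>e n X A\<close>.\<close>
  have main: "of_nat (k 0) * (\<Prod>i\<in>{1..n}. ?s i (e i X A)) * (\<Prod>i\<in>{1..n}. ?s i (e i X Z)) =
    (\<Prod>i\<in>{1..n}. ?s i (e i X B)) * ?s n (k n)" for n
  proof (induction n)
    case (Suc n)
    have "?s (Suc n) (k n) * ?s (Suc n) (k (Suc n)) * ?s (Suc n) (e (Suc n) X B)
      = ?s (Suc n) (e (Suc n) X A) * ?s (Suc n) (e (Suc n) X Z)"
      unfolding s_mult[symmetric] step ..
    then have "?s (Suc n) (e (Suc n) X A) * ?s (Suc n) (e (Suc n) X Z) =
      inverse (?s n (k n)) * ?s (Suc n) (k (Suc n)) * ?s (Suc n) (e (Suc n) X B)"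
      unfolding s_Suc by simp
    moreover have "?s n (k n) * inverse (?s n (k n)) = 1" using k_pos[of n] by simp
    moreover have "of_nat (k 0) * (\<Prod>i\<in>{1..Suc n}. ?s i (e i X A)) * (\<Prod>i\<in>{1..Suc n}. ?s i (e i X Z)) =
      (\<Prod>i\<in>{1..n}. ?s i (e i X B)) * ?s n (k n) * (?s (Suc n) (e (Suc n) X A) * ?s (Suc n) (e (Suc n) X Z))"
      unfolding Suc.IH[symmetric] by (simp add: prod.nat_ivl_Suc' ac_simps)
    ultimately show ?case by (simp add: prod.nat_ivl_Suc' ac_simps)
  qed simp
  obtain N1 N2 N3 where N: "\<forall>n > N1. e n X A = 1" "\<forall>n > N2. e n X B = 1" "\<forall>n > N3. e n X Z = 1"
    using e_eventually[OF X] triD(1-3)[OF t] by metis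
  let ?N = "Suc (N1 + N2 + N3)"
  have "k ?N \<le> e ?N X A" unfolding k_def e_def by (rule card_mono) auto
  then have "k ?N = 1" using k_pos[of ?N] N(1) by (simp add: le_Suc_eq)
  moreover have "b X A = (\<Prod>i\<in>{1..?N}. ?s i (e i X A))" "b X B = (\<Prod>i\<in>{1..?N}. ?s i (e i X B))"
    "b X Z = (\<Prod>i\<in>{1..?N}. ?s i (e i X Z))"
    by (rule b_prod, use N in simp)+
  ultimately have "of_nat (k 0) * b X A * b X Z = b X B"
    using main[of ?N] by (simp only: power_int_1_left of_nat_1 mult_1_right)
  then show ?thesis by (simp add: k_def negext_I_def)
qed

section \<open>Dimension shifting and equality of the two braces\<close>

lemma e_zero_object: assumes "zero_object C Y" and [simp]: "ob X" shows "e n X Y = 1"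
proof -
  have Y: "ob Y" "idt Y = zro Y Y" using assms unfolding zero_object_def by auto
  have "h = \<zero>\<^bsub>negext_I C S n X Y\<^esub>" if "h \<in> carrier (negext_I C S n X Y)" for h
  proof -
    have "negext_map C S n Y Y (idt Y) h = h"
      by (rule half_exact_functor.act_idt[OF half_exact_I[of X n]]) (use Y that in simp_all)
    moreover have "negext_map C S n Y Y (zro Y Y) h = \<zero>\<^bsub>negext_I C S n X Y\<^esub>"
      by (rule half_exact_functor.act_zro[OF half_exact_I[of X n]]) (use Y that in simp_all)
    ultimately show ?thesis unfolding Y(2) by (rule trans[OF sym])
  qed
  then have "carrier (negext_I C S n X Y) = {\<zero>\<^bsub>negext_I C S n X Y\<^esub>}" using zero_negext[of X Y n] Y(1) assms(2) by blast
  then show ?thesis unfolding e_def by simp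
qed

lemma e_one:
  assumes t: "tri W P Y k g \<delta>" and P: "projective C P" and [simp]: "ob X"
  shows "e 1 X Y = card {u \<in> arr C X W. k \<bullet> u = zro X P}"
  using negext_card_projective_cover[OF choice_I enough_proj _ t P, of X 0]
  unfolding e_def by (simp add: negext_I_def)

text \<open>In the triangle \<open>0 -> P = P\<close> the middle term is projective, so the count is
  bounded by that for a zero object.\<close>

lemma e_projective:
  assumes P: "projective C P" and [simp]: "ob X" shows "e (Suc n) X P = 1"
proof -
  obtain O' where O': "zero_object C O'" using ex_zero_object by blast
  have [simp]: "ob P" using P unfolding projective_def by simp
  have [simp]: "ob O'" using O' unfolding zero_object_def by simp
  have "e (Suc n) X P = card {a \<in> carrier (negext_I C S n X O').
    negext_map C S n O' P (zro O' P) a = \<zero>\<^bsub>negext_I C S n X P\<^esub>}"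
    unfolding e_def
    by (rule negext_card_projective_cover[OF choice_I enough_proj _ tri_zero_idt[OF O' \<open>ob P\<close>] P]) simp
  also have "\<dots> \<le> e n X O'" unfolding e_def by (rule card_mono) auto
  finally show ?thesis using e_zero_object[OF O', of X n] e_pos[of X P "Suc n"] by simp
qed

text \<open>\<open>P\<close> contributes a single element in positive degrees, so the kernel that
  computes the left side is everything. Degree one is different, as \<open>Hom(X,P)\<close> need not
  vanish; there \<open>e_one\<close> applies.\<close>

lemma e_Suc_Suc:
  assumes t: "tri W P Y k g \<delta>" and P: "projective C P" and [simp]: "ob X"
  shows "e (Suc (Suc n)) X Y = e (Suc n) X W"
proof -
  note [simp] = triD[OF t]
  have "card (carrier (negext_I C S (Suc n) X P)) = 1"
    using e_projective[OF P, of X n] unfolding e_def by simp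
  then obtain z where z: "carrier (negext_I C S (Suc n) X P) = {z}" using card_1_singletonE by blast
  have "{a \<in> carrier (negext_I C S (Suc n) X W). negext_map C S (Suc n) W P k a = \<zero>\<^bsub>negext_I C S (Suc n) X P\<^esub>}
    = carrier (negext_I C S (Suc n) X W)"
    using half_exact_functor.act_closed[OF half_exact_I[of X "Suc n"], of k W P] zero_negext[of X P "Suc n"]
    unfolding z by auto
  then show ?thesis
    using negext_card_projective_cover[OF choice_I enough_proj _ t P, of X "Suc n"] unfolding e_def by simp
qed

definition e' :: "nat \<Rightarrow> 'o \<Rightarrow> 'o \<Rightarrow> nat" where
  "e' n X Y = card (carrier (negext_II C T n X Y))"

lemma e_opp: "hall_setting.e (opp C) T n Y X = e' n X Y"
  unfolding e'_def hall_setting.e_def[OF hall_setting_opp] negext_II_def by simp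

lemma e'_one:
  assumes "tri X I U j c \<delta>" "injective C I" "ob Y"
  shows "e' 1 X Y = card {v \<in> arr C U Y. v \<bullet> c = zro I Y}"
  using hall_setting.e_one[OF hall_setting_opp, of U I X c j \<delta> Y] assms unfolding e_opp by simp

lemma e'_Suc_Suc:
  assumes "tri X I U j c \<delta>" "injective C I" "ob Y"
  shows "e' (Suc (Suc n)) X Y = e' (Suc n) U Y"
  using hall_setting.e_Suc_Suc[OF hall_setting_opp, of U I X c j \<delta> Y n] assms unfolding e_opp by simp

text \<open>In degree one the two sides are the kernel of \<open>k\<close> on
  \<open>Hom(X,W)\<close> and that of \<open>c\<close> on \<open>Hom(U,Y)\<close>. The morphisms
  \<open>(u, 0, v)\<close> show that their ratio is \<open>|U0| / |V0|\<close>, and the snake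
  relation is a bijection of \<open>U0\<close> with \<open>V0\<close>: by (d) each \<open>u\<close>
  determines \<open>v\<close>, by (c) each \<open>v\<close> determines \<open>u\<close>.\<close>

lemma balance_one:
  assumes [simp]: "ob X" "ob Y" shows "e 1 X Y = e' 1 X Y"
proof -
  obtain W P k g \<delta>' where P: "tri W P Y k g \<delta>'" "projective C P"
    using enough_proj assms(2) unfolding enough_projectives_def by blast
  obtain I U j c \<delta> where I: "tri X I U j c \<delta>" "injective C I"
    using enough_inj assms(1) unfolding enough_injectives_def by blast
  note [simp] = triD[OF P(1)] triD[OF I(1)]
  let ?U0 = "{u \<in> arr C X W. k \<bullet> u = zro X P \<and> push U u \<delta> = ex0 U W}"
  let ?V0 = "{v \<in> arr C U Y. v \<bullet> c = zro I Y \<and> pull W v \<delta>' = ex0 U W}"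
  have eq: "e 1 X Y * card ?V0 = e' 1 X Y * card ?U0"
    unfolding e_one[OF P assms(1)] e'_one[OF I assms(2)]
    by (rule card_kernel_balance[OF I(1) P(1)]) auto
  have UV: "card ?U0 = card ?V0"
  proof (rule card_eq_of_ex1[where R = "\<lambda>u v. \<exists>s \<in> arr C I W. \<exists>r \<in> arr C U P. k \<bullet> s = r \<bullet> c \<and> s \<bullet> j = u \<and> g \<bullet> r = v"])
    have c: "inj_on (\<lambda>h. k \<bullet> h) (arr C I W)"
      using inj_mono[OF I(2), of W P k] P(1) unfolding inflation_def by blast
    have d: "inj_on (\<lambda>h. h \<bullet> c) (arr C U P)"
      using proj_mono[OF P(2), of I U c] I(1) unfolding deflation_def by blast
    show "\<exists>!v. v \<in> ?V0 \<and> (\<exists>s \<in> arr C I W. \<exists>r \<in> arr C U P. k \<bullet> s = r \<bullet> c \<and> s \<bullet> j = u \<and> g \<bullet> r = v)"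
      if "u \<in> ?U0" for u
      using ex1_snake[OF I(1) P(1) d, of u] that by (simp add: arr_iff conj_assoc)
    show "\<exists>!u. u \<in> ?U0 \<and> (\<exists>s \<in> arr C I W. \<exists>r \<in> arr C U P. k \<bullet> s = r \<bullet> c \<and> s \<bullet> j = u \<and> g \<bullet> r = v)"
      if "v \<in> ?V0" for v
    proof -
      have *: "\<exists>!u. u \<in> arr C X W \<and> k \<bullet> u = zro X P \<and> push U u \<delta> = ex0 U W \<and>
        (\<exists>r \<in> arr C U P. \<exists>s \<in> arr C I W. r \<bullet> c = k \<bullet> s \<and> g \<bullet> r = v \<and> s \<bullet> j = u)"
        using extriangulated_category.ex1_snake[OF extriangulated_category_opp,
            of Y P W g k \<delta>' U I X c j \<delta> v] P(1) I(1) c that by (simp add: arr_iff)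
      have **: "(\<exists>s \<in> arr C I W. \<exists>r \<in> arr C U P. k \<bullet> s = r \<bullet> c \<and> s \<bullet> j = u \<and> g \<bullet> r = v) \<longleftrightarrow>
        (\<exists>r \<in> arr C U P. \<exists>s \<in> arr C I W. r \<bullet> c = k \<bullet> s \<and> g \<bullet> r = v \<and> s \<bullet> j = u)" for u
        by metis
      show ?thesis using * unfolding ** mem_Collect_eq conj_assoc .
    qed
  qed auto
  have "card ?V0 \<noteq> 0"
  proof -
    have "zro U Y \<in> ?V0" by (simp add: arr_iff)
    moreover have "finite ?V0" by simp
    ultimately show ?thesis using card_0_eq by blast
  qed
  then show ?thesis using eq unfolding UV by (rule iffD1[OF mult_right_cancel])
qed

text \<open>One side is shifted to the syzygy \<open>W\<close> of \<open>Y\<close>, the other to the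
  cosyzygy \<open>U\<close> of \<open>X\<close>. The induction hypothesis exchanges \<open>e\<close>
  and \<open>e'\<close>, so that each can be shifted in its remaining variable; both then refer to
  \<open>U\<close> and \<open>W\<close>, two degrees below the start.\<close>

lemma balance:
  assumes "ob X" "ob Y" shows "e (Suc n) X Y = e' (Suc n) X Y"
  using assms
proof (induction n arbitrary: X Y rule: less_induct)
  case (less n)
  note [simp] = less.prems
  show ?case
  proof (cases n)
    case 0
    then show ?thesis using balance_one by simp
  next
    case (Suc m)
    obtain W P k g \<delta>' where P: "tri W P Y k g \<delta>'" "projective C P"
      using enough_proj less.prems(2) unfolding enough_projectives_def by blast
    obtain I U j c \<delta> where I: "tri X I U j c \<delta>" "injective C I"
      using enough_inj less.prems(1) unfolding enough_injectives_def by blast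
    note [simp] = triD[OF P(1)] triD[OF I(1)]
    have "e (Suc n) X Y = e' (Suc m) X W"
      using e_Suc_Suc[OF P, of X m] less.IH[of m X W] Suc by simp
    moreover have "e' (Suc n) X Y = e (Suc m) U Y"
      using e'_Suc_Suc[OF I, of Y m] less.IH[of m U Y] Suc by simp
    moreover have "e' (Suc m) X W = e (Suc m) U Y"
    proof (cases m)
      case 0
      \<comment> \<open>From degree one there is no further shift. Both numbers count morphisms
        \<open>t : U -> W\<close>, and by (c) and (d) either condition on \<open>t\<close> is
        equivalent to \<open>k t c = 0\<close>.\<close>
      have c: "inj_on (\<lambda>h. k \<bullet> h) (arr C I W)"
        using inj_mono[OF I(2), of W P k] P(1) unfolding inflation_def by blast
      have d: "inj_on (\<lambda>h. h \<bullet> c) (arr C U P)"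
        using proj_mono[OF P(2), of I U c] I(1) unfolding deflation_def by blast
      have "t \<bullet> c = zro I W \<longleftrightarrow> k \<bullet> t = zro U P" if t: "\<guillemotleft>t : U \<rightarrow> W\<guillemotright>" for t
      proof
        assume "t \<bullet> c = zro I W"
        then have "(k \<bullet> t) \<bullet> c = zro U P \<bullet> c" using t by simp
        then show "k \<bullet> t = zro U P" using inj_onD[OF d, of "k \<bullet> t" "zro U P"] t by (simp add: arr_iff)
      next
        assume "k \<bullet> t = zro U P"
        then have "k \<bullet> (t \<bullet> c) = k \<bullet> zro I W" using t cmp_assoc[of c t k] by simp
        then show "t \<bullet> c = zro I W" using inj_onD[OF c, of "t \<bullet> c" "zro I W"] t by (simp add: arr_iff)
      qed
      then have "{t \<in> arr C U W. t \<bullet> c = zro I W} = {t \<in> arr C U W. k \<bullet> t = zro U P}"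
        by (auto simp: arr_iff)
      then show ?thesis using 0 e'_one[OF I, of W] e_one[OF P, of U] by simp
    next
      case (Suc l)
      have "e' (Suc m) X W = e (Suc l) U W"
        using e'_Suc_Suc[OF I, of W l] less.IH[of l U W] Suc \<open>n = Suc m\<close> by simp
      then show ?thesis using e_Suc_Suc[OF P, of U l] Suc by simp
    qed
    ultimately show ?thesis by simp
  qed
qed

lemma brace_balance:
  assumes "ob X" "ob Y" shows "brace_I C S X Y = brace_II C T X Y"
proof -
  have "card (carrier (negext_I C S i X Y)) = card (carrier (negext_II C T i X Y))" if "i > 0" for i
    using balance[OF assms, of "i - 1"] that unfolding e_def e'_def by simp
  then show ?thesis unfolding brace_I_def brace_II_def alt_prod_def by (intro prod.cong) auto
qed

lemma brace_opp: "ob X \<Longrightarrow> ob Y \<Longrightarrow> brace_I (opp C) T Y X = b X Y"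
  using brace_balance[of X Y] unfolding brace_I_def brace_II_def negext_II_def by simp

text \<open>The dual count comes in braces of the second kind; \<open>brace_balance\<close>
  expresses it in the first, where it can be compared with \<open>card_kernel_brace\<close>.\<close>

lemma card_cokernel_brace:
  assumes t: "tri A B Z x y \<delta>" and "ob Y"
  shows "of_nat (card {h \<in> arr C Z Y. h \<bullet> y = zro B Y}) * b Z Y * b A Y = b B Y"
  using hall_setting.card_kernel_brace[OF hall_setting_opp, of Z B A y x \<delta> Y] assms triD[OF t]
  by (simp add: brace_opp)

end

section \<open>Hall numbers\<close>

text \<open>The weight \<open>w q / c\<close> is the inverse of the number of pairs over
  \<open>i\<close>, so the pairs over each \<open>i\<close> have total weight one. In the
  application \<open>c\<close> is the order of an automorphism group and \<open>w q\<close> that of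
  a stabilizer.\<close>

lemma sum_over_fibres:
  fixes c :: rat
  assumes P: "finite P" and c: "c \<noteq> 0"
    and w: "\<And>i q. (i, q) \<in> P \<Longrightarrow> of_nat (card {q'. (i, q') \<in> P}) * w q = c"
  shows "(\<Sum>(i, q)\<in>P. w q / c) = of_nat (card (fst ` P))"
proof -
  have fin: "finite {q. (i, q) \<in> P}" for i
    by (rule finite_subset[of _ "snd ` P"]) (use P in force)+
  have "(\<Sum>q | (i, q) \<in> P. w q / c) = 1" if i: "i \<in> fst ` P" for i
  proof -
    from i obtain q0 where q0: "(i, q0) \<in> P" by auto
    have ne: "(of_nat (card {q'. (i, q') \<in> P}) :: rat) \<noteq> 0" using q0 fin by auto
    have "w q / c = 1 / of_nat (card {q'. (i, q') \<in> P})" if "(i, q) \<in> P" for q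
      using w[OF that] c ne by (simp add: field_simps)
    then have "(\<Sum>q | (i, q) \<in> P. w q / c) = (\<Sum>q | (i, q) \<in> P. 1 / of_nat (card {q'. (i, q') \<in> P}))"
      by (intro sum.cong) auto
    then show ?thesis using ne by simp
  qed
  moreover have "P = Sigma (fst ` P) (\<lambda>i. {q. (i, q) \<in> P})" by force
  then have "(\<Sum>(i, q)\<in>P. w q / c) = (\<Sum>i\<in>fst ` P. \<Sum>q | (i, q) \<in> P. w q / c)"
    using P fin by (simp add: sum.Sigma)
  ultimately show ?thesis by simp
qed

section \<open>Orbits and stabilizers of inflations and deflations\<close>

context extriangulated_category
begin

text \<open>The isomorphism between the cone and \<open>N\<close> is absorbed into the
  deflation.\<close>

lemma inflations_with_cone_iff:
  assumes [simp]: "ob N"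
  shows "i \<in> inflations_with_cone C M B N \<longleftrightarrow> (\<exists>q \<delta>. tri M B N i q \<delta>)"
proof
  assume "i \<in> inflations_with_cone C M B N"
  then obtain Z y \<delta> where t: "tri M B Z i y \<delta>" "isomorphic C Z N"
    unfolding inflations_with_cone_def by blast
  note [simp] = triD[OF t(1)]
  obtain f f' where f: "mutually_inverse f f'" "\<guillemotleft>f : Z \<rightarrow> N\<guillemotright>"
    using isomorphicE[OF t(2) triD(3)[OF t(1)] assms] by blast
  have "tri M B N (idt B \<bullet> (i \<bullet> idt M)) (f \<bullet> (y \<bullet> idt B)) (push N (idt M) (pull M f' \<delta>))"
    by (rule tri_transport[OF t(1) mutually_inverse_idt _ mutually_inverse_idt _ f]) simp_all
  then show "\<exists>q \<delta>. tri M B N i q \<delta>" by auto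
next
  assume "\<exists>q \<delta>. tri M B N i q \<delta>"
  then show "i \<in> inflations_with_cone C M B N"
    unfolding inflations_with_cone_def using isomorphic_refl[OF assms] by blast
qed

lemma inflations_with_cone_opp:
  assumes "ob X" shows "inflations_with_cone (opp C) Y L X = deflations_with_cocone C X L Y"
  unfolding inflations_with_cone_def deflations_with_cocone_def
  using isomorphic_opp[OF linear_category_axioms _ assms] triD(1) by (intro Collect_cong) (simp, metis)

lemma deflations_with_cocone_opp:
  assumes "ob X" shows "deflations_with_cocone (opp C) X L Y = inflations_with_cone C Y L X"
  unfolding inflations_with_cone_def deflations_with_cocone_def
  using isomorphic_opp[OF linear_category_axioms _ assms] triD(3) by (intro Collect_cong) (simp, metis)

lemma deflations_with_cocone_iff:
  assumes "ob M" shows "q \<in> deflations_with_cocone C M B N \<longleftrightarrow> (\<exists>i \<delta>. tri M B N i q \<delta>)"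
  using extriangulated_category.inflations_with_cone_iff[OF extriangulated_category_opp, of M q N B] assms
  by (simp add: inflations_with_cone_opp)

lemma Aut_iff: "ob X \<Longrightarrow> f \<in> Aut C X \<longleftrightarrow> (\<exists>f'. mutually_inverse f f' \<and> \<guillemotleft>f : X \<rightarrow> X\<guillemotright>)"
  unfolding Aut_def using iso_arr_iff[of X X f] mutually_inverse_simps(1) by auto

lemma Aut_subset: "ob X \<Longrightarrow> Aut C X \<subseteq> arr C X X"
  by (auto simp: Aut_iff arr_iff)

lemma idt_in_Aut: "ob X \<Longrightarrow> idt X \<in> Aut C X"
  using mutually_inverse_idt by (auto simp: Aut_iff)

text \<open>Two deflations with the same inflation are linked by a filler of \<open>(1, 1)\<close>,
  which the five lemma makes invertible; conversely, a triangle can be transported along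
  automorphisms of \<open>N\<close>.\<close>

lemma deflations_orbit:
  assumes t: "tri M B N i q \<delta>"
  shows "{q'. \<exists>\<delta>'. tri M B N i q' \<delta>'} = (\<lambda>c. c \<bullet> q) ` Aut C N"
proof (intro equalityI subsetI)
  note [simp] = triD[OF t]
  fix q' assume "q' \<in> {q'. \<exists>\<delta>'. tri M B N i q' \<delta>'}"
  then obtain \<delta>' where t': "tri M B N i q' \<delta>'" by blast
  note [simp] = triD[OF t']
  obtain c where c: "\<guillemotleft>c : N \<rightarrow> N\<guillemotright>" "c \<bullet> q = q' \<bullet> idt B" "push N (idt M) \<delta> = pull M c \<delta>'"
    using tri_fill_right[OF t t', of "idt M" "idt B"] by auto
  then obtain c' where "mutually_inverse c c'"
    using tri_right_iso[OF t t' mutually_inverse_idt[of M] _ mutually_inverse_idt[of B] _ c(1)] by auto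
  then have "c \<in> Aut C N" using c(1) by (auto simp: Aut_iff)
  then show "q' \<in> (\<lambda>c. c \<bullet> q) ` Aut C N" using c(2) by auto
next
  note [simp] = triD[OF t]
  fix q' assume "q' \<in> (\<lambda>c. c \<bullet> q) ` Aut C N"
  then obtain c c' where c: "mutually_inverse c c'" "\<guillemotleft>c : N \<rightarrow> N\<guillemotright>" "q' = c \<bullet> q" by (auto simp: Aut_iff)
  have "tri M B N (idt B \<bullet> (i \<bullet> idt M)) (c \<bullet> (q \<bullet> idt B)) (push N (idt M) (pull M c' \<delta>))"
    by (rule tri_transport[OF t mutually_inverse_idt _ mutually_inverse_idt _ c(1,2)]) simp_all
  then show "q' \<in> {q'. \<exists>\<delta>'. tri M B N i q' \<delta>'}" using c(3) by auto
qed

lemma card_orbit_stabilizer: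
  assumes q: "\<guillemotleft>q : B \<rightarrow> N\<guillemotright>" and fin: "finite (Aut C N)"
  shows "card ((\<lambda>c. c \<bullet> q) ` Aut C N) * card {c \<in> Aut C N. c \<bullet> q = q} = card (Aut C N)"
proof -
  note [simp] = q
  have [simp]: "ob N" using q ob_cd by blast
  have "card {c \<in> Aut C N. c \<bullet> q = q'} = card {c \<in> Aut C N. c \<bullet> q = q}"
    if q': "q' \<in> (\<lambda>c. c \<bullet> q) ` Aut C N" for q'
  proof -
    from q' obtain c0 c0' where c0: "mutually_inverse c0 c0'" "\<guillemotleft>c0 : N \<rightarrow> N\<guillemotright>" "q' = c0 \<bullet> q"
      by (auto simp: Aut_iff)
    note [simp] = mutually_inverse_simps[OF c0(1)] c0(2)
    have cl: "c0 \<bullet> c \<in> Aut C N" "c0' \<bullet> c \<in> Aut C N" if "c \<in> Aut C N" for c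
    proof -
      from that obtain c' where c: "mutually_inverse c c'" "\<guillemotleft>c : N \<rightarrow> N\<guillemotright>" by (auto simp: Aut_iff)
      show "c0 \<bullet> c \<in> Aut C N" using mutually_inverse_cmp[OF c(1) c0(1)] c(2) by (auto simp: Aut_iff)
      show "c0' \<bullet> c \<in> Aut C N"
        using mutually_inverse_cmp[OF c(1) mutually_inverse_sym[OF c0(1)]] c(2) by (auto simp: Aut_iff)
    qed
    have ar: "\<guillemotleft>c : N \<rightarrow> N\<guillemotright>" if "c \<in> Aut C N" for c using that by (auto simp: Aut_iff)
    have "bij_betw (\<lambda>c. c0 \<bullet> c) {c \<in> Aut C N. c \<bullet> q = q} {c \<in> Aut C N. c \<bullet> q = q'}"
    proof (rule bij_betw_byWitness[where f' = "\<lambda>c. c0' \<bullet> c"])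
      show "(\<lambda>c. c0 \<bullet> c) ` {c \<in> Aut C N. c \<bullet> q = q} \<subseteq> {c \<in> Aut C N. c \<bullet> q = q'}"
        using cl(1) ar c0(3) by (intro image_subsetI) simp
      show "(\<lambda>c. c0' \<bullet> c) ` {c \<in> Aut C N. c \<bullet> q = q'} \<subseteq> {c \<in> Aut C N. c \<bullet> q = q}"
        using cl(2) ar c0(3) by (intro image_subsetI) simp
    qed (use ar in simp_all)
    then show ?thesis by (rule bij_betw_same_card[symmetric])
  qed
  then show ?thesis using sum.image_gen[OF fin, of "\<lambda>_. 1 :: nat" "\<lambda>c. c \<bullet> q"] by simp
qed

lemma card_stabilizer:
  assumes i: "\<guillemotleft>i : M \<rightarrow> B\<guillemotright>"
  shows "card {u \<in> arr C M M. i \<bullet> u = zro M B \<and> idt M \<boxplus> u \<in> Aut C M} = card {a \<in> Aut C M. i \<bullet> a = i}"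
proof -
  note [simp] = i
  have [simp]: "ob M" using i ob_dm by blast
  have ar: "\<guillemotleft>a : M \<rightarrow> M\<guillemotright>" if "a \<in> Aut C M" for a using that by (auto simp: Aut_iff)
  have "bij_betw (\<lambda>u. idt M \<boxplus> u) {u \<in> arr C M M. i \<bullet> u = zro M B \<and> idt M \<boxplus> u \<in> Aut C M}
    {a \<in> Aut C M. i \<bullet> a = i}"
  proof (rule bij_betw_byWitness[where f' = "\<lambda>a. \<boxminus> (idt M) \<boxplus> a"])
    show "(\<lambda>a. \<boxminus> (idt M) \<boxplus> a) ` {a \<in> Aut C M. i \<bullet> a = i} \<subseteq>
      {u \<in> arr C M M. i \<bullet> u = zro M B \<and> idt M \<boxplus> u \<in> Aut C M}"
    proof (rule image_subsetI)
      fix a assume "a \<in> {a \<in> Aut C M. i \<bullet> a = i}"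
      then show "\<boxminus> (idt M) \<boxplus> a \<in> {u \<in> arr C M M. i \<bullet> u = zro M B \<and> idt M \<boxplus> u \<in> Aut C M}"
        using ar[of a] by (simp add: arr_iff)
    qed
    show "(\<lambda>u. idt M \<boxplus> u) ` {u \<in> arr C M M. i \<bullet> u = zro M B \<and> idt M \<boxplus> u \<in> Aut C M} \<subseteq>
      {a \<in> Aut C M. i \<bullet> a = i}"
      by (rule image_subsetI) (simp add: arr_iff)
  qed (use ar in \<open>simp_all add: arr_iff\<close>)
  then show ?thesis by (rule bij_betw_same_card)
qed

lemma card_costabilizer:
  assumes "\<guillemotleft>q : B \<rightarrow> N\<guillemotright>"
  shows "card {v \<in> arr C N N. v \<bullet> q = zro B N \<and> idt N \<boxplus> v \<in> Aut C N} = card {c \<in> Aut C N. c \<bullet> q = q}"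
  using extriangulated_category.card_stabilizer[OF extriangulated_category_opp, of q N B] assms by simp

text \<open>\<open>(1 + u, 1, 1 + v)\<close> is an endomorphism of the triangle with the identity in
  the middle, so a five lemma applies in either direction.\<close>

lemma Aut_balance:
  assumes t: "tri M B N i q \<delta>" and u: "\<guillemotleft>u : M \<rightarrow> M\<guillemotright>" "i \<bullet> u = zro M B"
    and v: "\<guillemotleft>v : N \<rightarrow> N\<guillemotright>" "v \<bullet> q = zro B N" and e: "push N u \<delta> = pull M v \<delta>"
  shows "idt M \<boxplus> u \<in> Aut C M \<longleftrightarrow> idt N \<boxplus> v \<in> Aut C N"
proof -
  note [simp] = triD[OF t] u v
  have e': "push N (idt M \<boxplus> u) \<delta> = pull M (idt N \<boxplus> v) \<delta>"
    using push_madd[of N "idt M" u \<delta>] pull_madd[of M "idt N" v \<delta>] e by simp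
  show ?thesis
  proof
    assume "idt M \<boxplus> u \<in> Aut C M"
    then obtain a' where a: "mutually_inverse (idt M \<boxplus> u) a'" by (auto simp: Aut_iff)
    have "\<exists>c'. mutually_inverse (idt N \<boxplus> v) c'"
      by (rule tri_right_iso[OF t t a _ mutually_inverse_idt[of B] _ _ _ _ e']) simp_all
    then show "idt N \<boxplus> v \<in> Aut C N" by (simp add: Aut_iff)
  next
    assume "idt N \<boxplus> v \<in> Aut C N"
    then obtain c' where c: "mutually_inverse (idt N \<boxplus> v) c'" by (auto simp: Aut_iff)
    have "\<exists>a'. mutually_inverse (idt M \<boxplus> u) a'"
      by (rule tri_left_iso[OF t t mutually_inverse_idt[of B] _ c _ _ _ _ e']) simp_all
    then show "idt M \<boxplus> u \<in> Aut C M" by (simp add: Aut_iff)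
  qed
qed

end

context hall_setting
begin

lemma finite_Aut [simp]: "ob X \<Longrightarrow> finite (Aut C X)"
  using finite_subset[OF Aut_subset] by simp

lemma card_pos_of_mem: "finite A \<Longrightarrow> a \<in> A \<Longrightarrow> card A \<noteq> 0"
  by auto

text \<open>
  The stabilizers consist of the invertible elements of \<open>1 + u\<close> with \<open>u\<close> in a one-sided ideal. Their
  density in the ideal is the same on both sides of the triangle, and the sizes of the ideals are
  quotients of braces.
\<close>

lemma stabilizer_balance:
  assumes t: "tri M B N i q \<delta>"
  shows "of_nat (card {c \<in> Aut C N. c \<bullet> q = q}) * (b M B / b M M) =
    of_nat (card {a \<in> Aut C M. i \<bullet> a = i}) * (b B N / b N N)"
proof -
  note [simp] = triD[OF t]
  let ?I = "{u \<in> arr C M M. i \<bullet> u = zro M B}" let ?J = "{v \<in> arr C N N. v \<bullet> q = zro B N}"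
  let ?I1 = "{u \<in> arr C M M. i \<bullet> u = zro M B \<and> idt M \<boxplus> u \<in> Aut C M}"
  let ?J1 = "{v \<in> arr C N N. v \<bullet> q = zro B N \<and> idt N \<boxplus> v \<in> Aut C N}"
  let ?V0 = "{v \<in> arr C N N. v \<bullet> q = zro B N \<and> pull M v \<delta> = ex0 N M}"
  let ?U0 = "{u \<in> arr C M M. i \<bullet> u = zro M B \<and> push N u \<delta> = ex0 N M}"
  have 1: "card ?I * card ?V0 = card ?J * card ?U0"
    by (rule card_kernel_balance[OF t t]) auto
  \<comment> \<open>The same fibre sizes govern the ideals and their parts with \<open>1 + u\<close>
    invertible, so they drop out of the comparison.\<close>
  have 2: "card ?I1 * card ?V0 = card ?J1 * card ?U0"
  proof (rule card_kernel_balance[OF t t])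
    fix u v assume "u \<in> arr C M M" "i \<bullet> u = zro M B" "v \<in> arr C N N" "v \<bullet> q = zro B N"
      "push N u \<delta> = pull M v \<delta>"
    then show "u \<in> ?I1 \<longleftrightarrow> v \<in> ?J1" using Aut_balance[OF t, of u v] by (simp add: arr_iff)
  qed auto
  have "zro N N \<in> ?V0" "zro M M \<in> ?U0" by (simp_all add: arr_iff)
  moreover have "finite ?V0" "finite ?U0" by simp_all
  ultimately have V0: "card ?V0 \<noteq> 0" and U0: "card ?U0 \<noteq> 0" by (blast dest: card_pos_of_mem)+
  have "(card ?J1 * card ?I) * (card ?U0 * card ?V0) = (card ?I1 * card ?J) * (card ?U0 * card ?V0)"
  proof -
    have "(card ?J1 * card ?U0) * (card ?I * card ?V0) = (card ?I1 * card ?V0) * (card ?J * card ?U0)"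
      unfolding 1 2 ..
    then show ?thesis by (simp only: ac_simps)
  qed
  then have 3: "card ?J1 * card ?I = card ?I1 * card ?J" using U0 V0 by simp
  \<comment> \<open>The sizes of both ideals involve the same brace \<open>b M N\<close>, which
    cancels in their quotient.\<close>
  have I: "of_nat (card ?I) * b M M * b M N = b M B" by (rule card_kernel_brace[OF t]) simp
  have J: "of_nat (card ?J) * b N N * b M N = b B N" by (rule card_cokernel_brace[OF t]) simp
  have pos: "b M M \<noteq> 0" "b N N \<noteq> 0" using b_pos[of M M] b_pos[of N N] by simp_all
  have "of_nat (card ?J1) * (b M B / b M M) = of_nat (card ?J1 * card ?I) * b M N"
    unfolding I[symmetric] using pos by simp
  also have "\<dots> = of_nat (card ?I1) * (b B N / b N N)"
    unfolding 3 J[symmetric] using pos by simp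
  finally show ?thesis by (simp add: card_stabilizer card_costabilizer)
qed

text \<open>The pairs \<open>(i, q)\<close> that form a triangle are summed with two weights, one of
  total one over each \<open>i\<close>, the other over each \<open>q\<close>. By
  \<open>stabilizer_balance\<close> the two weights are proportional, with a factor that is the same
  for all pairs.\<close>

lemma weighted_duality:
  assumes [simp]: "ob M" "ob B" "ob N"
    and PQ: "\<And>i q \<delta>. tri M B N i q \<delta> \<Longrightarrow> P i \<longleftrightarrow> Q q"
  shows "of_nat (card {i \<in> inflations_with_cone C M B N. P i}) / of_nat (card (Aut C M)) * (b M B / b M M) =
    of_nat (card {q \<in> deflations_with_cocone C M B N. Q q}) / of_nat (card (Aut C N)) * (b B N / b N N)"
proof -
  define R where "R = {(i, q). (\<exists>\<delta>. tri M B N i q \<delta>) \<and> P i}"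
  have "R \<subseteq> arr C M B \<times> arr C B N" unfolding R_def using triD by (auto simp: arr_iff)
  then have fin: "finite R" by (rule finite_subset) simp
  let ?cN = "of_nat (card (Aut C N)) :: rat" let ?cM = "of_nat (card (Aut C M)) :: rat"
  have c: "?cN \<noteq> 0" "?cM \<noteq> 0" using idt_in_Aut[of N] idt_in_Aut[of M] by auto
  let ?sN = "\<lambda>q. of_nat (card {c \<in> Aut C N. c \<bullet> q = q}) :: rat"
  let ?sM = "\<lambda>i. of_nat (card {a \<in> Aut C M. i \<bullet> a = i}) :: rat"
  have "of_nat (card {q'. (i, q') \<in> R}) * ?sN q = ?cN" if iq: "(i, q) \<in> R" for i q
  proof -
    obtain \<delta> where t: "tri M B N i q \<delta>" using iq unfolding R_def by blast
    have "{q'. (i, q') \<in> R} = (\<lambda>c. c \<bullet> q) ` Aut C N"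
      using deflations_orbit[OF t] iq unfolding R_def by auto
    then show ?thesis using card_orbit_stabilizer[of q B N] triD[OF t]
      by (simp flip: of_nat_mult)
  qed
  then have 1: "(\<Sum>(i, q)\<in>R. ?sN q / ?cN) = of_nat (card (fst ` R))"
    by (rule sum_over_fibres[OF fin c(1)])
  have "of_nat (card {i'. (q, i') \<in> R\<inverse>}) * ?sM i = ?cM" if iq: "(q, i) \<in> R\<inverse>" for i q
  proof -
    obtain \<delta> where t: "tri M B N i q \<delta>" using iq unfolding R_def by blast
    have "{i'. \<exists>\<delta>'. tri M B N i' q \<delta>'} = (\<lambda>a. i \<bullet> a) ` Aut C M"
      using extriangulated_category.deflations_orbit[OF extriangulated_category_opp, of N B M q i \<delta>] t by simp
    then have "{i'. (q, i') \<in> R\<inverse>} = (\<lambda>a. i \<bullet> a) ` Aut C M"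
      using iq PQ unfolding R_def by blast
    moreover have "card ((\<lambda>a. i \<bullet> a) ` Aut C M) * card {a \<in> Aut C M. i \<bullet> a = i} = card (Aut C M)"
      using extriangulated_category.card_orbit_stabilizer[OF extriangulated_category_opp, of i B M] triD[OF t]
      by simp
    ultimately show ?thesis by (simp flip: of_nat_mult)
  qed
  then have "(\<Sum>(q, i)\<in>R\<inverse>. ?sM i / ?cM) = of_nat (card (fst ` R\<inverse>))"
    using fin c(2) by (intro sum_over_fibres) simp_all
  moreover have "(\<Sum>(q, i)\<in>R\<inverse>. ?sM i / ?cM) = (\<Sum>(i, q)\<in>R. ?sM i / ?cM)"
    by (rule sum.reindex_bij_witness[of _ prod.swap prod.swap]) auto
  moreover have "fst ` R\<inverse> = snd ` R" by force
  ultimately have 2: "(\<Sum>(i, q)\<in>R. ?sM i / ?cM) = of_nat (card (snd ` R))" by simp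
  have 3: "fst ` R = {i \<in> inflations_with_cone C M B N. P i}"
    unfolding R_def by (force simp: inflations_with_cone_iff)
  have 4: "snd ` R = {q \<in> deflations_with_cocone C M B N. Q q}"
    unfolding R_def using PQ by (force simp: deflations_with_cocone_iff)
  have "of_nat (card (fst ` R)) / ?cM * (b M B / b M M) =
    (\<Sum>(i, q)\<in>R. ?sN q * (b M B / b M M) / (?cN * ?cM))"
    unfolding 1[symmetric] sum_divide_distrib sum_distrib_right
    by (rule sum.cong) (auto simp: field_simps)
  also have "\<dots> = (\<Sum>(i, q)\<in>R. ?sM i * (b B N / b N N) / (?cN * ?cM))"
  proof (rule sum.cong[OF refl], clarify)
    fix i q assume "(i, q) \<in> R"
    then obtain \<delta> where "tri M B N i q \<delta>" unfolding R_def by blast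
    from stabilizer_balance[OF this]
    show "?sN q * (b M B / b M M) / (?cN * ?cM) = ?sM i * (b B N / b N N) / (?cN * ?cM)"
      by (simp only:)
  qed
  also have "\<dots> = of_nat (card (snd ` R)) / ?cN * (b B N / b N N)"
    unfolding 2[symmetric] sum_divide_distrib sum_distrib_right
    by (rule sum.cong) (auto simp: field_simps)
  finally show ?thesis unfolding 3 4 .
qed

lemma hall_number_duality:
  assumes "ob X" "ob Y" "ob L"
  shows "hall_number_defl C S X Y L = hall_number_infl C S X Y L"
  using weighted_duality[OF assms(1,3,2), of "\<lambda>_. True" "\<lambda>_. True"]
  unfolding hall_number_defl_def hall_number_infl_def by simp

subsection \<open>Invariance under isomorphism\<close>

text \<open>For a split inflation the kernel in \<open>card_kernel_brace\<close> is trivial.\<close>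

lemma b_split_mono:
  assumes t: "tri A B Z x y \<delta>" and r: "\<guillemotleft>r : B \<rightarrow> A\<guillemotright>" "r \<bullet> x = idt A" and [simp]: "ob X"
  shows "b X A * b X Z = b X B"
proof -
  note [simp] = triD[OF t] r(1)
  have "a = zro X A" if a: "\<guillemotleft>a : X \<rightarrow> A\<guillemotright>" "x \<bullet> a = zro X B" for a
  proof -
    have "a = (r \<bullet> x) \<bullet> a" unfolding r(2) using a by simp
    also have "\<dots> = r \<bullet> zro X B" unfolding a(2)[symmetric] using a(1) by simp
    finally show ?thesis by simp
  qed
  then have "{a \<in> arr C X A. x \<bullet> a = zro X B} = {zro X A}" by (auto simp: arr_iff)
  then show ?thesis using card_kernel_brace[OF t, of X] by simp
qed

lemma b_biproduct_right:
  assumes S: "biproduct C A D Q i j p q" and "ob X" shows "b X Q = b X A * b X D"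
  using b_split_mono[OF tri_split[OF S], of p X] biproductD[OF S] assms by simp

text \<open>The triangles \<open>A -> A -> 0\<close> and \<open>A -> A' -> 0\<close> both have split
  inflations and express the two braces by the same product.\<close>

lemma b_iso_right:
  assumes i: "isomorphic C A A'" and [simp]: "ob A" "ob A'" "ob X" shows "b X A = b X A'"
proof -
  obtain O' where O': "zero_object C O'" using ex_zero_object by blast
  have [simp]: "ob O'" using O' unfolding zero_object_def by simp
  obtain f f' where f: "mutually_inverse f f'" "\<guillemotleft>f : A \<rightarrow> A'\<guillemotright>"
    using isomorphicE[OF i assms(2,3)] by blast
  note [simp] = mutually_inverse_simps[OF f(1)] f(2)
  note t = tri_idt_zero[OF O' assms(2)]
  have "b X A * b X O' = b X A" using b_split_mono[OF t, of "idt A" X] by simp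
  moreover have "b X A * b X O' = b X A'"
    using b_split_mono[OF tri_equiv[OF t f(1), of A'], of f' X] by simp
  ultimately show ?thesis by simp
qed

lemma b_iso_left:
  assumes "isomorphic C A A'" "ob A" "ob A'" "ob X" shows "b A X = b A' X"
  using hall_setting.b_iso_right[OF hall_setting_opp, of A A' X] assms
  by (simp add: brace_opp isomorphic_opp[OF linear_category_axioms])

lemma card_Aut_iso:
  assumes i: "isomorphic C X X'" and [simp]: "ob X" "ob X'"
  shows "card (Aut C X) = card (Aut C X')"
proof -
  obtain f f' where f: "mutually_inverse f f'" "\<guillemotleft>f : X \<rightarrow> X'\<guillemotright>"
    using isomorphicE[OF i assms(2,3)] by blast
  note [simp] = mutually_inverse_simps[OF f(1)] f(2)
  have ar: "\<guillemotleft>a : Y \<rightarrow> Y\<guillemotright>" if "a \<in> Aut C Y" "ob Y" for a Y using that by (auto simp: Aut_iff)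
  have cl: "g \<bullet> (a \<bullet> g') \<in> Aut C Y'" if a: "a \<in> Aut C Y" and g: "mutually_inverse g g'" "\<guillemotleft>g : Y \<rightarrow> Y'\<guillemotright>"
    and [simp]: "ob Y" "ob Y'" for a g g' Y Y'
  proof -
    note [simp] = mutually_inverse_simps[OF g(1)] g(2)
    obtain a' where a: "mutually_inverse a a'" "\<guillemotleft>a : Y \<rightarrow> Y\<guillemotright>" using a by (auto simp: Aut_iff)
    have "mutually_inverse (g \<bullet> (a \<bullet> g')) ((g \<bullet> a') \<bullet> g')"
      using mutually_inverse_cmp[OF mutually_inverse_cmp[OF mutually_inverse_sym[OF g(1)] a(1)] g(1)] a(2)
      by simp
    then show ?thesis using a(2) by (auto simp: Aut_iff)
  qed
  have "bij_betw (\<lambda>a. f \<bullet> (a \<bullet> f')) (Aut C X) (Aut C X')"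
  proof (rule bij_betw_byWitness[where f' = "\<lambda>a. f' \<bullet> (a \<bullet> f)"])
    show "(\<lambda>a. f \<bullet> (a \<bullet> f')) ` Aut C X \<subseteq> Aut C X'"
      using cl[OF _ f, of _] by auto
    show "(\<lambda>a. f' \<bullet> (a \<bullet> f)) ` Aut C X' \<subseteq> Aut C X"
      using cl[OF _ mutually_inverse_sym[OF f(1)], of _ X' X] by auto
    show "\<forall>a\<in>Aut C X. f' \<bullet> ((f \<bullet> (a \<bullet> f')) \<bullet> f) = a" using ar[of _ X] by simp
    show "\<forall>a\<in>Aut C X'. f \<bullet> ((f' \<bullet> (a \<bullet> f)) \<bullet> f') = a" using ar[of _ X'] by simp
  qed
  then show ?thesis by (rule bij_betw_same_card)
qed

lemma deflations_transport:
  assumes g: "g \<in> deflations_with_cocone C X L Y"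
    and x: "mutually_inverse x x'" "\<guillemotleft>x : X \<rightarrow> X'\<guillemotright>" and l: "mutually_inverse l l'" "\<guillemotleft>l : L \<rightarrow> L'\<guillemotright>"
    and y: "mutually_inverse y y'" "\<guillemotleft>y : Y \<rightarrow> Y'\<guillemotright>"
  shows "y \<bullet> (g \<bullet> l') \<in> deflations_with_cocone C X' L' Y'"
proof -
  have [simp]: "ob X" "ob X'" using x(2) ob_dm ob_cd by blast+
  obtain i \<delta> where t: "tri X L Y i g \<delta>" using g deflations_with_cocone_iff by auto
  show ?thesis using tri_transport[OF t x l y] deflations_with_cocone_iff by auto
qed

lemma deflations_arr:
  "ob X \<Longrightarrow> g \<in> deflations_with_cocone C X L Y \<Longrightarrow> \<guillemotleft>g : L \<rightarrow> Y\<guillemotright>"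
  using deflations_with_cocone_iff triD by metis

lemma inflations_arr:
  "ob Y \<Longrightarrow> g \<in> inflations_with_cone C X L Y \<Longrightarrow> \<guillemotleft>g : X \<rightarrow> L\<guillemotright>"
  using inflations_with_cone_iff triD by metis

lemma card_deflations_iso:
  assumes "isomorphic C X X'" "isomorphic C L L'" "isomorphic C Y Y'"
    and [simp]: "ob X" "ob X'" "ob L" "ob L'" "ob Y" "ob Y'"
  shows "card (deflations_with_cocone C X L Y) = card (deflations_with_cocone C X' L' Y')"
proof -
  obtain x x' where x: "mutually_inverse x x'" "\<guillemotleft>x : X \<rightarrow> X'\<guillemotright>"
    using isomorphicE[OF assms(1,4,5)] by blast
  obtain l l' where l: "mutually_inverse l l'" "\<guillemotleft>l : L \<rightarrow> L'\<guillemotright>"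
    using isomorphicE[OF assms(2,6,7)] by blast
  obtain y y' where y: "mutually_inverse y y'" "\<guillemotleft>y : Y \<rightarrow> Y'\<guillemotright>"
    using isomorphicE[OF assms(3,8,9)] by blast
  note [simp] = mutually_inverse_simps[OF l(1)] l(2) mutually_inverse_simps[OF y(1)] y(2)
  have x': "\<guillemotleft>x' : X' \<rightarrow> X\<guillemotright>" using mutually_inverse_simps[OF x(1)] x(2) by simp
  have "bij_betw (\<lambda>g. y \<bullet> (g \<bullet> l')) (deflations_with_cocone C X L Y) (deflations_with_cocone C X' L' Y')"
  proof (rule bij_betw_byWitness[where f' = "\<lambda>g. y' \<bullet> (g \<bullet> l)"])
    show "(\<lambda>g. y \<bullet> (g \<bullet> l')) ` deflations_with_cocone C X L Y \<subseteq> deflations_with_cocone C X' L' Y'"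
      using deflations_transport[OF _ x l y] by auto
    show "(\<lambda>g. y' \<bullet> (g \<bullet> l)) ` deflations_with_cocone C X' L' Y' \<subseteq> deflations_with_cocone C X L Y"
      using deflations_transport[OF _ mutually_inverse_sym[OF x(1)] x' mutually_inverse_sym[OF l(1)] _
          mutually_inverse_sym[OF y(1)]] by auto
    show "\<forall>g\<in>deflations_with_cocone C X L Y. y' \<bullet> ((y \<bullet> (g \<bullet> l')) \<bullet> l) = g"
      using deflations_arr[of X _ L Y] by simp
    show "\<forall>g\<in>deflations_with_cocone C X' L' Y'. y \<bullet> ((y' \<bullet> (g \<bullet> l)) \<bullet> l') = g"
      using deflations_arr[of X' _ L' Y'] by simp
  qed
  then show ?thesis by (rule bij_betw_same_card)
qed

lemma hall_number_iso:
  assumes "isomorphic C X X'" "isomorphic C Y Y'" "isomorphic C L L'"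
    and "ob X" "ob X'" "ob Y" "ob Y'" "ob L" "ob L'"
  shows "hall_number_defl C S X Y L = hall_number_defl C S X' Y' L'"
  unfolding hall_number_defl_def
  using card_deflations_iso[of X X' L L' Y Y'] card_Aut_iso[of Y Y'] b_iso_left[of L L' Y]
    b_iso_right[of Y Y' L'] b_iso_left[of Y Y' Y] b_iso_right[of Y Y' Y'] assms by simp

section \<open>Isomorphism classes and finiteness of products\<close>

lemma iso_class_eq_iff:
  assumes "ob X" "ob Y" shows "iso_class C X = iso_class C Y \<longleftrightarrow> isomorphic C X Y"
  unfolding iso_class_def using assms isomorphic_sym isomorphic_trans isomorphic_refl by blast

lemma rep_iso_class:
  assumes "c \<in> iso_classes C" shows "ob (rep c)" "iso_class C (rep c) = c"
proof -
  obtain X where X: "ob X" "c = iso_class C X" using assms unfolding iso_classes_def by blast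
  then have "X \<in> c" using isomorphic_refl unfolding iso_class_def by simp
  then have "rep c \<in> c" unfolding rep_def by (rule someI)
  then have r: "ob (rep c)" "isomorphic C X (rep c)" unfolding X(2) iso_class_def by simp_all
  then show "ob (rep c)" "iso_class C (rep c) = c"
    using X(2) iso_class_eq_iff[OF X(1) r(1)] by simp_all
qed

lemma iso_class_in [simp]: "ob X \<Longrightarrow> iso_class C X \<in> iso_classes C"
  unfolding iso_classes_def by simp

lemma isomorphic_rep: "ob X \<Longrightarrow> isomorphic C X (rep (iso_class C X))"
proof -
  assume X: "ob X"
  note r = rep_iso_class[OF iso_class_in[OF X]]
  show ?thesis using iso_class_eq_iff[OF X r(1)] r(2) by simp
qed

text \<open>Every extension of \<open>Y\<close> by \<open>X\<close> is a pushout of one fixed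
  triangle \<open>W -> P -> Y\<close> with \<open>P\<close> projective, so \<open>Hom(W,X)\<close>
  maps onto the group of extensions.\<close>

lemma finite_exts:
  assumes [simp]: "ob X" "ob Y" shows "finite (exts C Y X)"
proof -
  obtain W P k g \<epsilon> where P: "tri W P Y k g \<epsilon>" "projective C P"
    using enough_proj assms(2) unfolding enough_projectives_def by blast
  note [simp] = triD[OF P(1)]
  have "exts C Y X \<subseteq> (\<lambda>a. push Y a \<epsilon>) ` arr C W X"
  proof
    fix \<delta> assume d: "\<delta> \<in> exts C Y X"
    then obtain B x y where t: "tri X B Y x y \<delta>" using ex_tri[of Y X \<delta>] by auto
    note [simp] = triD[OF t]
    have "deflation C B Y y" using t unfolding deflation_def by blast
    moreover have "g \<in> arr C P Y" by (simp add: arr_iff)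
    ultimately obtain h where h: "h \<in> arr C P B" "y \<bullet> h = g" using P(2) unfolding projective_def by blast
    then have "\<guillemotleft>h : P \<rightarrow> B\<guillemotright>" by (simp add: arr_iff)
    then obtain a where a: "\<guillemotleft>a : W \<rightarrow> X\<guillemotright>" "push Y a \<epsilon> = pull X (idt Y) \<delta>"
      using tri_fill_left[OF P(1) t, of h "idt Y"] h(2) by auto
    then show "\<delta> \<in> (\<lambda>a. push Y a \<epsilon>) ` arr C W X" using d in_hom_arr[OF a(1)] by auto
  qed
  then show ?thesis by (rule finite_subset) simp
qed

text \<open>A nonzero Hall number needs a triangle, and the extension determines its middle term up
  to isomorphism.\<close>

lemma finite_middle_classes:
  assumes [simp]: "ob X" "ob Y"
  shows "finite {c \<in> iso_classes C. hall_number_defl C S X Y (rep c) \<noteq> 0}"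
proof -
  let ?m = "\<lambda>\<delta>. iso_class C (SOME B. \<exists>x y. tri X B Y x y \<delta>)"
  have "{c \<in> iso_classes C. hall_number_defl C S X Y (rep c) \<noteq> 0} \<subseteq> ?m ` exts C Y X"
  proof
    fix c assume c: "c \<in> {c \<in> iso_classes C. hall_number_defl C S X Y (rep c) \<noteq> 0}"
    then have "card (deflations_with_cocone C X (rep c) Y) \<noteq> 0" unfolding hall_number_defl_def by auto
    then obtain g where "g \<in> deflations_with_cocone C X (rep c) Y" by fastforce
    then obtain f \<delta> where t: "tri X (rep c) Y f g \<delta>" using deflations_with_cocone_iff by auto
    then have "\<exists>x y. tri X (SOME B. \<exists>x y. tri X B Y x y \<delta>) Y x y \<delta>" by (intro someI[of "\<lambda>B. \<exists>x y. tri X B Y x y \<delta>"] exI)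
    then obtain x y where t': "tri X (SOME B. \<exists>x y. tri X B Y x y \<delta>) Y x y \<delta>" by blast
    have "isomorphic C (rep c) (SOME B. \<exists>x y. tri X B Y x y \<delta>)"
      by (rule tri_unique[OF t t']) (rule isomorphicI, auto)
    then have "c = ?m \<delta>"
      using iso_class_eq_iff[OF triD(2)[OF t] triD(2)[OF t']] rep_iso_class(2)[of c] c by simp
    then show "c \<in> ?m ` exts C Y X" using triD(10)[OF t] by blast
  qed
  then show ?thesis by (rule finite_subset) (simp add: finite_exts)
qed

lemma hall_number_nonzero:
  assumes [simp]: "ob X" "ob Y" "ob L"
  shows "hall_number_defl C S X Y L \<noteq> 0 \<longleftrightarrow> (\<exists>f g \<delta>. tri X L Y f g \<delta>)"
proof -
  have "deflations_with_cocone C X L Y \<subseteq> arr C L Y"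
    using deflations_arr[of X _ L Y] by (auto simp: arr_iff)
  then have "finite (deflations_with_cocone C X L Y)" by (rule finite_subset) simp
  moreover have "b L Y \<noteq> 0" "b Y Y \<noteq> 0" using b_pos[of L Y] b_pos[of Y Y] by simp_all
  moreover have "Aut C Y \<noteq> {}" using idt_in_Aut[of Y] by auto
  ultimately have "hall_number_defl C S X Y L \<noteq> 0 \<longleftrightarrow> deflations_with_cocone C X L Y \<noteq> {}"
    unfolding hall_number_defl_def by simp
  then show ?thesis
    unfolding ex_in_conv[symmetric] deflations_with_cocone_iff[OF assms(1)] by blast
qed

lemma hall_number_opp:
  assumes "ob X" "ob Y" "ob L"
  shows "hall_number_defl (opp C) T Y X L = hall_number_infl C S X Y L"
  unfolding hall_number_defl_def hall_number_infl_def
  using assms by (simp add: deflations_with_cocone_opp brace_opp)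

subsection \<open>Associativity\<close>

text \<open>A pair of morphisms \<open>M -> L\<close> and \<open>M -> Y\<close> is one morphism
  \<open>M -> Q\<close>. If the first is an inflation with cone \<open>Z\<close>, the homotopy
  pushout makes the combined morphism an inflation whose cone \<open>E\<close> lies in a triangle
  \<open>Y -> E -> Z\<close>. So the class of \<open>E\<close> belongs to \<open>\<N>\<close>, and
  the pairs can be sorted by it.\<close>

lemma card_split_by_cone:
  assumes Q: "biproduct C L Y Q iL iY pL pY" and [simp]: "ob M" "ob X" "ob Z"
    and N: "finite \<N>" "\<N> \<subseteq> iso_classes C"
      "\<And>N f g \<delta>. tri Y N Z f g \<delta> \<Longrightarrow> iso_class C N \<in> \<N>"
  shows "card (inflations_with_cone C M L Z) * card (deflations_with_cocone C X M Y) =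
    (\<Sum>n\<in>\<N>. card {i \<in> inflations_with_cone C M Q (rep n).
      pL \<bullet> i \<in> inflations_with_cone C M L Z \<and> pY \<bullet> i \<in> deflations_with_cocone C X M Y})"
proof -
  note [simp] = biproductD[OF Q]
  let ?I = "inflations_with_cone C M L Z" let ?D = "deflations_with_cocone C X M Y"
  let ?G = "{i \<in> arr C M Q. pL \<bullet> i \<in> ?I \<and> pY \<bullet> i \<in> ?D}"
  let ?H = "\<lambda>n. {i \<in> inflations_with_cone C M Q (rep n). pL \<bullet> i \<in> ?I \<and> pY \<bullet> i \<in> ?D}"
  have I: "\<guillemotleft>m : M \<rightarrow> L\<guillemotright>" if "m \<in> ?I" for m using inflations_arr[OF _ that] by simp
  have D: "\<guillemotleft>y : M \<rightarrow> Y\<guillemotright>" if "y \<in> ?D" for y using deflations_arr[OF _ that] by simp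
  have bij: "bij_betw (\<lambda>i. (pL \<bullet> i, pY \<bullet> i)) ?G (?I \<times> ?D)"
  proof (rule bij_betw_byWitness[where f' = "\<lambda>(m, y). iL \<bullet> m \<boxplus> iY \<bullet> y"])
    show "\<forall>i\<in>?G. (\<lambda>(m, y). iL \<bullet> m \<boxplus> iY \<bullet> y) (pL \<bullet> i, pY \<bullet> i) = i"
      using biproduct_decomp[OF Q] by (simp add: arr_iff)
    show "\<forall>s\<in>?I \<times> ?D. (pL \<bullet> (\<lambda>(m, y). iL \<bullet> m \<boxplus> iY \<bullet> y) s, pY \<bullet> (\<lambda>(m, y). iL \<bullet> m \<boxplus> iY \<bullet> y) s) = s"
      using I D by auto
    show "(\<lambda>(m, y). iL \<bullet> m \<boxplus> iY \<bullet> y) ` (?I \<times> ?D) \<subseteq> ?G"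
    proof (clarify, intro conjI)
      fix m y assume "m \<in> ?I" "y \<in> ?D"
      then show "iL \<bullet> m \<boxplus> iY \<bullet> y \<in> arr C M Q" "pL \<bullet> (iL \<bullet> m \<boxplus> iY \<bullet> y) \<in> ?I"
        "pY \<bullet> (iL \<bullet> m \<boxplus> iY \<bullet> y) \<in> ?D"
        using I[of m] D[of y] by (simp_all add: arr_iff)
    qed
  qed auto
  have G: "?G = (\<Union>n\<in>\<N>. ?H n)"
  proof (intro equalityI subsetI)
    fix i assume i: "i \<in> ?G"
    then have i': "\<guillemotleft>i : M \<rightarrow> Q\<guillemotright>" "pL \<bullet> i \<in> ?I" "pY \<bullet> i \<in> ?D" by (auto simp: arr_iff)
    note [simp] = i'(1)
    obtain f \<delta> where f: "tri M L Z (pL \<bullet> i) f \<delta>" using i'(2) inflations_with_cone_iff by auto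
    note [simp] = triD[OF f]
    obtain E d e' where d: "tri Y E Z d e' (push Z (pY \<bullet> i) \<delta>)"
      using ex_tri[of Z Y "push Z (pY \<bullet> i) \<delta>"] by auto
    obtain c where c: "tri M Q E (iL \<bullet> (pL \<bullet> i) \<boxplus> iY \<bullet> (pY \<bullet> i)) (c \<bullet> pL \<boxplus> \<boxminus> (d \<bullet> pY)) (pull M e' \<delta>)"
      using homotopy_pushout[OF f _ d Q] by auto
    have "iL \<bullet> (pL \<bullet> i) \<boxplus> iY \<bullet> (pY \<bullet> i) = i" by (rule biproduct_decomp[OF Q, symmetric]) simp_all
    note c' = c[unfolded this]
    have n: "iso_class C E \<in> \<N>" by (rule N(3)[OF d])
    have "isomorphic C E (rep (iso_class C E))" by (rule isomorphic_rep[OF triD(3)[OF c']])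
    then have "i \<in> inflations_with_cone C M Q (rep (iso_class C E))"
      unfolding inflations_with_cone_def using c' by blast
    then show "i \<in> (\<Union>n\<in>\<N>. ?H n)" using n i' by blast
  next
    fix i assume "i \<in> (\<Union>n\<in>\<N>. ?H n)"
    then obtain n where n: "n \<in> \<N>" "i \<in> ?H n" by blast
    then have "\<guillemotleft>i : M \<rightarrow> Q\<guillemotright>" using inflations_arr[of "rep n" i M Q] rep_iso_class(1)[of n] N(2) by auto
    then show "i \<in> ?G" using n in_hom_arr by blast
  qed
  have "card (\<Union>n\<in>\<N>. ?H n) = (\<Sum>n\<in>\<N>. card (?H n))"
  proof (rule card_UN_disjoint[OF N(1)])
    show "\<forall>n\<in>\<N>. finite (?H n)"
    proof
      fix n assume "n \<in> \<N>"
      then have "?H n \<subseteq> ?G" using G by blast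
      then show "finite (?H n)" by (rule finite_subset) simp
    qed
    show "\<forall>n\<in>\<N>. \<forall>n'\<in>\<N>. n \<noteq> n' \<longrightarrow> ?H n \<inter> ?H n' = {}"
    proof (intro ballI impI, rule ccontr)
      fix n n' assume n: "n \<in> \<N>" "n' \<in> \<N>" "n \<noteq> n'" "?H n \<inter> ?H n' \<noteq> {}"
      have r: "ob (rep n)" "ob (rep n')" "iso_class C (rep n) = n" "iso_class C (rep n') = n'"
        using rep_iso_class n N(2) by auto
      obtain i where "i \<in> ?H n" "i \<in> ?H n'" using n(4) by blast
      then have "i \<in> inflations_with_cone C M Q (rep n)" "i \<in> inflations_with_cone C M Q (rep n')" by blast+
      then obtain q \<delta> q' \<delta>' where t: "tri M Q (rep n) i q \<delta>" and t': "tri M Q (rep n') i q' \<delta>'"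
        unfolding inflations_with_cone_iff[OF r(1)] inflations_with_cone_iff[OF r(2)] by blast
      note [simp] = triD[OF t] triD[OF t']
      obtain c where c: "\<guillemotleft>c : rep n \<rightarrow> rep n'\<guillemotright>" "c \<bullet> q = q' \<bullet> idt Q" "push (rep n) (idt M) \<delta> = pull M c \<delta>'"
        using tri_fill_right[OF t t', of "idt M" "idt Q"] by auto
      then obtain c' where "mutually_inverse c c'"
        using tri_right_iso[OF t t' mutually_inverse_idt[of M] _ mutually_inverse_idt[of Q] _ c(1)] by auto
      then have "isomorphic C (rep n) (rep n')" using c(1) by (intro isomorphicI) auto
      then show False using r iso_class_eq_iff[OF r(1,2)] n(3) by simp
    qed
  qed
  then show ?thesis using bij_betw_same_card[OF bij] unfolding G by (simp add: card_cartesian_product)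
qed

text \<open>The forms of the two factors are chosen such that \<open>b M L\<close> and
  \<open>b M Y\<close> meet and combine to \<open>b M Q\<close> by \<open>b_biproduct_right\<close>.
  Each summand is then one side of \<open>weighted_duality\<close> for \<open>M\<close>,
  \<open>Q\<close> and \<open>rep n\<close>.\<close>

lemma hall_number_product:
  assumes Q: "biproduct C L Y Q iL iY pL pY" and [simp]: "ob M" "ob X" "ob Z"
    and N: "finite \<N>" "\<N> \<subseteq> iso_classes C"
      "\<And>N f g \<delta>. tri Y N Z f g \<delta> \<Longrightarrow> iso_class C N \<in> \<N>"
  shows "hall_number_defl C S X Y M * hall_number_infl C S M Z L =
    (\<Sum>n\<in>\<N>. of_nat (card {i \<in> inflations_with_cone C M Q (rep n).
      pL \<bullet> i \<in> inflations_with_cone C M L Z \<and> pY \<bullet> i \<in> deflations_with_cocone C X M Y})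
      / of_nat (card (Aut C M)) * (b M Q / b M M)) / (of_nat (card (Aut C Y)) * b Y Y)"
proof -
  let ?k = "\<lambda>n. of_nat (card {i \<in> inflations_with_cone C M Q (rep n).
      pL \<bullet> i \<in> inflations_with_cone C M L Z \<and> pY \<bullet> i \<in> deflations_with_cocone C X M Y}) :: rat"
  note [simp] = biproductD[OF Q]
  have k: "of_nat (card (inflations_with_cone C M L Z)) * of_nat (card (deflations_with_cocone C X M Y)) =
    (\<Sum>n\<in>\<N>. ?k n)"
    using arg_cong[OF card_split_by_cone[OF assms], where f = "of_nat :: nat \<Rightarrow> rat"] by simp
  have "(\<Sum>n\<in>\<N>. ?k n / of_nat (card (Aut C M)) * (b M Q / b M M)) =
    (\<Sum>n\<in>\<N>. ?k n) / of_nat (card (Aut C M)) * (b M Q / b M M)"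
    by (simp add: sum_distrib_right sum_divide_distrib)
  then show ?thesis
    unfolding hall_number_defl_def hall_number_infl_def b_biproduct_right[OF Q \<open>ob M\<close>] k[symmetric]
    by (simp add: ac_simps)
qed

lemma hall_number_product_op:
  assumes Q: "biproduct C L Y Q iL iY pL pY" and [simp]: "ob N" "ob X" "ob Z"
    and M: "finite \<M>" "\<M> \<subseteq> iso_classes C"
      "\<And>M f g \<delta>. tri X M Y f g \<delta> \<Longrightarrow> iso_class C M \<in> \<M>"
  shows "hall_number_infl C S Y Z N * hall_number_defl C S X N L =
    (\<Sum>m\<in>\<M>. of_nat (card {q \<in> deflations_with_cocone C (rep m) Q N.
      q \<bullet> iL \<in> deflations_with_cocone C X L N \<and> q \<bullet> iY \<in> inflations_with_cone C Y N Z})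
      / of_nat (card (Aut C N)) * (b Q N / b N N)) / (of_nat (card (Aut C Y)) * b Y Y)"
proof -
  note [simp] = biproductD[OF Q]
  \<comment> \<open>\<open>rep\<close> depends on the class as a set only, and \<open>C\<close> and
    \<open>opp C\<close> have the same classes; so both categories use the same
    representatives.\<close>
  have cls: "iso_class (opp C) A = iso_class C A" if "ob A" for A
    unfolding iso_class_def using isomorphic_opp[OF linear_category_axioms that] by auto
  have clss: "iso_classes (opp C) = iso_classes C"
    unfolding iso_classes_def using cls by auto
  have M3: "iso_class (opp C) M \<in> \<M>" if "etriangle (opp C) Y M X f g \<delta>" for M f g \<delta>
    using M(3)[of M g f \<delta>] that cls triD(2) by auto
  have "hall_number_defl (opp C) T Z Y N * hall_number_infl (opp C) T N X L =
    (\<Sum>m\<in>\<M>. of_nat (card {q \<in> inflations_with_cone (opp C) N Q (rep m).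
      cmp (opp C) iL q \<in> inflations_with_cone (opp C) N L X \<and>
      cmp (opp C) iY q \<in> deflations_with_cocone (opp C) Z N Y})
      / of_nat (card (Aut (opp C) N)) * (brace_I (opp C) T N Q / brace_I (opp C) T N N))
      / (of_nat (card (Aut (opp C) Y)) * brace_I (opp C) T Y Y)"
    by (rule hall_setting.hall_number_product[OF hall_setting_opp, of L Y Q pL pY iL iY])
      (use Q M M3 clss in \<open>simp_all only: opp_simps biproduct_opp assms\<close>)
  moreover have "hall_number_infl (opp C) T N X L = hall_number_defl C S X N L"
    using hall_setting.hall_number_opp[OF hall_setting_opp, of N X L] by simp
  moreover have "inflations_with_cone (opp C) N Q (rep m) = deflations_with_cocone C (rep m) Q N"
    if "m \<in> \<M>" for m
    using inflations_with_cone_opp[of "rep m" N Q] rep_iso_class(1)[of m] that M(2) by auto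
  ultimately show ?thesis
    by (simp add: hall_number_opp inflations_with_cone_opp deflations_with_cocone_opp brace_opp conj_commute
        cong: sum.cong)
qed

text \<open>Both bracketings become double sums over the classes of \<open>M\<close> and
  \<open>N\<close>, up to the common factor in \<open>Y\<close>, and their summands agree one by
  one. The index sets are cut down to nonzero Hall numbers because there may be infinitely many
  isomorphism classes.\<close>

theorem hall_number_assoc:
  assumes [simp]: "ob X" "ob Y" "ob Z" "ob L"
  shows "(\<Sum>m\<in>{m \<in> iso_classes C. hall_number_defl C S X Y (rep m) \<noteq> 0}.
      hall_number_defl C S X Y (rep m) * hall_number_defl C S (rep m) Z L) =
    (\<Sum>n\<in>{n \<in> iso_classes C. hall_number_defl C S Y Z (rep n) \<noteq> 0}.
      hall_number_defl C S Y Z (rep n) * hall_number_defl C S X (rep n) L)"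
proof -
  let ?M = "{m \<in> iso_classes C. hall_number_defl C S X Y (rep m) \<noteq> 0}"
  let ?N = "{n \<in> iso_classes C. hall_number_defl C S Y Z (rep n) \<noteq> 0}"
  obtain Q iL iY pL pY where Q: "biproduct C L Y Q iL iY pL pY" using ex_biproduct[of L Y] by auto
  note [simp] = biproductD[OF Q]
  have cls: "iso_class C N \<in> {c \<in> iso_classes C. hall_number_defl C S A B (rep c) \<noteq> 0}"
    if t: "tri A N B f g \<delta>" for A N B f g \<delta>
  proof -
    note [simp] = triD[OF t]
    have "hall_number_defl C S A B N \<noteq> 0" using hall_number_nonzero[of A B N] t by auto
    then show ?thesis
      using hall_number_iso[of A A B B N "rep (iso_class C N)"] isomorphic_rep[of N] isomorphic_refl
        rep_iso_class(1)[of "iso_class C N"] by simp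
  qed
  let ?G = "\<lambda>M i. pL \<bullet> i \<in> inflations_with_cone C M L Z \<and> pY \<bullet> i \<in> deflations_with_cocone C X M Y"
  let ?H = "\<lambda>N q. q \<bullet> iL \<in> deflations_with_cocone C X L N \<and> q \<bullet> iY \<in> inflations_with_cone C Y N Z"
  let ?w = "\<lambda>m n. of_nat (card {i \<in> inflations_with_cone C (rep m) Q (rep n). ?G (rep m) i})
      / of_nat (card (Aut C (rep m))) * (b (rep m) Q / b (rep m) (rep m))"
  let ?w' = "\<lambda>m n. of_nat (card {q \<in> deflations_with_cocone C (rep m) Q (rep n). ?H (rep n) q})
      / of_nat (card (Aut C (rep n))) * (b Q (rep n) / b (rep n) (rep n))"
  let ?c = "of_nat (card (Aut C Y)) * b Y Y"
  have fin: "finite ?M" "finite ?N" by (simp_all add: finite_middle_classes)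
  have "(\<Sum>m\<in>?M. hall_number_defl C S X Y (rep m) * hall_number_defl C S (rep m) Z L)
    = (\<Sum>m\<in>?M. (\<Sum>n\<in>?N. ?w m n) / ?c)"
  proof (rule sum.cong[OF refl])
    fix m assume "m \<in> ?M"
    then have [simp]: "ob (rep m)" using rep_iso_class(1) by simp
    have "hall_number_defl C S (rep m) Z L = hall_number_infl C S (rep m) Z L"
      by (rule hall_number_duality) simp_all
    moreover have "hall_number_defl C S X Y (rep m) * hall_number_infl C S (rep m) Z L =
      (\<Sum>n\<in>?N. ?w m n) / ?c"
      by (rule hall_number_product[OF Q _ _ _ fin(2)]) (rule cls, assumption | simp | blast)+
    ultimately show "hall_number_defl C S X Y (rep m) * hall_number_defl C S (rep m) Z L =
      (\<Sum>n\<in>?N. ?w m n) / ?c"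
      by (simp only:)
  qed
  also have "\<dots> = (\<Sum>m\<in>?M. \<Sum>n\<in>?N. ?w m n) / ?c" by (simp add: sum_divide_distrib)
  also have "(\<Sum>m\<in>?M. \<Sum>n\<in>?N. ?w m n) = (\<Sum>m\<in>?M. \<Sum>n\<in>?N. ?w' m n)"
  proof (intro sum.cong refl)
    fix m n assume "m \<in> ?M" "n \<in> ?N"
    then have [simp]: "ob (rep m)" "ob (rep n)" using rep_iso_class(1) by simp_all
    show "?w m n = ?w' m n"
    proof (rule weighted_duality)
      fix i q \<delta> assume t: "tri (rep m) Q (rep n) i q \<delta>"
      \<comment> \<open>Opposite sides of the square on \<open>M\<close>, \<open>L\<close>,
        \<open>Y\<close>, \<open>N\<close>: parallel deflations share the cocone \<open>X\<close>,
        parallel inflations the cone \<open>Z\<close>.\<close>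
      show "?G (rep m) i \<longleftrightarrow> ?H (rep n) q"
        using deflation_parallel_iff[OF t Q, of X] inflation_parallel_iff[OF t Q, of Z]
        by (auto simp: inflations_with_cone_iff deflations_with_cocone_iff)
    qed simp_all
  qed
  also have "\<dots> = (\<Sum>n\<in>?N. \<Sum>m\<in>?M. ?w' m n)" by (rule sum.swap)
  also have "\<dots> / ?c = (\<Sum>n\<in>?N. (\<Sum>m\<in>?M. ?w' m n) / ?c)" by (simp add: sum_divide_distrib)
  also have "\<dots> = (\<Sum>n\<in>?N. hall_number_defl C S Y Z (rep n) * hall_number_defl C S X (rep n) L)"
  proof (rule sum.cong[OF refl])
    fix n assume "n \<in> ?N"
    then have [simp]: "ob (rep n)" using rep_iso_class(1) by simp
    have "hall_number_defl C S Y Z (rep n) = hall_number_infl C S Y Z (rep n)"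
      by (rule hall_number_duality) simp_all
    moreover have "hall_number_infl C S Y Z (rep n) * hall_number_defl C S X (rep n) L =
      (\<Sum>m\<in>?M. ?w' m n) / ?c"
      by (rule hall_number_product_op[OF Q _ _ _ fin(1)]) (rule cls, assumption | simp | blast)+
    ultimately show "(\<Sum>m\<in>?M. ?w' m n) / ?c =
      hall_number_defl C S Y Z (rep n) * hall_number_defl C S X (rep n) L"
      by (simp only:)
  qed
  finally show ?thesis .
qed

end

section \<open>Algebras with given structure constants\<close>

definition structure_mult :: "'c set \<Rightarrow> ('c \<Rightarrow> 'c \<Rightarrow> 'c \<Rightarrow> rat) \<Rightarrow> ('c \<Rightarrow> rat) \<Rightarrow> ('c \<Rightarrow> rat) \<Rightarrow> 'c \<Rightarrow> rat" where
  "structure_mult Cls g u v = (\<lambda>l. if l \<in> Cls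
     then (\<Sum>a\<in>{a. u a \<noteq> 0}. \<Sum>b\<in>{b. v b \<noteq> 0}. u a * v b * g a b l) else 0)"

definition structure_algebra ::
  "'c set \<Rightarrow> ('c \<Rightarrow> 'c \<Rightarrow> 'c \<Rightarrow> rat) \<Rightarrow> 'c \<Rightarrow> (rat, 'c \<Rightarrow> rat) module" where
  "structure_algebra Cls g z =
     \<lparr> carrier = {u. finite {c. u c \<noteq> 0} \<and> {c. u c \<noteq> 0} \<subseteq> Cls},
       mult = structure_mult Cls g,
       one = (\<lambda>c. if c = z then 1 else 0),
       zero = (\<lambda>_. 0),
       add = (\<lambda>u v c. u c + v c),
       smult = (\<lambda>r u c. r * u c) \<rparr>"

lemma cring_rat_ring: "cring rat_ring"
proof (rule cringI)
  show "abelian_group rat_ring"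
  proof (rule abelian_groupI)
    fix x assume "x \<in> carrier rat_ring"
    then show "\<exists>y\<in>carrier rat_ring. y \<oplus>\<^bsub>rat_ring\<^esub> x = \<zero>\<^bsub>rat_ring\<^esub>"
      by (intro bexI[of _ "- x"]) (simp_all add: rat_ring_def)
  qed (simp_all add: rat_ring_def)
  show "comm_monoid rat_ring" by (rule comm_monoidI) (simp_all add: rat_ring_def)
qed (simp add: rat_ring_def distrib_right)

text \<open>The sums in \<open>assoc\<close> run over the support of the inner constants, finite by
  \<open>finite_products\<close>; a sum over an infinite \<open>Cls\<close> would be zero by
  default.\<close>

locale structure_constants =
  fixes Cls :: "'c set" and g :: "'c \<Rightarrow> 'c \<Rightarrow> 'c \<Rightarrow> rat" and z :: 'c
  assumes z: "z \<in> Cls"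
    and finite_products: "\<lbrakk>a \<in> Cls; b \<in> Cls\<rbrakk> \<Longrightarrow> finite {l \<in> Cls. g a b l \<noteq> 0}"
    and unit_left: "\<lbrakk>b \<in> Cls; l \<in> Cls\<rbrakk> \<Longrightarrow> g z b l = (if l = b then 1 else 0)"
    and unit_right: "\<lbrakk>a \<in> Cls; l \<in> Cls\<rbrakk> \<Longrightarrow> g a z l = (if l = a then 1 else 0)"
    and assoc: "\<lbrakk>a \<in> Cls; b \<in> Cls; c \<in> Cls; l \<in> Cls\<rbrakk> \<Longrightarrow>
      (\<Sum>m\<in>{m \<in> Cls. g a b m \<noteq> 0}. g a b m * g m c l) =
      (\<Sum>n\<in>{n \<in> Cls. g b c n \<noteq> 0}. g b c n * g a n l)"
begin

abbreviation supp :: "('c \<Rightarrow> rat) \<Rightarrow> 'c set" where "supp u \<equiv> {c. u c \<noteq> 0}"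
abbreviation fin_supp :: "('c \<Rightarrow> rat) \<Rightarrow> bool" where "fin_supp u \<equiv> finite (supp u) \<and> supp u \<subseteq> Cls"
abbreviation times (infixl "\<star>" 70) where "u \<star> v \<equiv> structure_mult Cls g u v"

text \<open>The supports in the definition vary with the factors; common larger index sets make the
  sums for different factors comparable.\<close>

lemma times_eq:
  assumes "finite A" "supp u \<subseteq> A" "finite B" "supp v \<subseteq> B" "l \<in> Cls"
  shows "(u \<star> v) l = (\<Sum>a\<in>A. \<Sum>b\<in>B. u a * v b * g a b l)"
proof -
  have "(u \<star> v) l = (\<Sum>a\<in>supp u. \<Sum>b\<in>supp v. u a * v b * g a b l)"
    unfolding structure_mult_def using assms(5) by simp
  also have "\<dots> = (\<Sum>a\<in>supp u. \<Sum>b\<in>B. u a * v b * g a b l)"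
    using assms(3,4) by (intro sum.cong refl sum.mono_neutral_left) auto
  also have "\<dots> = (\<Sum>a\<in>A. \<Sum>b\<in>B. u a * v b * g a b l)"
    using assms(1,2) by (intro sum.mono_neutral_left) auto
  finally show ?thesis .
qed

lemma times_outside: "l \<notin> Cls \<Longrightarrow> (u \<star> v) l = 0"
  unfolding structure_mult_def by simp

lemma supp_times: "supp (u \<star> v) \<subseteq> (\<Union>a\<in>supp u. \<Union>b\<in>supp v. {l \<in> Cls. g a b l \<noteq> 0})"
proof
  fix l assume l: "l \<in> supp (u \<star> v)"
  then have "l \<in> Cls" using times_outside by blast
  with l have "(\<Sum>a\<in>supp u. \<Sum>b\<in>supp v. u a * v b * g a b l) \<noteq> 0" unfolding structure_mult_def by simp
  then obtain a where a: "a \<in> supp u" "(\<Sum>b\<in>supp v. u a * v b * g a b l) \<noteq> 0"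
    using sum.not_neutral_contains_not_neutral by blast
  then obtain b where b: "b \<in> supp v" "u a * v b * g a b l \<noteq> 0"
    using sum.not_neutral_contains_not_neutral by blast
  then show "l \<in> (\<Union>a\<in>supp u. \<Union>b\<in>supp v. {l \<in> Cls. g a b l \<noteq> 0})"
    using a(1) \<open>l \<in> Cls\<close> by auto
qed

lemma finite_supp_bound:
  assumes "fin_supp u" "fin_supp v"
  shows "finite (\<Union>a\<in>supp u. \<Union>b\<in>supp v. {l \<in> Cls. g a b l \<noteq> 0})"
  using assms finite_products by (intro finite_UN_I) blast+

lemma times_closed: "fin_supp u \<Longrightarrow> fin_supp v \<Longrightarrow> fin_supp (u \<star> v)"
  using finite_subset[OF supp_times finite_supp_bound] times_outside by blast

lemma times_assoc:
  assumes u: "fin_supp u" and v: "fin_supp v" and w: "fin_supp w"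
  shows "(u \<star> v) \<star> w = u \<star> (v \<star> w)"
proof
  fix l
  show "((u \<star> v) \<star> w) l = (u \<star> (v \<star> w)) l"
  proof (cases "l \<in> Cls")
    case True
    let ?A = "supp u" let ?B = "supp v" let ?D = "supp w"
    \<comment> \<open>A finite bound for the support of \<open>u \<star> v\<close>. Unlike the
      support itself, it contains the intermediate indices of every pair of basis vectors, even
      where the product cancels.\<close>
    let ?M = "\<Union>a\<in>?A. \<Union>b\<in>?B. {l \<in> Cls. g a b l \<noteq> 0}"
    let ?N = "\<Union>a\<in>?B. \<Union>b\<in>?D. {l \<in> Cls. g a b l \<noteq> 0}"
    have fin: "finite ?A" "finite ?B" "finite ?D" "finite ?M" "finite ?N"
      using u v w finite_supp_bound by blast+
    have uv: "(u \<star> v) m = (\<Sum>a\<in>?A. \<Sum>b\<in>?B. u a * v b * g a b m)" if "m \<in> ?M" for m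
      using times_eq[OF fin(1) order_refl fin(2) order_refl] that by blast
    have vw: "(v \<star> w) n = (\<Sum>b\<in>?B. \<Sum>c\<in>?D. v b * w c * g b c n)" if "n \<in> ?N" for n
      using times_eq[OF fin(2) order_refl fin(3) order_refl] that by blast
    have "((u \<star> v) \<star> w) l = (\<Sum>m\<in>?M. \<Sum>c\<in>?D. (u \<star> v) m * w c * g m c l)"
      by (rule times_eq[OF fin(4) supp_times fin(3) order_refl True])
    also have "\<dots> = (\<Sum>m\<in>?M. \<Sum>c\<in>?D. \<Sum>a\<in>?A. \<Sum>b\<in>?B. u a * v b * w c * (g a b m * g m c l))"
      by (intro sum.cong refl) (simp add: uv sum_distrib_left sum_distrib_right ac_simps)
    also have "\<dots> = (\<Sum>c\<in>?D. \<Sum>m\<in>?M. \<Sum>a\<in>?A. \<Sum>b\<in>?B. u a * v b * w c * (g a b m * g m c l))"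
      by (rule sum.swap)
    also have "\<dots> = (\<Sum>c\<in>?D. \<Sum>a\<in>?A. \<Sum>m\<in>?M. \<Sum>b\<in>?B. u a * v b * w c * (g a b m * g m c l))"
      by (intro sum.cong refl sum.swap)
    also have "\<dots> = (\<Sum>c\<in>?D. \<Sum>a\<in>?A. \<Sum>b\<in>?B. \<Sum>m\<in>?M. u a * v b * w c * (g a b m * g m c l))"
      by (intro sum.cong refl sum.swap)
    also have "\<dots> = (\<Sum>c\<in>?D. \<Sum>a\<in>?A. \<Sum>b\<in>?B. u a * v b * w c *
        (\<Sum>m\<in>{m \<in> Cls. g a b m \<noteq> 0}. g a b m * g m c l))"
    proof (intro sum.cong refl)
      fix c a b assume "c \<in> ?D" "a \<in> ?A" "b \<in> ?B"
      then have "(\<Sum>m\<in>?M. g a b m * g m c l) = (\<Sum>m\<in>{m \<in> Cls. g a b m \<noteq> 0}. g a b m * g m c l)"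
        using fin(4) by (intro sum.mono_neutral_right) auto
      then show "(\<Sum>m\<in>?M. u a * v b * w c * (g a b m * g m c l)) =
          u a * v b * w c * (\<Sum>m\<in>{m \<in> Cls. g a b m \<noteq> 0}. g a b m * g m c l)"
        by (simp flip: sum_distrib_left)
    qed
    also have "\<dots> = (\<Sum>c\<in>?D. \<Sum>a\<in>?A. \<Sum>b\<in>?B. u a * v b * w c *
        (\<Sum>n\<in>{n \<in> Cls. g b c n \<noteq> 0}. g b c n * g a n l))"
    proof (intro sum.cong refl)
      fix c a b assume "c \<in> ?D" "a \<in> ?A" "b \<in> ?B"
      then have "a \<in> Cls" "b \<in> Cls" "c \<in> Cls" using u v w by blast+
      from assoc[OF this True]
      show "u a * v b * w c * (\<Sum>m\<in>{m \<in> Cls. g a b m \<noteq> 0}. g a b m * g m c l) =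
        u a * v b * w c * (\<Sum>n\<in>{n \<in> Cls. g b c n \<noteq> 0}. g b c n * g a n l)"
        by (rule arg_cong)
    qed
    also have "\<dots> = (\<Sum>c\<in>?D. \<Sum>a\<in>?A. \<Sum>b\<in>?B. \<Sum>n\<in>?N. u a * v b * w c * (g b c n * g a n l))"
    proof (intro sum.cong refl)
      fix c a b assume "c \<in> ?D" "a \<in> ?A" "b \<in> ?B"
      then have "(\<Sum>n\<in>?N. g b c n * g a n l) = (\<Sum>n\<in>{n \<in> Cls. g b c n \<noteq> 0}. g b c n * g a n l)"
        using fin(5) by (intro sum.mono_neutral_right) auto
      then show "u a * v b * w c * (\<Sum>n\<in>{n \<in> Cls. g b c n \<noteq> 0}. g b c n * g a n l) =
          (\<Sum>n\<in>?N. u a * v b * w c * (g b c n * g a n l))"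
        by (simp flip: sum_distrib_left)
    qed
    also have "\<dots> = (\<Sum>a\<in>?A. \<Sum>c\<in>?D. \<Sum>b\<in>?B. \<Sum>n\<in>?N. u a * v b * w c * (g b c n * g a n l))"
      by (rule sum.swap)
    also have "\<dots> = (\<Sum>a\<in>?A. \<Sum>c\<in>?D. \<Sum>n\<in>?N. \<Sum>b\<in>?B. u a * v b * w c * (g b c n * g a n l))"
      by (intro sum.cong refl sum.swap)
    also have "\<dots> = (\<Sum>a\<in>?A. \<Sum>n\<in>?N. \<Sum>c\<in>?D. \<Sum>b\<in>?B. u a * v b * w c * (g b c n * g a n l))"
      by (intro sum.cong refl sum.swap)
    also have "\<dots> = (\<Sum>a\<in>?A. \<Sum>n\<in>?N. \<Sum>b\<in>?B. \<Sum>c\<in>?D. u a * v b * w c * (g b c n * g a n l))"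
      by (intro sum.cong refl sum.swap)
    also have "\<dots> = (\<Sum>a\<in>?A. \<Sum>n\<in>?N. u a * (v \<star> w) n * g a n l)"
      by (intro sum.cong refl) (simp add: vw sum_distrib_left sum_distrib_right ac_simps)
    also have "\<dots> = (u \<star> (v \<star> w)) l"
      by (rule times_eq[OF fin(1) order_refl fin(5) supp_times True, symmetric])
    finally show ?thesis .
  qed (simp add: times_outside)
qed

lemma fin_supp_add: "fin_supp u \<Longrightarrow> fin_supp v \<Longrightarrow> fin_supp (\<lambda>c. u c + v c)"
proof -
  assume u: "fin_supp u" and v: "fin_supp v"
  have "supp (\<lambda>c. u c + v c) \<subseteq> supp u \<union> supp v" by auto
  then show ?thesis using u v finite_subset[of _ "supp u \<union> supp v"] by blast
qed

lemma fin_supp_smult: "fin_supp u \<Longrightarrow> fin_supp (\<lambda>c. r * u c)"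
  by (intro conjI finite_subset[of "supp (\<lambda>c. r * u c)" "supp u"]) auto

lemma times_add_left:
  assumes "fin_supp u" "fin_supp v" "fin_supp w"
  shows "(\<lambda>c. u c + v c) \<star> w = (\<lambda>c. (u \<star> w) c + (v \<star> w) c)"
proof
  fix l
  let ?A = "supp u \<union> supp v" let ?B = "supp w"
  have f: "finite ?A" "finite ?B" using assms by auto
  show "((\<lambda>c. u c + v c) \<star> w) l = (u \<star> w) l + (v \<star> w) l"
  proof (cases "l \<in> Cls")
    case True
    have "((\<lambda>c. u c + v c) \<star> w) l = (\<Sum>a\<in>?A. \<Sum>b\<in>?B. (u a + v a) * w b * g a b l)"
      by (rule times_eq[OF f(1) _ f(2) order_refl True]) auto
    moreover have "(u \<star> w) l = (\<Sum>a\<in>?A. \<Sum>b\<in>?B. u a * w b * g a b l)"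
      by (rule times_eq[OF f(1) _ f(2) order_refl True]) auto
    moreover have "(v \<star> w) l = (\<Sum>a\<in>?A. \<Sum>b\<in>?B. v a * w b * g a b l)"
      by (rule times_eq[OF f(1) _ f(2) order_refl True]) auto
    ultimately show ?thesis by (simp add: distrib_right sum.distrib)
  qed (simp add: times_outside)
qed

lemma times_add_right:
  assumes "fin_supp u" "fin_supp v" "fin_supp w"
  shows "w \<star> (\<lambda>c. u c + v c) = (\<lambda>c. (w \<star> u) c + (w \<star> v) c)"
proof
  fix l
  let ?A = "supp w" let ?B = "supp u \<union> supp v"
  have f: "finite ?A" "finite ?B" using assms by auto
  show "(w \<star> (\<lambda>c. u c + v c)) l = (w \<star> u) l + (w \<star> v) l"
  proof (cases "l \<in> Cls")
    case True
    have "(w \<star> (\<lambda>c. u c + v c)) l = (\<Sum>a\<in>?A. \<Sum>b\<in>?B. w a * (u b + v b) * g a b l)"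
      by (rule times_eq[OF f(1) order_refl f(2) _ True]) auto
    moreover have "(w \<star> u) l = (\<Sum>a\<in>?A. \<Sum>b\<in>?B. w a * u b * g a b l)"
      by (rule times_eq[OF f(1) order_refl f(2) _ True]) auto
    moreover have "(w \<star> v) l = (\<Sum>a\<in>?A. \<Sum>b\<in>?B. w a * v b * g a b l)"
      by (rule times_eq[OF f(1) order_refl f(2) _ True]) auto
    ultimately show ?thesis by (simp add: distrib_left distrib_right sum.distrib)
  qed (simp add: times_outside)
qed

lemma times_smult:
  assumes "fin_supp u" "fin_supp v"
  shows "(\<lambda>c. r * u c) \<star> v = (\<lambda>c. r * (u \<star> v) c)" "u \<star> (\<lambda>c. r * v c) = (\<lambda>c. r * (u \<star> v) c)"
proof -
  have f: "finite (supp u)" "finite (supp v)" using assms by auto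
  have "((\<lambda>c. r * u c) \<star> v) l = r * (u \<star> v) l \<and> (u \<star> (\<lambda>c. r * v c)) l = r * (u \<star> v) l" for l
  proof (cases "l \<in> Cls")
    case True
    have "((\<lambda>c. r * u c) \<star> v) l = (\<Sum>a\<in>supp u. \<Sum>b\<in>supp v. (r * u a) * v b * g a b l)"
      by (rule times_eq[OF f(1) _ f(2) order_refl True]) auto
    moreover have "(u \<star> (\<lambda>c. r * v c)) l = (\<Sum>a\<in>supp u. \<Sum>b\<in>supp v. u a * (r * v b) * g a b l)"
      by (rule times_eq[OF f(1) order_refl f(2) _ True]) auto
    moreover have "(u \<star> v) l = (\<Sum>a\<in>supp u. \<Sum>b\<in>supp v. u a * v b * g a b l)"
      by (rule times_eq[OF f(1) order_refl f(2) order_refl True])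
    ultimately show ?thesis by (simp add: sum_distrib_left ac_simps)
  qed (simp add: times_outside)
  then show "(\<lambda>c. r * u c) \<star> v = (\<lambda>c. r * (u \<star> v) c)" "u \<star> (\<lambda>c. r * v c) = (\<lambda>c. r * (u \<star> v) c)"
    by auto
qed

lemma times_one:
  assumes u: "fin_supp u"
  shows "(\<lambda>c. if c = z then 1 else 0) \<star> u = u" "u \<star> (\<lambda>c. if c = z then 1 else 0) = u"
proof -
  let ?e = "\<lambda>c. if c = z then 1 else (0 :: rat)"
  have "(?e \<star> u) l = u l \<and> (u \<star> ?e) l = u l" for l
  proof (cases "l \<in> Cls")
    case True
    have f: "finite (supp u)" "finite {z}" "supp ?e \<subseteq> {z}" using u by auto
    have "(?e \<star> u) l = (\<Sum>b\<in>supp u. u b * g z b l)"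
      using times_eq[OF f(2,3,1) order_refl True] by simp
    also have "\<dots> = (\<Sum>b\<in>supp u. if b = l then u b else 0)"
      using u unit_left True by (intro sum.cong) auto
    finally have 1: "(?e \<star> u) l = u l" using f(1) by simp
    have "(u \<star> ?e) l = (\<Sum>a\<in>supp u. u a * g a z l)"
      using times_eq[OF f(1) order_refl f(2,3) True] by simp
    also have "\<dots> = (\<Sum>a\<in>supp u. if a = l then u a else 0)"
      using u unit_right True by (intro sum.cong) auto
    finally show ?thesis using 1 f(1) by simp
  next
    case False
    then show ?thesis using u times_outside[of l] by auto
  qed
  then show "?e \<star> u = u" "u \<star> ?e = u" by auto
qed

lemma associative_algebra_structure: "associative_algebra rat_ring (structure_algebra Cls g z)"
proof (intro associative_algebra.intro associative_algebra_axioms.intro)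
  let ?A = "structure_algebra Cls g z"
  have car: "u \<in> carrier ?A \<longleftrightarrow> fin_supp u" for u by (simp add: structure_algebra_def)
  have sel: "\<zero>\<^bsub>?A\<^esub> = (\<lambda>_. 0)" "\<one>\<^bsub>?A\<^esub> = (\<lambda>c. if c = z then 1 else 0)"
    "\<And>u v. u \<oplus>\<^bsub>?A\<^esub> v = (\<lambda>c. u c + v c)" "\<And>u v. u \<otimes>\<^bsub>?A\<^esub> v = u \<star> v"
    "\<And>r u. r \<odot>\<^bsub>?A\<^esub> u = (\<lambda>c. r * u c)"
    by (simp_all add: structure_algebra_def)
  have ag: "abelian_group ?A"
  proof (rule abelian_groupI)
    fix u assume "u \<in> carrier ?A"
    then have "(\<lambda>c. - u c) \<in> carrier ?A" using fin_supp_smult[of u "- 1"] unfolding car by simp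
    then show "\<exists>v\<in>carrier ?A. v \<oplus>\<^bsub>?A\<^esub> u = \<zero>\<^bsub>?A\<^esub>" by (intro bexI[of _ "\<lambda>c. - u c"]) (auto simp: sel)
  qed (use fin_supp_add in \<open>auto simp: car sel\<close>)
  show "Module.module rat_ring ?A"
    by (rule moduleI[OF cring_rat_ring ag])
      (use fin_supp_smult in \<open>auto simp: car sel rat_ring_def distrib_left distrib_right\<close>)
  have "monoid ?A"
    by (rule monoidI) (use times_closed times_assoc times_one z in \<open>auto simp: car sel\<close>)
  then show "ring ?A"
    by (rule ringI[OF ag]) (use times_add_left times_add_right in \<open>auto simp: car sel\<close>)
  fix r u v assume "u \<in> carrier ?A" "v \<in> carrier ?A"
  then show "(r \<odot>\<^bsub>?A\<^esub> u) \<otimes>\<^bsub>?A\<^esub> v = r \<odot>\<^bsub>?A\<^esub> (u \<otimes>\<^bsub>?A\<^esub> v)"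
    "u \<otimes>\<^bsub>?A\<^esub> (r \<odot>\<^bsub>?A\<^esub> v) = r \<odot>\<^bsub>?A\<^esub> (u \<otimes>\<^bsub>?A\<^esub> v)"
    unfolding sel car using times_smult by blast+
qed

end

section \<open>The Hall algebra\<close>

context hall_setting
begin

text \<open>Compare with \<open>0 -> L = L\<close>: the five lemma turns a deflation with zero
  cocone into an isomorphism, and transport gives the converse.\<close>

lemma deflation_with_zero_cocone:
  assumes O': "zero_object C O'" and [simp]: "ob L" "ob Y"
  shows "g \<in> deflations_with_cocone C O' L Y \<longleftrightarrow> iso_arr C L Y g"
proof -
  have [simp]: "ob O'" using O' unfolding zero_object_def by simp
  note t0 = tri_zero_idt[OF O' assms(2)]
  show ?thesis unfolding deflations_with_cocone_iff[OF \<open>ob O'\<close>]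
  proof
    assume "\<exists>f \<delta>. tri O' L Y f g \<delta>"
    then obtain f \<delta> where t: "tri O' L Y f g \<delta>" by blast
    note [simp] = triD[OF t]
    have f: "f = zro O' L" using zero_object_arr(1)[OF O', of f] by simp
    have "\<exists>g'. mutually_inverse g g'"
      by (rule tri_right_iso[OF t0 t mutually_inverse_idt[of O'] _ mutually_inverse_idt[of L]])
        (simp_all add: f tri_pull_zero[OF t])
    then show "iso_arr C L Y g" by (auto simp: iso_arr_iff)
  next
    assume "iso_arr C L Y g"
    then obtain g' where g: "mutually_inverse g g'" "\<guillemotleft>g : L \<rightarrow> Y\<guillemotright>"
      using mutually_inverse_simps(1) by (auto simp: iso_arr_iff)
    have "tri O' L Y (idt L \<bullet> (zro O' L \<bullet> idt O')) (g \<bullet> (idt L \<bullet> idt L))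
        (push Y (idt O') (pull O' g' (ex0 L O')))"
      by (rule tri_transport[OF t0 mutually_inverse_idt _ mutually_inverse_idt _ g]) simp_all
    then show "\<exists>f \<delta>. tri O' L Y f g \<delta>" using g(2) by auto
  qed
qed

text \<open>For \<open>L = Y\<close> the deflations are the automorphisms of \<open>Y\<close> and
  the brace factor is one; if \<open>L\<close> and \<open>Y\<close> are not isomorphic, there are no
  such deflations.\<close>

lemma hall_number_unit_left:
  assumes O': "zero_object C O'" and "ob Y" "ob L"
  shows "hall_number_defl C S O' Y L = (if isomorphic C L Y then 1 else 0)"
proof (cases "isomorphic C L Y")
  case True
  have [simp]: "ob O'" using O' unfolding zero_object_def by simp
  have "deflations_with_cocone C O' Y Y = Aut C Y"
    unfolding Aut_def using deflation_with_zero_cocone[OF O' assms(2,2)] by blast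
  moreover have "b Y Y \<noteq> 0" using b_pos[of Y Y] assms by simp
  moreover have "Aut C Y \<noteq> {}" using idt_in_Aut[OF assms(2)] by auto
  ultimately have "hall_number_defl C S O' Y Y = 1"
    unfolding hall_number_defl_def using assms(2) by simp
  then show ?thesis
    using hall_number_iso[of O' O' Y Y L Y] True isomorphic_refl assms by simp
next
  case False
  then have "deflations_with_cocone C O' L Y = {}"
    using deflation_with_zero_cocone[OF O' assms(3,2)] unfolding isomorphic_def by blast
  then show ?thesis unfolding hall_number_defl_def using False by simp
qed

text \<open>The left unit law in \<open>opp C\<close>, read through the equality of the deflation
  and inflation forms.\<close>

lemma hall_number_unit_right:
  assumes O': "zero_object C O'" and "ob X" "ob L"
  shows "hall_number_defl C S X O' L = (if isomorphic C L X then 1 else 0)"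
proof -
  have [simp]: "ob O'" using O' unfolding zero_object_def by simp
  have "hall_number_defl C S X O' L = hall_number_defl (opp C) T O' X L"
    using hall_number_duality[of X O' L] hall_number_opp[of X O' L] assms by simp
  also have "\<dots> = (if isomorphic (opp C) L X then 1 else 0)"
    by (rule hall_setting.hall_number_unit_left[OF hall_setting_opp]) (use assms in simp_all)
  finally show ?thesis using isomorphic_opp[OF linear_category_axioms] assms by simp
qed

text \<open>The unit is indexed by the set of all zero objects, which therefore has to be one of the
  labels of the basis.\<close>

lemma zero_object_class:
  assumes O': "zero_object C O'" shows "{Z. zero_object C Z} = iso_class C O'"
proof (intro equalityI subsetI)
  have [simp]: "ob O'" "idt O' = zro O' O'" using O' unfolding zero_object_def by simp_all
  fix Z assume "Z \<in> {Z. zero_object C Z}"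
  then have [simp]: "ob Z" "idt Z = zro Z Z" unfolding zero_object_def by simp_all
  have "mutually_inverse (zro O' Z) (zro Z O')" by (rule mutually_inverseI[of _ O' Z]) simp_all
  then have "isomorphic C O' Z" by (rule isomorphicI) simp_all
  then show "Z \<in> iso_class C O'" unfolding iso_class_def by simp
next
  have O1: "ob O'" "idt O' = zro O' O'" using O' unfolding zero_object_def by simp_all
  fix Z assume "Z \<in> iso_class C O'"
  then have Z: "ob Z" "isomorphic C O' Z" unfolding iso_class_def by simp_all
  obtain f f' where f: "mutually_inverse f f'" "\<guillemotleft>f : O' \<rightarrow> Z\<guillemotright>"
    using isomorphicE[OF Z(2) O1(1) Z(1)] by blast
  note s = mutually_inverse_simps[OF f(1)]
  have "idt Z = f \<bullet> (idt O' \<bullet> f')" using s f(2) by simp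
  also have "\<dots> = zro Z Z" unfolding O1(2) using s f(2) O1(1) Z(1) by simp
  finally show "Z \<in> {Z. zero_object C Z}" using Z(1) unfolding zero_object_def by simp
qed

lemma hall_algebra_eq:
  "hall_algebra C S = structure_algebra (iso_classes C)
     (\<lambda>a b l. hall_number_defl C S (rep a) (rep b) (rep l)) {Z. zero_object C Z}"
  unfolding hall_algebra_def structure_algebra_def hall_mult_def structure_mult_def basis_vec_def
  by (simp add: fun_eq_iff)

theorem associative_hall_algebra: "associative_algebra rat_ring (hall_algebra C S)"
proof -
  obtain O' where O': "zero_object C O'" using ex_zero_object by blast
  have [simp]: "ob O'" using O' unfolding zero_object_def by simp
  let ?z = "{Z. zero_object C Z}"
  have z: "?z = iso_class C O'" by (rule zero_object_class[OF O'])
  have zc: "?z \<in> iso_classes C" unfolding z by simp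
  have "rep ?z \<in> ?z" unfolding rep_def using O' by (intro someI[of "\<lambda>X. X \<in> ?z" O']) simp
  then have rz: "zero_object C (rep ?z)" by simp
  have iso: "isomorphic C (rep a) (rep c) \<longleftrightarrow> a = c" if "a \<in> iso_classes C" "c \<in> iso_classes C" for a c
    using iso_class_eq_iff[of "rep a" "rep c"] rep_iso_class[OF that(1)] rep_iso_class[OF that(2)] by simp
  show ?thesis unfolding hall_algebra_eq
  proof (rule structure_constants.associative_algebra_structure, unfold_locales)
    show "?z \<in> iso_classes C" by (rule zc)
  next
    fix a c assume "a \<in> iso_classes C" "c \<in> iso_classes C"
    then show "finite {l \<in> iso_classes C. hall_number_defl C S (rep a) (rep c) (rep l) \<noteq> 0}"
      using finite_middle_classes rep_iso_class(1) by blast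
  next
    fix c l assume "c \<in> iso_classes C" "l \<in> iso_classes C"
    then show "hall_number_defl C S (rep ?z) (rep c) (rep l) = (if l = c then 1 else 0)"
      "hall_number_defl C S (rep c) (rep ?z) (rep l) = (if l = c then 1 else 0)"
      using hall_number_unit_left[OF rz] hall_number_unit_right[OF rz] iso rep_iso_class(1) by simp_all
  next
    fix a c d l assume "a \<in> iso_classes C" "c \<in> iso_classes C" "d \<in> iso_classes C" "l \<in> iso_classes C"
    then show "(\<Sum>m\<in>{m \<in> iso_classes C. hall_number_defl C S (rep a) (rep c) (rep m) \<noteq> 0}.
        hall_number_defl C S (rep a) (rep c) (rep m) * hall_number_defl C S (rep m) (rep d) (rep l)) =
      (\<Sum>n\<in>{n \<in> iso_classes C. hall_number_defl C S (rep c) (rep d) (rep n) \<noteq> 0}.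
        hall_number_defl C S (rep c) (rep d) (rep n) * hall_number_defl C S (rep a) (rep n) (rep l))"
      using rep_iso_class(1) by (intro hall_number_assoc) blast+
  qed
qed

text \<open>The multiplication is defined through chosen representatives;
  \<open>hall_number_iso\<close> removes them.\<close>

lemma basis_vec_mult:
  assumes "ob X" "ob Y" "ob L"
  shows "(basis_vec (iso_class C X) \<otimes>\<^bsub>hall_algebra C S\<^esub> basis_vec (iso_class C Y)) (iso_class C L) =
    hall_number_defl C S X Y L"
proof -
  have "{a. basis_vec c a \<noteq> 0} = {c}" for c :: "'o set" unfolding basis_vec_def by auto
  then have "(basis_vec (iso_class C X) \<otimes>\<^bsub>hall_algebra C S\<^esub> basis_vec (iso_class C Y)) (iso_class C L) =
      hall_number_defl C S (rep (iso_class C X)) (rep (iso_class C Y)) (rep (iso_class C L))"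
    unfolding hall_algebra_def hall_mult_def using assms by (simp add: basis_vec_def)
  also have "\<dots> = hall_number_defl C S X Y L"
    using assms rep_iso_class(1)[OF iso_class_in] isomorphic_rep isomorphic_sym
    by (intro hall_number_iso) simp_all
  finally show ?thesis .
qed

end

theorem theorem6p4:
  fixes K :: "'k ring"
    and C :: "('k, 'o, 'm, 'e) ext_data"
    and S T :: "('o, 'm, 'e) syzygies"
  assumes finite_field: "field K" "finite (carrier K)"
    and extriangulated: "extriangulated_category K C"
    and krull_schmidt: "krull_schmidt C"
    and choices: "syzygy_choice C S" "syzygy_choice (opp C) T"
    and a: "enough_projectives C" "enough_injectives C"
    and b: "negext_finite K C (negext_I C S)" "negext_finite K C (negext_II C T)"
    and c: "\<And>I A B x. injective C I \<Longrightarrow> inflation C A B x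
              \<Longrightarrow> inj_on (\<lambda>h. x \<cdot>\<^bsub>C\<^esub> h) (arr C I A)"
    and d: "\<And>P B Z y. projective C P \<Longrightarrow> deflation C B Z y
              \<Longrightarrow> inj_on (\<lambda>h. h \<cdot>\<^bsub>C\<^esub> y) (arr C Z P)"
  shows "(\<forall>X \<in> Obj C. \<forall>Y \<in> Obj C. brace_I C S X Y = brace_II C T X Y) \<and>
         (\<forall>X \<in> Obj C. \<forall>Y \<in> Obj C. \<forall>L \<in> Obj C.
            hall_number_defl C S X Y L = hall_number_infl C S X Y L) \<and>
         (\<forall>X \<in> Obj C. \<forall>Y \<in> Obj C. \<forall>L \<in> Obj C.
            (basis_vec (iso_class C X) \<otimes>\<^bsub>hall_algebra C S\<^esub> basis_vec (iso_class C Y)) (iso_class C L)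
              = hall_number_defl C S X Y L) \<and>
         associative_algebra rat_ring (hall_algebra C S)"
proof -
  have "hall_setting K C S T"
    by (intro hall_setting.intro hall_setting_axioms.intro extriangulated finite_field choices a b)
      (fact c, fact d)
  then interpret hall_setting K C S T .
  show ?thesis
    using brace_balance hall_number_duality basis_vec_mult associative_hall_algebra by blast
qed

end
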